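(* For any $w\in S_n$, the weighted sum over generic pipe dreams $$\mathcal{E}_w=\sum_{\pi\in\mathsf{GPD}(w)}\operatorname{weight}(\pi)$$ is a polynomial representative of the elliptic Schubert class $\mathbf{E}_w$ (of $\operatorname{GL}_n$).
   Context: **Functions.** For a lattice $\Lambda$, $\mathbb{Q}[\Lambda]=\bigoplus_{\mu\in\Lambda}\mathbb{Q}\,e^{\pi i\mu}$ is the group algebra (formal symbols $e^{\pi i \mu}$). For $u\in\Lambda$, $\theta(u)=(e^{\pi iu}-e^{-\pi iu})\prod_{m>0}(1-q^me^{2\pi iu})(1-q^me^{-2\pi iu})\in\mathbb{Q}[\Lambda][[q]]$ is the Jacobi theta function, treated formally, and $$\mathsf{P}(x,y)=\frac{\theta(x-y)\theta(\hbar)}{\theta(y+\hbar)\theta(x)},\qquad \mathsf{Q}(x,y)=\frac{\theta(x+\hbar)\theta(y)}{\theta(y+\hbar)\theta(x)}.$$ **Elliptic Schubert classes for $\operatorname{GL}_n$.** Let $W=S_n$, $\Lambda=\bigoplus_{i=1}^n\mathbb{Z}z_i\oplus\bigoplus_{i=1}^n\mathbb{Z}\lambda_i\oplus\mathbb{Z}\hbar$, $\mathcal{Q}=\operatorname{Frac}\mathbb{Q}[\Lambda][[q]]$. $W\times W$ acts on $\mathcal{Q}$ by ${}^{wv^{\mathsf d}}z_i=z_{w(i)}$, ${}^{wv^{\mathsf d}}\lambda_i=\lambda_{v(i)}$, fixing $\hbar,q$. $\mathcal{Q}_{W^2}$ is the free left $\mathcal{Q}$-module with basis $\{\delta_w\delta_v^{\mathsf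 d}\}_{w,v\in W}$ and product $a\,\delta_w\delta_v^{\mathsf d}\cdot a'\,\delta_{w'}\delta_{v'}^{\mathsf d}=a\cdot{}^{wv^{\mathsf d}}a'\,\delta_{ww'}\delta_{vv'}^{\mathsf d}$. For $1\le i\le n-1$ let $T_i=\delta_{s_i}^{\mathsf d}\big(\mathsf{P}(z_i-z_{i+1},\lambda_i-\lambda_{i+1})+\mathsf{Q}(z_i-z_{i+1},\lambda_i-\lambda_{i+1})\delta_{s_i}\big)$; these satisfy the Coxeter relations of $S_n$ (known), so $T_w$ is defined for $w\in S_n$. Define $b_{u,w}\in\mathcal{Q}$ by $\delta_u=\sum_{w\le u}b_{u,w}\,\delta^{\mathsf d}_{w^{-1}}T_w$ (Bruhat order; $b_{u,w}=0$ for $w\not\le u$). The elliptic Schubert class $\mathbf{E}_w\in\operatorname{Map}(W,\mathcal{Q})$ is $\mathbf{E}_w(u)=b_{u,w}$. **Polynomial representatives.** Let $\mathcal{P}=\mathbb{Q}[\Lambda'][[q]]$ with $\Lambda'=\bigoplus_i\mathbb{Z}x_i\oplus\bigoplus_i\mathbb{Z}y_i\oplus\bigoplus_i\mathbb{Z}\lambda_i\oplus\mathbb{Z}\hbar$ ($1\le i\le n$). The localization map is the ring homomorphism $\operatorname{Loc}:\mathcal{P}\to\operatorname{Map}(W,\mathcal{Q})$ given by $\operatorname{Loc}(f(x,y,\lambda))(u)=f(uz,z,\lambda)$, where $uz=(z_{u(1)},\ldots,z_{u(n)})$; that is, one substitutes $x_i\mapsto z_{u(i)}$, $y_i\mapsto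 z_i$. A polynomial representative of $\mathbf{E}_w$ is an element $\mathcal{E}_w\in\mathcal{P}$ such that $\operatorname{Loc}(\mathcal{E}_w)=\mathbf{E}_w$. **Generic pipe dreams.** A generic pipe dream is a tiling of the $n\times n$ grid (rows $1,\dots,n$ top to bottom, columns $1,\ldots,n$ left to right) by the following seven tiles, so that pipes match along common edges: - $\mathrm{X}$ (cross): a pipe from left side to right side and a pipe from bottom side to top side, crossing; - $\mathrm{B}$ (bump): a pipe from left side to top side and another pipe from bottom side to right side; - $\mathrm{H}$: one pipe from left to right; $\mathrm{J}$: one pipe from left to top; $\mathrm{I}$: one pipe from bottom to top; $\mathrm{F}$: one pipe from bottom to right; $\mathrm{O}$: empty. Boundary conditions: on the left boundary a pipe enters each row (the pipe entering row $i$ is pipe $i$); on the top boundary a pipe leaves each column; no pipe meets the right or the bottom boundary. $\mathsf{GPD}(w)$ is the set of generic pipe dreams in which, for all $i$, pipe $i$ goes to the $w(i)$-th position of the upper boundary. **Level.** The level is defined for tiles containing exactly one pipe (types F, J, I, H), as follows. Walk along each pipe starting from its source on the left boundary, keeping a number in mind, which is $0$ at the source. Each time a tile F, J, I or H is met, its level is defined to be the number in mind; then the number is increased by $1$ if the tile met is H, and by $-1$ if the tile met is I (and otherwise is unchanged). **Weights.** The weight of a tile at row $i$, column $j$ is as follows, with $a$ the index of the pipe entering the tile from its left side, $b$ the index of the pipe entering it from its bottom side, and $c$ the level: X: $\mathsf{Q}(\lambda_a-\lambda_b,y_j-x_i)$; B: $\mathsf{P}(\lambda_a-\lambda_b,y_j-x_i)$;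 H: $\mathsf{Q}(\lambda_a-c\hbar,y_j-x_i)$; J: $\mathsf{P}(\lambda_a-c\hbar,y_j-x_i)$; I: $\mathsf{Q}(c\hbar-\lambda_b,y_j-x_i)$; F: $\mathsf{P}(c\hbar-\lambda_b,y_j-x_i)$; O: $1$. $\operatorname{weight}(\pi)$ is the product of the weights of all tiles of $\pi$.
   Formalization: In the weights of tiles I and F the level c is replaced by c−1 (the stated weights fail for n=2, w=id), and the representative lies in the localization of 𝒫 at elements nonzero under every substitution x_i↦z_{u(i)}, y_i↦z_i, not in 𝒫 itself, since the weights have non-invertible denominators. *)

theory Defs
  imports
    "HOL-Analysis.Analysis"
    "HOL-Library.Poly_Mapping"
    "HOL-Computational_Algebra.Computational_Algebra"
    "HOL-Combinatorics.Permutations"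
begin

section \<open>Lattices, group algebras and the Jacobi theta function\<close>

text \<open>
  The lattice with generators \<^typ>\<open>'v\<close> (for \<open>z\<^sub>i\<close>, or for \<open>x\<^sub>i\<close> and \<open>y\<^sub>i\<close>),
  \<open>\<lambda>\<^sub>i\<close> and \<open>\<hbar>\<close> is the free abelian group \<open>'v gen \<Rightarrow>\<^sub>0 int\<close>, and its group algebra over the
  rationals is a second layer of \<^theory>\<open>HOL-Library.Poly_Mapping\<close>.  Indices are natural
  numbers; for \<open>GL\<^sub>n\<close> only the indices \<open>1, \<dots>, n\<close> occur.
\<close>

datatype 'v gen = Var 'v | Lam nat | Hbar
datatype xyvar = X nat | Y nat

instance gen :: (countable) countable by countable_datatype
instance xyvar :: countable by countable_datatype

text \<open>
  An arbitrary linear order on the generators.  It has no mathematical meaning; it only serves to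
  make the library's instances derive that the group algebra is an integral domain.
\<close>

instantiation gen :: (countable) linorder
begin

definition less_eq_gen :: "'a gen \<Rightarrow> 'a gen \<Rightarrow> bool" where
  "less_eq_gen a b \<longleftrightarrow> to_nat a \<le> to_nat b"

definition less_gen :: "'a gen \<Rightarrow> 'a gen \<Rightarrow> bool" where
  "less_gen a b \<longleftrightarrow> to_nat a < to_nat b"

instance
  by standard (auto simp: less_eq_gen_def less_gen_def)

end

type_synonym 'v lattice = "'v gen \<Rightarrow>\<^sub>0 int"
type_synonym 'v galg = "'v lattice \<Rightarrow>\<^sub>0 rat"
type_synonym 'v series = "'v galg fps"
type_synonym 'v frac = "'v series fract"

abbreviation var :: "'v \<Rightarrow> 'v lattice" where "var v \<equiv> frag_of (Var v)"
abbreviation lam :: "nat \<Rightarrow> 'v lattice" where "lam i \<equiv> frag_of (Lam i)"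
abbreviation hbar :: "'v lattice" where "hbar \<equiv> frag_of Hbar"

text \<open>\<open>ex \<mu>\<close> is the formal symbol \<open>e\<^bsup>\<pi>i\<mu>\<^esup>\<close>; the variable \<open>q\<close> is \<^term>\<open>fps_X\<close>.\<close>

definition ex :: "'v lattice \<Rightarrow> 'v galg" where
  "ex \<mu> = Poly_Mapping.single \<mu> 1"

definition theta :: "('v::countable) lattice \<Rightarrow> 'v series" where
  "theta u = fps_const (ex u - ex (- u)) *
     prodinf (\<lambda>m. (1 - fps_X ^ Suc m * fps_const (ex (frag_cmul 2 u))) *
                  (1 - fps_X ^ Suc m * fps_const (ex (frag_cmul (-2) u))))"

definition Pfun :: "('v::countable) lattice \<Rightarrow> 'v lattice \<Rightarrow> 'v frac" where
  "Pfun x y = Fract (theta (x - y) * theta hbar) (theta (y + hbar) * theta x)"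

definition Qfun :: "('v::countable) lattice \<Rightarrow> 'v lattice \<Rightarrow> 'v frac" where
  "Qfun x y = Fract (theta (x + hbar) * theta y) (theta (y + hbar) * theta x)"

section \<open>Substitution of generators\<close>

text \<open>
  The ring homomorphism of \<open>\<rat>[\<Lambda>][[q]]\<close> induced by a map of generators, and the partial extension
  of a ring homomorphism to fractions.  \<open>frac_extend h x\<close> is meaningful if \<open>x\<close> can be written as
  \<open>a / b\<close> with \<open>h b \<noteq> 0\<close>, and then its value is \<open>h a / h b\<close>, whatever the choice of \<open>a\<close> and \<open>b\<close>.
\<close>

definition galg_map :: "('v lattice \<Rightarrow> 'w lattice) \<Rightarrow> 'v galg \<Rightarrow> 'w galg" where
  "galg_map \<phi> p =
     (\<Sum>\<mu>\<in>Poly_Mapping.keys p. Poly_Mapping.single (\<phi> \<mu>) (Poly_Mapping.lookup p \<mu>))"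

definition series_subst :: "('v gen \<Rightarrow> 'w gen) \<Rightarrow> 'v series \<Rightarrow> 'w series" where
  "series_subst \<sigma> f = Abs_fps (\<lambda>k. galg_map (frag_extend (\<lambda>g. frag_of (\<sigma> g))) (fps_nth f k))"

definition frac_extend :: "('a::idom \<Rightarrow> 'b::idom) \<Rightarrow> 'a fract \<Rightarrow> 'b fract" where
  "frac_extend h x = (THE y. \<exists>a b. h b \<noteq> 0 \<and> x = Fract a b \<and> y = Fract (h a) (h b))"

section \<open>The twisted group algebra and the elliptic Schubert classes\<close>

fun act_gen :: "(nat \<Rightarrow> nat) \<Rightarrow> (nat \<Rightarrow> nat) \<Rightarrow> nat gen \<Rightarrow> nat gen" where
  "act_gen w v (Var i) = Var (w i)"
| "act_gen w v (Lam i) = Lam (v i)"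
| "act_gen w v Hbar = Hbar"

definition act :: "(nat \<Rightarrow> nat) \<Rightarrow> (nat \<Rightarrow> nat) \<Rightarrow> nat frac \<Rightarrow> nat frac" where
  "act w v = frac_extend (series_subst (act_gen w v))"

abbreviation Sym :: "nat \<Rightarrow> (nat \<Rightarrow> nat) set" where
  "Sym n \<equiv> {w. w permutes {1..n}}"

text \<open>
  An element of \<open>\<Q>\<^bsub>W\<^sup>2\<^esub>\<close> is given by its coefficients: \<open>f w v\<close> is the coefficient
  of \<open>\<delta>\<^sub>w \<delta>\<^sup>d\<^sub>v\<close>, and it vanishes unless \<open>w\<close> and \<open>v\<close> are in \<^term>\<open>Sym n\<close>.
\<close>

type_synonym twisted = "(nat \<Rightarrow> nat) \<Rightarrow> (nat \<Rightarrow> nat) \<Rightarrow> nat frac"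

definition basis :: "(nat \<Rightarrow> nat) \<Rightarrow> (nat \<Rightarrow> nat) \<Rightarrow> twisted" where
  "basis w v = (\<lambda>w' v'. if w' = w \<and> v' = v then 1 else 0)"

definition tw_add :: "twisted \<Rightarrow> twisted \<Rightarrow> twisted" where
  "tw_add f g = (\<lambda>w v. f w v + g w v)"

definition tw_scale :: "nat frac \<Rightarrow> twisted \<Rightarrow> twisted" where
  "tw_scale a f = (\<lambda>w v. a * f w v)"

definition tw_mult :: "nat \<Rightarrow> twisted \<Rightarrow> twisted \<Rightarrow> twisted" where
  "tw_mult n f g = (\<lambda>w v. if w \<in> Sym n \<and> v \<in> Sym n
     then (\<Sum>w1\<in>Sym n. \<Sum>v1\<in>Sym n. f w1 v1 * act w1 v1 (g (inv w1 \<circ> w) (inv v1 \<circ> v)))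
     else 0)"

abbreviation simple_refl :: "nat \<Rightarrow> nat \<Rightarrow> nat" where
  "simple_refl i \<equiv> Transposition.transpose i (Suc i)"

definition T_gen :: "nat \<Rightarrow> nat \<Rightarrow> twisted" where
  "T_gen n i =
     tw_mult n (basis id (simple_refl i))
       (tw_add
         (tw_scale (Pfun (var i - var (Suc i)) (lam i - lam (Suc i))) (basis id id))
         (tw_scale (Qfun (var i - var (Suc i)) (lam i - lam (Suc i))) (basis (simple_refl i) id)))"

definition word_perm :: "nat list \<Rightarrow> nat \<Rightarrow> nat" where
  "word_perm is = foldr (\<lambda>i w. simple_refl i \<circ> w) is id"

definition word_of :: "nat \<Rightarrow> nat list \<Rightarrow> (nat \<Rightarrow> nat) \<Rightarrow> bool" where
  "word_of n is w \<longleftrightarrow> set is \<subseteq> {1..<n} \<and> word_perm is = w"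

definition cox_length :: "nat \<Rightarrow> (nat \<Rightarrow> nat) \<Rightarrow> nat" where
  "cox_length n w = (LEAST k. \<exists>is. word_of n is w \<and> length is = k)"

definition bruhat_le :: "nat \<Rightarrow> (nat \<Rightarrow> nat) \<Rightarrow> (nat \<Rightarrow> nat) \<Rightarrow> bool" where
  "bruhat_le n =
     (\<lambda>u v. \<exists>i\<in>{1..n}. \<exists>j\<in>{1..n}. i \<noteq> j \<and> v = u \<circ> Transposition.transpose i j \<and>
        cox_length n u < cox_length n v)\<^sup>*\<^sup>*"

text \<open>The choice of the reduced word is immaterial, as the \<^term>\<open>T_gen n i\<close> satisfy the Coxeter relations.\<close>

definition T_elem :: "nat \<Rightarrow> (nat \<Rightarrow> nat) \<Rightarrow> twisted" where
  "T_elem n w =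
     foldr (\<lambda>i t. tw_mult n (T_gen n i) t)
       (SOME is. word_of n is w \<and> length is = cox_length n w) (basis id id)"

text \<open>The unique family with \<open>\<delta>\<^sub>u = \<Sum>\<^bsub>w \<le> u\<^esub> b\<^bsub>u,w\<^esub> \<delta>\<^sup>d\<^bsub>w\<inverse>\<^esub> T\<^sub>w\<close>, extended by zero.\<close>

definition b_coeff :: "nat \<Rightarrow> (nat \<Rightarrow> nat) \<Rightarrow> (nat \<Rightarrow> nat) \<Rightarrow> nat frac" where
  "b_coeff n = (THE b.
     (\<forall>u w. \<not> (u \<in> Sym n \<and> w \<in> Sym n \<and> bruhat_le n w u) \<longrightarrow> b u w = 0) \<and>
     (\<forall>u\<in>Sym n. basis u id =
        (\<lambda>w' v'. \<Sum>w\<in>{w \<in> Sym n. bruhat_le n w u}.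
           tw_scale (b u w) (tw_mult n (basis id (inv w)) (T_elem n w)) w' v')))"

definition elliptic_class :: "nat \<Rightarrow> (nat \<Rightarrow> nat) \<Rightarrow> (nat \<Rightarrow> nat) \<Rightarrow> nat frac" where
  "elliptic_class n w = (\<lambda>u. b_coeff n u w)"

section \<open>Localization and polynomial representatives\<close>

definition poly_ring :: "nat \<Rightarrow> xyvar series set" where
  "poly_ring n = {f. \<forall>k. \<forall>\<mu>\<in>Poly_Mapping.keys (fps_nth f k). Poly_Mapping.keys \<mu> \<subseteq>
     Var ` (X ` {1..n} \<union> Y ` {1..n}) \<union> Lam ` {1..n} \<union> {Hbar}}"

fun loc_gen :: "(nat \<Rightarrow> nat) \<Rightarrow> xyvar gen \<Rightarrow> nat gen" where
  "loc_gen u (Var (X i)) = Var (u i)"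
| "loc_gen u (Var (Y i)) = Var i"
| "loc_gen u (Lam i) = Lam i"
| "loc_gen u Hbar = Hbar"

text \<open>
  The weights below have denominators such as \<open>\<theta>(\<lambda>\<^sub>a - \<lambda>\<^sub>b)\<close> and \<open>\<theta>(y\<^sub>j - x\<^sub>i + \<hbar>)\<close>, which are not
  invertible in \<^term>\<open>poly_ring n\<close>.  Representatives are therefore taken in the localization of
  \<^term>\<open>poly_ring n\<close> at the multiplicative set of those \<open>b\<close> all of whose substitutions
  \<open>x\<^sub>i \<mapsto> z\<^bsub>u(i)\<^esub>\<close>, \<open>y\<^sub>i \<mapsto> z\<^sub>i\<close> are non-zero; the localization map extends to that ring.
\<close>

definition localizable :: "nat \<Rightarrow> xyvar frac \<Rightarrow> bool" where
  "localizable n F \<longleftrightarrow> (\<exists>a\<in>poly_ring n. \<exists>b\<in>poly_ring n.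
     F = Fract a b \<and> (\<forall>u\<in>Sym n. series_subst (loc_gen u) b \<noteq> 0))"

definition Loc :: "xyvar frac \<Rightarrow> (nat \<Rightarrow> nat) \<Rightarrow> nat frac" where
  "Loc F u = frac_extend (series_subst (loc_gen u)) F"

definition polynomial_representative ::
    "nat \<Rightarrow> ((nat \<Rightarrow> nat) \<Rightarrow> nat frac) \<Rightarrow> xyvar frac \<Rightarrow> bool" where
  "polynomial_representative n E F \<longleftrightarrow> localizable n F \<and> (\<forall>u\<in>Sym n. Loc F u = E u)"

section \<open>Generic pipe dreams\<close>

datatype tile = TX | TB | TH | TJ | TI | TF | TO

definition has_left :: "tile \<Rightarrow> bool" where "has_left t \<longleftrightarrow> t \<in> {TX, TB, TH, TJ}"
definition has_bottom :: "tile \<Rightarrow> bool" where "has_bottom t \<longleftrightarrow> t \<in> {TX, TB, TI, TF}"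
definition has_right :: "tile \<Rightarrow> bool" where "has_right t \<longleftrightarrow> t \<in> {TX, TB, TH, TF}"
definition has_top :: "tile \<Rightarrow> bool" where "has_top t \<longleftrightarrow> t \<in> {TX, TB, TJ, TI}"

text \<open>\<open>\<pi> i j\<close> is the tile in row \<open>i\<close> and column \<open>j\<close>; outside the grid it is \<^term>\<open>TO\<close> by convention.\<close>

definition generic_pipe_dream :: "nat \<Rightarrow> (nat \<Rightarrow> nat \<Rightarrow> tile) \<Rightarrow> bool" where
  "generic_pipe_dream n \<pi> \<longleftrightarrow>
     (\<forall>i j. \<not> (i \<in> {1..n} \<and> j \<in> {1..n}) \<longrightarrow> \<pi> i j = TO) \<and>
     (\<forall>i\<in>{1..n}. \<forall>j\<in>{1..<n}. has_right (\<pi> i j) = has_left (\<pi> i (Suc j))) \<and>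
     (\<forall>i\<in>{1..<n}. \<forall>j\<in>{1..n}. has_bottom (\<pi> i j) = has_top (\<pi> (Suc i) j)) \<and>
     (\<forall>i\<in>{1..n}. has_left (\<pi> i 1) \<and> \<not> has_right (\<pi> i n)) \<and>
     (\<forall>j\<in>{1..n}. has_top (\<pi> 1 j) \<and> \<not> has_bottom (\<pi> n j))"

datatype side = FromLeft | FromBottom

fun exits_right :: "side \<Rightarrow> tile \<Rightarrow> bool" where
  "exits_right FromLeft t \<longleftrightarrow> t \<in> {TX, TH}"
| "exits_right FromBottom t \<longleftrightarrow> t \<in> {TB, TF}"

fun exits_top :: "side \<Rightarrow> tile \<Rightarrow> bool" where
  "exits_top FromLeft t \<longleftrightarrow> t \<in> {TB, TJ}"
| "exits_top FromBottom t \<longleftrightarrow> t \<in> {TX, TI}"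

definition increment :: "tile \<Rightarrow> int" where
  "increment t = (if t = TH then 1 else if t = TI then -1 else 0)"

text \<open>
  \<open>walk n \<pi> p i j d c\<close>: pipe \<open>p\<close> enters the tile \<open>(i, j)\<close> from side \<open>d\<close>, with the number \<open>c\<close>
  in mind at that moment.
\<close>

inductive walk ::
    "nat \<Rightarrow> (nat \<Rightarrow> nat \<Rightarrow> tile) \<Rightarrow> nat \<Rightarrow> nat \<Rightarrow> nat \<Rightarrow> side \<Rightarrow> int \<Rightarrow> bool"
  for n \<pi> where
  source: "p \<in> {1..n} \<Longrightarrow> walk n \<pi> p p 1 FromLeft 0"
| right: "walk n \<pi> p i j d c \<Longrightarrow> exits_right d (\<pi> i j) \<Longrightarrow>
    walk n \<pi> p i (Suc j) FromLeft (c + increment (\<pi> i j))"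
| up: "walk n \<pi> p (Suc i) j d c \<Longrightarrow> 1 \<le> i \<Longrightarrow> exits_top d (\<pi> (Suc i) j) \<Longrightarrow>
    walk n \<pi> p i j FromBottom (c + increment (\<pi> (Suc i) j))"

definition GPD :: "nat \<Rightarrow> (nat \<Rightarrow> nat) \<Rightarrow> (nat \<Rightarrow> nat \<Rightarrow> tile) set" where
  "GPD n w = {\<pi>. generic_pipe_dream n \<pi> \<and>
     (\<forall>i\<in>{1..n}. \<exists>d c. walk n \<pi> i 1 (w i) d c \<and> exits_top d (\<pi> 1 (w i)))}"

definition pipe_from :: "nat \<Rightarrow> (nat \<Rightarrow> nat \<Rightarrow> tile) \<Rightarrow> nat \<Rightarrow> nat \<Rightarrow> side \<Rightarrow> nat" where
  "pipe_from n \<pi> i j d = (THE p. \<exists>c. walk n \<pi> p i j d c)"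

definition level :: "nat \<Rightarrow> (nat \<Rightarrow> nat \<Rightarrow> tile) \<Rightarrow> nat \<Rightarrow> nat \<Rightarrow> int" where
  "level n \<pi> i j = (THE c. \<exists>p d. walk n \<pi> p i j d c)"

text \<open>
  The number in mind counts the empty strands that currently lie above and to the left of the pipe
  (an H tile adds one, an I tile removes one).  Hence a pipe entering an H or J tile
  with the number \<open>c\<close> meets the strand with index \<open>c\<close>, counting from 0, whereas a pipe entering an
  I or F tile with the number \<open>c\<close> meets the last strand already counted, whose index is \<open>c - 1\<close>.
  This is why \<open>c - 1\<close> appears in the weights of I and F.  With \<open>c \<hbar> - \<lambda>\<^sub>b\<close> there instead,
  the sum over \<open>GPD(id)\<close> for \<open>n = 2\<close> would localize at \<open>id\<close> to
  \<open>P(\<lambda>\<^sub>2, y) P(\<lambda>\<^sub>2, -y) + Q(\<lambda>\<^sub>2, y) Q(\<hbar> - \<lambda>\<^sub>2, -y)\<close> with \<open>y = z\<^sub>1 - z\<^sub>2\<close>.  This has a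
  pole at \<open>\<lambda>\<^sub>2 = \<hbar>\<close>, while the elliptic class of the identity takes the value 1 there.
\<close>

definition tile_weight :: "nat \<Rightarrow> (nat \<Rightarrow> nat \<Rightarrow> tile) \<Rightarrow> nat \<Rightarrow> nat \<Rightarrow> xyvar frac" where
  "tile_weight n \<pi> i j =
     (let a = pipe_from n \<pi> i j FromLeft;
          b = pipe_from n \<pi> i j FromBottom;
          c = level n \<pi> i j;
          y = var (Y j) - var (X i)
      in case \<pi> i j of
           TX \<Rightarrow> Qfun (lam a - lam b) y
         | TB \<Rightarrow> Pfun (lam a - lam b) y
         | TH \<Rightarrow> Qfun (lam a - frag_cmul c hbar) y
         | TJ \<Rightarrow> Pfun (lam a - frag_cmul c hbar) y
         | TI \<Rightarrow> Qfun (frag_cmul (c - 1) hbar - lam b) y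
         | TF \<Rightarrow> Pfun (frag_cmul (c - 1) hbar - lam b) y
         | TO \<Rightarrow> 1)"

definition gpd_weight :: "nat \<Rightarrow> (nat \<Rightarrow> nat \<Rightarrow> tile) \<Rightarrow> xyvar frac" where
  "gpd_weight n \<pi> = (\<Prod>i\<in>{1..n}. \<Prod>j\<in>{1..n}. tile_weight n \<pi> i j)"

end

(*
  The generators delta_s and T_s determine each other, with the two arguments of P and Q exchanged,
  so the coefficients b(u,w) are the partition functions of a lattice model in which n lines cross:
  colours are carried along the lines, colours a and b bounce with weight P(lambda_a - lambda_b, z)
  or cross with weight Q(lambda_a - lambda_b, z).  All identities of P and Q follow from the
  three-term relation of theta, which is a Pluecker relation: by the Jacobi triple product,
  theta(u) theta(v) is a 2 x 2 determinant of series in u + v and u - v.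

  A generic pipe dream becomes a configuration of the n x n grid of 2n lines once the empty strands
  are coloured too, the c-th one with lambda = c hbar.  Neighbouring empty strands then never cross,
  as Q(-hbar, z) = 0, and bounce with weight P(-hbar, z) = 1.  By the Yang-Baxter equation the
  crossing of two columns can be moved from the bottom of the grid, where it acts trivially on the
  empty strands, to the top; this is the recursion of b(u,w) under left multiplication of u.  For
  u = id the row and column parameters agree and the grid is trivial.

  The Coxeter relations of the T_i are not used: the recursion says that the inverse of the matrix
  b(u,w) gives the expansion of any product of generators T_i.
*)
theory Submission
  imports Defs
begin

section \<open>Formal theta functions: substitution in the group algebra and truncation in q\<close>

section \<open>The group algebra and its power series\<close>

text \<open>Theta is a formal series, so arguments by zeros and quasi-periods are not at hand; this
  is why the three-term relation is derived from explicit series.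

  Empty strands cannot share one colour, because theta of a difference of colours stands in the
  denominator of every weight. Steps of hbar keep the colours distinct, and - hbar is the zero of
  theta(x + hbar) in Q at which the thetas of P cancel. Only neighbouring empty strands are
  controlled in this way; that others never cross in a nonzero term has to be proved from the order
  of the labels along each row. The same labels explain the level of a tile as a count of empty
  strands.

  The coefficients b(u,w), the levels and the localized values are definite descriptions, so
  uniqueness has to be proved with each. For b(u,w) it comes from the triangularity of the partition
  functions in Bruhat order: the expansion of delta_u says that b is a left inverse of the matrix C
  of coefficients of the elements delta^d(w^-1) T_w, and C turns out to be the inverse of the matrix
  of partition functions.\<close>

lemma poly_mapping_single_induct [case_names zero add]:
  fixes p :: "'a \<Rightarrow>\<^sub>0 'b::monoid_add"
  assumes "P 0" "\<And>a b f. P f \<Longrightarrow> P (Poly_Mapping.single a b + f)"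
  shows "P p"
proof (induction p rule: update_induct)
  case const
  show ?case by (fact assms)
next
  case (update f a b)
  have "Poly_Mapping.update a b f = Poly_Mapping.single a b + f"
    using update(1) by (intro poly_mapping_eqI)
      (auto simp: lookup_update lookup_add lookup_single when_def in_keys_iff)
  with assms(2)[OF update(3), of a b] show ?case by simp
qed

lemma ex_0 [simp]: "ex 0 = 1"
  by (simp add: ex_def)

lemma ex_add: "ex (a + b) = ex a * ex b"
  by (simp add: ex_def mult_single)

lemma ex_minus_mult [simp]: "ex a * ex (- a) = 1" "ex (- a) * ex a = 1"
  by (simp_all flip: ex_add)

lemma ex_inject [simp]: "ex a = ex b \<longleftrightarrow> a = b"
proof
  assume "ex a = ex b"
  then have "Poly_Mapping.keys (ex a) = Poly_Mapping.keys (ex b)"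
    by simp
  then show "a = b"
    by (simp add: ex_def)
qed simp

lemma galg_map_alt:
  assumes "finite A" "Poly_Mapping.keys p \<subseteq> A"
  shows "galg_map \<phi> p = (\<Sum>\<mu>\<in>A. Poly_Mapping.single (\<phi> \<mu>) (Poly_Mapping.lookup p \<mu>))"
  unfolding galg_map_def using assms
  by (intro sum.mono_neutral_left) (auto simp: in_keys_iff)

lemma galg_map_0 [simp]: "galg_map \<phi> 0 = 0"
  by (simp add: galg_map_def)

lemma galg_map_add: "galg_map \<phi> (p + q) = galg_map \<phi> p + galg_map \<phi> q"
proof -
  let ?A = "Poly_Mapping.keys p \<union> Poly_Mapping.keys q"
  have "galg_map \<phi> r = (\<Sum>\<mu>\<in>?A. Poly_Mapping.single (\<phi> \<mu>) (Poly_Mapping.lookup r \<mu>))"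
    if "r \<in> {p, q, p + q}" for r
    using that keys_add[of p q] by (intro galg_map_alt) auto
  then show ?thesis
    by (simp add: lookup_add single_add sum.distrib)
qed

lemma galg_map_single [simp]:
  "galg_map \<phi> (Poly_Mapping.single \<mu> c) = Poly_Mapping.single (\<phi> \<mu>) c"
  by (simp add: galg_map_def)

lemma galg_map_minus: "galg_map \<phi> (- p) = - galg_map \<phi> p"
  by (metis add_eq_0_iff galg_map_0 galg_map_add)

lemma galg_map_diff: "galg_map \<phi> (p - q) = galg_map \<phi> p - galg_map \<phi> q"
  by (metis galg_map_add galg_map_minus diff_conv_add_uminus)

lemma galg_map_sum: "galg_map \<phi> (sum f A) = (\<Sum>a\<in>A. galg_map \<phi> (f a))"
  by (induction A rule: infinite_finite_induct) (auto simp: galg_map_add)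

locale lattice_hom =
  fixes \<phi> :: "'v lattice \<Rightarrow> 'w lattice"
  assumes add: "\<phi> (a + b) = \<phi> a + \<phi> b"
begin

lemma zero [simp]: "\<phi> 0 = 0"
  using add[of 0 0] by simp

lemma minus: "\<phi> (- a) = - \<phi> a"
  by (metis add add.right_inverse add_eq_0_iff zero)

lemma galg_map_mult: "galg_map \<phi> (p * q) = galg_map \<phi> p * galg_map \<phi> q"
proof (induction p rule: poly_mapping_single_induct)
  case (add a b p)
  have "galg_map \<phi> (Poly_Mapping.single a b * q) = Poly_Mapping.single (\<phi> a) b * galg_map \<phi> q"
    by (induction q rule: poly_mapping_single_induct)
      (simp_all add: distrib_left galg_map_add mult_single lattice_hom.add[OF lattice_hom_axioms])
  with add show ?case
    by (simp add: distrib_right galg_map_add)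
qed simp

lemma galg_map_1 [simp]: "galg_map \<phi> 1 = 1"
  by (simp flip: single_one)

lemma galg_map_ex [simp]: "galg_map \<phi> (ex a) = ex (\<phi> a)"
  by (simp add: ex_def)

end

definition series_map :: "('v lattice \<Rightarrow> 'w lattice)
    \<Rightarrow> 'v series \<Rightarrow> 'w series" where
  "series_map \<phi> f = Abs_fps (\<lambda>k. galg_map \<phi> (fps_nth f k))"

lemma series_map_nth [simp]: "fps_nth (series_map \<phi> f) k = galg_map \<phi> (fps_nth f k)"
  by (simp add: series_map_def)

abbreviation gen_map :: "('v gen \<Rightarrow> 'w gen) \<Rightarrow> 'v lattice \<Rightarrow> 'w
    lattice" where
  "gen_map \<sigma> \<equiv> frag_extend (\<lambda>g. frag_of (\<sigma> g))"

lemma series_subst_conv: "series_subst \<sigma> = series_map (gen_map \<sigma>)"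
  by (simp add: fun_eq_iff series_subst_def series_map_def)

lemma lattice_hom_gen_map: "lattice_hom (gen_map \<sigma>)"
  by standard (rule frag_extend_add)

context lattice_hom
begin

lemma series_map_add: "series_map \<phi> (f + g) = series_map \<phi> f + series_map \<phi> g"
  by (intro fps_ext) (simp add: galg_map_add)

lemma series_map_diff: "series_map \<phi> (f - g) = series_map \<phi> f - series_map \<phi> g"
  by (intro fps_ext) (simp add: galg_map_diff)

lemma series_map_mult: "series_map \<phi> (f * g) = series_map \<phi> f * series_map \<phi> g"
  by (intro fps_ext) (simp add: fps_mult_nth galg_map_sum galg_map_mult)

lemma series_map_const: "series_map \<phi> (fps_const c) = fps_const (galg_map \<phi> c)"
  by (intro fps_ext) simp

lemma series_map_1 [simp]: "series_map \<phi> 1 = 1"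
  by (intro fps_ext) simp

lemma series_map_X [simp]: "series_map \<phi> fps_X = fps_X"
  by (intro fps_ext) simp

lemma series_map_power: "series_map \<phi> (f ^ k) = series_map \<phi> f ^ k"
  by (induction k) (simp_all add: series_map_mult)

lemma series_map_prod: "series_map \<phi> (prod f A) = (\<Prod>a\<in>A. series_map \<phi> (f a))"
  by (induction A rule: infinite_finite_induct) (auto simp: series_map_mult)

end

section \<open>Coefficients of the theta function\<close>

text \<open>Congruence modulo \<open>fps_X ^ (k + 1)\<close>. Statements about the infinite products
  are reduced to finite products in this form.\<close>

definition eq_upto :: "nat \<Rightarrow> 'a::zero fps \<Rightarrow> 'a fps \<Rightarrow> bool" where
  "eq_upto k f g \<longleftrightarrow> (\<forall>i\<le>k. fps_nth f i = fps_nth g i)"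

lemma eq_upto_refl [simp]: "eq_upto k f f"
  and eq_upto_sym: "eq_upto k f g \<Longrightarrow> eq_upto k g f"
  and eq_upto_trans [trans]: "eq_upto k f g \<Longrightarrow> eq_upto k g h \<Longrightarrow>
      eq_upto k f h"
  by (auto simp: eq_upto_def)

lemma eq_upto_mult:
  fixes f g :: "'a::comm_ring_1 fps"
  shows "eq_upto k f f' \<Longrightarrow> eq_upto k g g' \<Longrightarrow> eq_upto k (f * g) (f' *
      g')"
  by (auto simp: eq_upto_def fps_mult_nth intro!: sum.cong)

lemma eq_upto_sum:
  fixes f g :: "'b \<Rightarrow> 'a::comm_ring_1 fps"
  shows "(\<And>x. x \<in> A \<Longrightarrow> eq_upto k (f x) (g x)) \<Longrightarrow> eq_upto k
      (sum f A) (sum g A)"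
  by (auto simp: eq_upto_def fps_sum_nth)

lemma eq_upto_X_power:
  fixes f :: "'a::comm_ring_1 fps"
  shows "k < m \<Longrightarrow> eq_upto k (fps_X ^ m * f) 0"
  by (auto simp: eq_upto_def fps_X_power_mult_nth)

text \<open>A series with constant coefficient 1 is a unit modulo every power of q. Over a ring
  without division this is the recursion that determines coefficient i from the earlier
  ones.\<close>

lemma eq_upto_cancel:
  fixes f g :: "'a::comm_ring_1 fps"
  assumes "eq_upto k (c * f) (c * g)" "fps_nth c 0 = 1"
  shows "eq_upto k f g"
proof -
  have "fps_nth f i = fps_nth g i" if "i \<le> k" for i
    using that
  proof (induction i rule: less_induct)
    case (less i)
    have *: "fps_nth (c * h) i = fps_nth h i + (\<Sum>j=1..i. fps_nth c j * fps_nth h (i - j))"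
        for h
      unfolding fps_mult_nth by (subst sum.atLeast_Suc_atMost) (auto simp: assms(2))
    have "(\<Sum>j=1..i. fps_nth c j * fps_nth f (i - j)) = (\<Sum>j=1..i. fps_nth c j * fps_nth g
        (i - j))"
      using less by (intro sum.cong) auto
    with *[of f] *[of g] assms(1) less.prems show ?case
      by (simp add: eq_upto_def)
  qed
  then show ?thesis
    by (simp add: eq_upto_def)
qed

lemma eq_upto_prod_stable:
  fixes f :: "nat \<Rightarrow> 'a::comm_ring_1 fps"
  assumes "\<And>m. eq_upto m (f m) 1" "k \<le> M" "M \<le> N"
  shows "eq_upto k (\<Prod>m<N. f m) (\<Prod>m<M. f m)"
  using assms(3)
proof (induction N rule: dec_induct)
  case (step n)
  have "eq_upto k (f n) 1"
    using assms(1)[of n] assms(2) step(1) by (auto simp: eq_upto_def)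
  with step show ?case
    using eq_upto_mult[of k "\<Prod>m<n. f m" "\<Prod>m<M. f m" "f n" 1] by simp
qed simp

text \<open>The m-th factor is 1 modulo q^(m+1), so coefficient k no longer changes after the first
  k factors. The limit is the series of these stable coefficients.\<close>

lemma prodinf_nth:
  fixes f :: "nat \<Rightarrow> 'a::idom fps"
  assumes f: "\<And>m. eq_upto m (f m) 1"
  shows "eq_upto k (prodinf f) (\<Prod>m<k. f m)"
proof -
  define L where "L = Abs_fps (\<lambda>k. fps_nth (\<Prod>m<k. f m) k)"
  have L: "eq_upto k L (\<Prod>m<N. f m)" if "k \<le> N" for k N
    unfolding eq_upto_def L_def
  proof safe
    fix i assume "i \<le> k"
    then show "fps_nth (Abs_fps (\<lambda>k. fps_nth (\<Prod>m<k. f m) k)) i = fps_nth (\<Prod>m<N. f m) i"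
      using eq_upto_prod_stable[OF f, of i i N] that by (simp add: eq_upto_def)
  qed
  have "fps_nth L 0 = 1"
    by (simp add: L_def)
  \<comment> \<open>\<open>raw_has_prod\<close> asks for a nonzero limit; the constant coefficient 1
    provides it.\<close>
  then have "L \<noteq> 0"
    by (metis fps_zero_nth zero_neq_one)
  moreover have "(\<lambda>n. \<Prod>i\<le>n. f i) \<longlonglongrightarrow> L"
  proof (rule tendsto_fpsI)
    fix k
    show "eventually (\<lambda>n. fps_nth (\<Prod>i\<le>n. f i) k = fps_nth L k) sequentially"
      using eventually_ge_at_top[of k]
    proof eventually_elim
      case (elim n)
      then show ?case
        using L[of k "Suc n"] by (simp add: eq_upto_def lessThan_Suc_atMost)
    qed
  qed
  ultimately have "f has_prod L"
    by (simp add: has_prod_def raw_has_prod_def)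
  then have "prodinf f = L"
    by (metis has_prod_unique)
  with L[of k k] show ?thesis
    by simp
qed

definition theta_fin :: "('v::countable) lattice \<Rightarrow> nat \<Rightarrow> 'v series" where
  "theta_fin u N = fps_const (ex u - ex (- u)) *
     (\<Prod>m<N. (1 - fps_X ^ Suc m * fps_const (ex (frag_cmul 2 u))) *
             (1 - fps_X ^ Suc m * fps_const (ex (frag_cmul (-2) u))))"

lemma theta_factor_upto:
  fixes c d :: "'a::comm_ring_1"
  shows "eq_upto m ((1 - fps_X ^ Suc m * fps_const c) * (1 - fps_X ^ Suc m * fps_const d)) 1"
proof -
  have *: "eq_upto m (1 - fps_X ^ Suc m * fps_const c) 1" for c :: 'a
    using eq_upto_X_power[of m "Suc m" "fps_const c"] by (simp add: eq_upto_def)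
  show ?thesis
    using eq_upto_mult[OF *[of c] *[of d]] by simp
qed

lemma theta_upto:
  assumes "k \<le> N"
  shows "eq_upto k (theta u) (theta_fin u N)"
proof -
  let ?f = "\<lambda>m. (1 - fps_X ^ Suc m * fps_const (ex (frag_cmul 2 u))) *
             (1 - fps_X ^ Suc m * fps_const (ex (frag_cmul (-2) u)))"
  have "eq_upto k (prodinf ?f) (\<Prod>m<N. ?f m)"
    using prodinf_nth[of ?f k, OF theta_factor_upto] 
      eq_upto_prod_stable[of ?f k k N, OF theta_factor_upto order_refl assms]
    by (meson eq_upto_sym eq_upto_trans)
  then show ?thesis
    unfolding theta_def theta_fin_def by (intro eq_upto_mult) auto
qed

lemma theta_minus: "theta (- u) = - theta u"
proof -
  have 1: "ex (- u) - ex (- (- u)) = - (ex u - ex (- u))"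
    by simp
  have 2: "frag_cmul c (- u) = frag_cmul (- c) u" for c
    by (intro poly_mapping_eqI) simp
  show ?thesis
    unfolding theta_def 1 2 by (simp only: fps_const_neg [symmetric] mult_minus_left minus_minus
        mult.commute)
qed

lemma theta_0 [simp]: "theta 0 = 0"
  by (simp add: theta_def)

lemma theta_nth_0: "fps_nth (theta u) 0 = ex u - ex (- u)"
  using theta_upto[of 0 0 u] by (simp add: eq_upto_def theta_fin_def)

lemma lattice_double_eq_0: "u = - u \<longleftrightarrow> (u :: 'v lattice) = 0"
proof
  assume "u = - u"
  then have "Poly_Mapping.lookup u x = - Poly_Mapping.lookup u x" for x
    by (metis lookup_uminus)
  then show "u = 0"
    by (intro poly_mapping_eqI) (simp add: equal_neg_zero)
qed simp

text \<open>The constant coefficient \<open>ex u - ex (- u)\<close> already detects u, because the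
  lattice is torsion-free. Denominators are later shown to be nonzero by this criterion.\<close>

lemma theta_eq_0_iff [simp]: "theta u = 0 \<longleftrightarrow> u = 0"
proof
  assume "theta u = 0"
  then have "ex u = ex (- u)"
    using theta_nth_0[of u] by simp
  then show "u = 0"
    by (simp only: ex_inject lattice_double_eq_0)
qed simp

lemma (in lattice_hom) cmul: "\<phi> (frag_cmul c a) = frag_cmul c (\<phi> a)"
proof -
  have *: "\<phi> (frag_cmul (int n) a) = frag_cmul (int n) (\<phi> a)" for n
    by (induction n) (simp_all add: frag_cmul_distrib add)
  show ?thesis
    using *[of "nat c"] *[of "nat (- c)"] minus[of "frag_cmul (- c) a"]
    by (cases "c \<ge> 0") auto
qed

text \<open>Each coefficient of theta is a coefficient of a finite product, so no continuity of the
  substitution is involved.\<close>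

lemma series_map_theta:
  fixes \<phi> :: "('v::countable) lattice \<Rightarrow> ('w::countable) lattice"
  assumes "lattice_hom \<phi>"
  shows "series_map \<phi> (theta u) = theta (\<phi> u)"
proof (rule fps_ext)
  interpret lattice_hom \<phi> by fact
  fix k
  have "fps_nth (series_map \<phi> (theta u)) k = fps_nth (series_map \<phi> (theta_fin u k)) k"
    using theta_upto[of k k u] by (simp add: eq_upto_def)
  also have "series_map \<phi> (theta_fin u k) = theta_fin (\<phi> u) k"
    by (simp add: theta_fin_def series_map_mult series_map_prod series_map_diff series_map_const
        galg_map_diff minus cmul series_map_power)
  also have "fps_nth (theta_fin (\<phi> u) k) k = fps_nth (theta (\<phi> u)) k"
    using theta_upto[of k k "\<phi> u"] by (simp add: eq_upto_def)
  finally show "fps_nth (series_map \<phi> (theta u)) k = fps_nth (theta (\<phi> u)) k" .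
qed

section \<open>The three-term relation of theta by way of the Jacobi triple product\<close>

section \<open>The Jacobi triple product\<close>

text \<open>The q-Pochhammer symbol (q;q)_N.\<close>

definition qpoch :: "nat \<Rightarrow> 'a::idom fps" where
  "qpoch N = (\<Prod>j<N. 1 - fps_X ^ Suc j)"

lemma qpoch_0 [simp]: "qpoch 0 = 1"
  and qpoch_Suc: "qpoch (Suc N) = qpoch N * (1 - fps_X ^ Suc N)"
  by (simp_all add: qpoch_def)

lemma qpoch_nth_0: "fps_nth (qpoch N) 0 = 1"
  by (induction N) (simp_all add: qpoch_Suc)

lemma qpoch_stable: "n \<le> N \<Longrightarrow> eq_upto n (qpoch N) (qpoch n)"
  unfolding qpoch_def
proof (rule eq_upto_prod_stable)
  show "eq_upto m (1 - fps_X ^ Suc m) (1 :: 'a fps)" for m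
    using eq_upto_X_power[of m "Suc m" 1] by (simp add: eq_upto_def)
qed auto

text \<open>
  \<open>odd_coeff N k\<close> is the coefficient of \<open>t\<^bsup>2k+1\<^esup> - t\<^bsup>-2k-1\<^esup>\<close> in the \<open>N\<close>-th partial product of
  the theta function.
\<close>

fun odd_coeff :: "nat \<Rightarrow> nat \<Rightarrow> 'a::idom fps" where
  "odd_coeff 0 k = (if k = 0 then 1 else 0)"
| "odd_coeff (Suc N) 0 = (1 + fps_X ^ (2 * Suc N)) * odd_coeff N 0
     - fps_X ^ Suc N * (odd_coeff N 1 - odd_coeff N 0)"
| "odd_coeff (Suc N) (Suc k) = (1 + fps_X ^ (2 * Suc N)) * odd_coeff N (Suc k)
     - fps_X ^ Suc N * (odd_coeff N k + odd_coeff N (Suc (Suc k)))"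

lemma odd_coeff_eq_0: "N < k \<Longrightarrow> odd_coeff N k = 0"
proof (induction N arbitrary: k)
  case (Suc N)
  then show ?case
    by (cases k) auto
qed simp

definition tri :: "nat \<Rightarrow> 'a::idom fps" where
  "tri k = (- 1) ^ k * fps_X ^ (\<Sum>{..k})"

lemma tri_0 [simp]: "tri 0 = 1"
  and tri_Suc: "tri (Suc k) = - (fps_X ^ Suc k * tri k)"
  by (simp_all add: tri_def power_add)

text \<open>Up to the sign and the power of q in \<open>tri k\<close>, the coefficient is the
  Gaussian binomial coefficient of 2N+1 over N-k, here with denominators cleared. This is the
  q-binomial theorem for the 2N+1 factors 1 - q^m t^(-2) with m from -N to N; the induction checks
  it against the recursion.\<close>

lemma odd_coeff_closed:
  assumes "k \<le> N"
  shows "qpoch (N - k) * qpoch (N + 1 + k) * odd_coeff N k = tri k * qpoch (2 * N + 1)"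
  using assms
proof (induction N arbitrary: k)
  case 0
  then show ?case by simp
next
  case (Suc N)
  let ?q = "fps_X :: 'a fps"
  define A where "A = ?q ^ (Suc N - k)"
  define K where "K = ?q ^ k"
  define B where "B = K * K * A"
  define c where "c = tri k * (qpoch (2 * N + 1) :: 'a fps)"
  \<comment> \<open>The denominator of the claim for \<open>Suc N\<close>. Multiplied by it, the
    values of \<open>odd_coeff N\<close> at k, k+1 and k-1 become, up to powers of q, polynomials in
    A, K and q times c (these are X, Z' and Y), and the claim turns into a polynomial
    identity.\<close>
  define D where "D = qpoch (Suc N - k) * (qpoch (Suc N + 1 + k) :: 'a fps)"
  have KA: "?q ^ Suc N = K * A"
    unfolding K_def A_def using Suc.prems by (simp add: power_add[symmetric])
  have KKA: "?q ^ (Suc N + k) = B"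
    unfolding B_def power_add KA by (simp add: K_def mult_ac)
  have qp2: "D = qpoch (Suc N - k) * qpoch (N + 1 + k) * (1 - ?q * B)"
    unfolding D_def using KKA by (simp add: qpoch_Suc mult_ac)
  have X: "D * odd_coeff N k = (1 - A) * (1 - ?q * B) * c"
  proof (cases "k \<le> N")
    case True
    then have "Suc N - k = Suc (N - k)" by simp
    then have "qpoch (Suc N - k) = qpoch (N - k) * (1 - A)"
      unfolding A_def by (simp only: qpoch_Suc)
    with Suc.IH[OF True] show ?thesis
      unfolding qp2 c_def by (simp only:) algebra
  next
    case False
    then have "A = 1" "odd_coeff N k = (0 :: 'a fps)"
      using Suc.prems by (auto simp: A_def odd_coeff_eq_0)
    then show ?thesis by simp
  qed
  \<comment> \<open>The extra factor q turns 1 - q^(N-k) into q - A; it is cancelled in Z'. If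
    \<open>Suc k\<close> exceeds N, then A is 1 or q and both sides vanish.\<close>
  have Z: "?q * (D * odd_coeff N (Suc k)) = - ((1 - A) * (?q - A) * ?q * K * c)"
  proof (cases "Suc k \<le> N")
    case True
    define A' where "A' = ?q ^ (N - k)"
    have A': "A = ?q * A'"
      using Suc.prems True by (simp add: A_def A'_def Suc_diff_le)
    have "Suc N - k = Suc (Suc (N - Suc k))" "N - k = Suc (N - Suc k)"
      using True by auto
    then have 1: "qpoch (Suc N - k) = qpoch (N - Suc k) * (1 - A') * (1 - A)"
      unfolding A_def A'_def by (simp only: qpoch_Suc)
    have 2: "N + 1 + Suc k = Suc N + 1 + k"
      by simp
    have "D * odd_coeff N (Suc k) = (1 - A') * (1 - A) * (tri (Suc k) * qpoch (2 * N + 1))"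
      using Suc.IH[OF True] unfolding D_def 1 2 by algebra
    moreover have "tri (Suc k) = - (?q * K * tri k)"
      by (simp add: tri_Suc K_def)
    ultimately show ?thesis
      unfolding c_def A' by algebra
  next
    case False
    then have "k = N \<or> k = Suc N"
      using Suc.prems by auto
    then have "odd_coeff N (Suc k) = (0 :: 'a fps)"
      by (auto simp: odd_coeff_eq_0)
    moreover have "A = 1 \<or> A = ?q"
      unfolding A_def using \<open>k = N \<or> k = Suc N\<close>
      by (metis One_nat_def Suc_diff_Suc diff_self_eq_0 lessI power_0 power_one_right)
    ultimately show ?thesis by auto
  qed
  have rhs: "tri k * qpoch (2 * Suc N + 1) = (1 - A * B) * (1 - ?q * (A * B)) * c"
  proof -
    have "A * B = ?q ^ (2 * N + 2)"
      unfolding B_def using KA by (metis (no_types, lifting)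
          add_Suc_right mult.assoc mult.commute mult_2 numeral_2_eq_2 power_add add_2_eq_Suc'
          add.right_neutral add_Suc)
    then have *: "?q ^ Suc (Suc (2 * N)) = A * B" "?q ^ Suc (Suc (Suc (2 * N))) = ?q * (A * B)"
      by simp_all
    have "2 * Suc N + 1 = Suc (Suc (2 * N + 1))" by simp
    then show ?thesis
      unfolding c_def by (simp only: qpoch_Suc) (use * in \<open>simp add: mult_ac\<close>)
  qed
  have q2: "?q ^ (2 * Suc N) = K * A * (K * A)"
    by (metis KA mult_2 power_add)
  have q0: "?q \<noteq> 0"
    by simp
  have Z': "D * odd_coeff N (Suc k) = - ((1 - A) * (?q - A) * K * c)"
    using Z q0 by (metis (no_types, opaque_lifting) mult.assoc mult.commute mult_cancel_left
        mult_minus_right)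
  have "D * odd_coeff (Suc N) k = (1 - A * B) * (1 - ?q * (A * B)) * c"
  proof (cases k)
    case 0
    then have "K = 1" "B = A"
      by (simp_all add: K_def B_def)
    with X Z' 0 show ?thesis
      unfolding odd_coeff.simps 0 q2 KA by (simp only: One_nat_def) algebra
  next
    case (Suc k')
    have K: "?q ^ Suc k' = K"
      by (simp add: K_def Suc)
    have "k' \<le> N"
      using Suc Suc.prems by simp
    note IH = Suc.IH[OF this]
    have 1: "Suc N - k = N - k'" "N + 1 + k = Suc (N + 1 + k')" "Suc (N + 1 + k') = Suc N + k"
      using Suc by auto
    have 2: "D = qpoch (N - k') * qpoch (N + 1 + k') * (1 - B) * (1 - ?q * B)"
      unfolding qp2 1(1) unfolding 1(2) qpoch_Suc unfolding 1(3) KKA by simp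
    have "D * odd_coeff N k' = (1 - B) * (1 - ?q * B) * (tri k' * qpoch (2 * N + 1))"
      using IH unfolding 2 by algebra
    moreover have "c = - (K * (tri k' * qpoch (2 * N + 1)))"
      unfolding c_def Suc tri_Suc K by simp
    ultimately have Y: "K * (D * odd_coeff N k') = - ((1 - B) * (1 - ?q * B) * c)"
      by algebra
    show ?thesis
      unfolding Suc odd_coeff.simps q2 KA
      using X Y Z' unfolding Suc B_def by algebra
  qed
  then show ?case
    unfolding rhs D_def by simp
qed

context
  fixes t s :: "'a::idom"
  assumes ts: "t * s = 1"
begin

lemma odd_power_diff_step:
  "(t^2 + s^2) * (t ^ (2 * k + 3) - s ^ (2 * k + 3)) =
    (t ^ (2 * k + 5) - s ^ (2 * k + 5)) + (t ^ (2 * k + 1) - s ^ (2 * k + 1))"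
proof -
  have "s\<^sup>2 * t ^ (2 * k + 3) = (t * s) ^ 2 * t ^ (2 * k + 1)"
    "t\<^sup>2 * s ^ (2 * k + 3) = (t * s) ^ 2 * s ^ (2 * k + 1)"
    by (simp_all add: power_add power_mult_distrib power2_eq_square power3_eq_cube mult_ac)
  moreover have "t\<^sup>2 * t ^ (2 * k + 3) = t ^ (2 * k + 5)" "s\<^sup>2 * s ^ (2 * k + 3) = s ^ (2 * k + 5)"
    by (simp_all add: add.commute flip: power_add)
  ultimately show ?thesis
    using ts by (simp add: distrib_left distrib_right right_diff_distrib)
qed

abbreviation (input) pdiff where "pdiff k \<equiv> fps_const (t ^ (2 * k + 1) - s ^ (2 * k + 1))"

text \<open>Multiplication by t^2 + s^2 sends \<open>pdiff k\<close> to the sum of its two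
  neighbours. At k = 0 the lower neighbour is t^(-1) - s^(-1) = s - t, hence the correction by minus
  \<open>b 0 * pdiff 0\<close>.\<close>

lemma odd_power_sum_step:
  fixes b :: "nat \<Rightarrow> 'a fps"
  shows "(\<Sum>k\<le>n. b k * (fps_const (t^2 + s^2) * pdiff k)) =
    - (b 0 * pdiff 0) + (\<Sum>k\<le>n. b k * pdiff (Suc k)) + (\<Sum>k<n. b (Suc k) * pdiff k)"
proof (induction n)
  case 0
  have "(t^2 + s^2) * (t - s) = t^3 - s^3 - (t - s) + (t * s - 1) * (s - t)"
    by algebra
  then have "fps_const (t^2 + s^2) * pdiff 0 = pdiff 1 - pdiff 0"
    using ts by simp
  then have "b 0 * (fps_const (t^2 + s^2) * pdiff 0) = - (b 0 * pdiff 0) + b 0 * pdiff 1"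
    by (simp only: right_diff_distrib) simp
  then show ?case
    by (simp only: atMost_0 sum.insert finite.emptyI empty_iff not_False_eq_True sum.empty
        lessThan_0 add_0_right One_nat_def)
next
  case (Suc n)
  have "fps_const (t^2 + s^2) * pdiff (Suc n) = pdiff (Suc (Suc n)) + pdiff n"
    using odd_power_diff_step[of n] by (simp add: eval_nat_numeral)
  then show ?case
    by (simp only: sum.atMost_Suc sum.lessThan_Suc Suc.IH distrib_left) (simp only: ac_simps)
qed

lemma finite_triple_product:
  "fps_const (t - s) * (\<Prod>m<N. (1 - fps_X ^ Suc m * fps_const (t^2)) *
      (1 - fps_X ^ Suc m * fps_const (s^2))) = (\<Sum>k\<le>N. odd_coeff N k * pdiff k)"
proof (induction N)
  case 0
  show ?case by simp
next
  case (Suc N)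
  let ?Q = "fps_X ^ Suc N :: 'a fps" and ?a = "odd_coeff N :: nat \<Rightarrow> 'a fps"
  have "fps_const (t^2) * fps_const (s^2) = fps_const ((t * s)^2)"
    by (simp add: power_mult_distrib)
  then have 1: "fps_const (t^2) * fps_const (s^2) = 1"
    by (simp add: ts)
  have 2: "fps_X ^ (2 * Suc N) = ?Q * ?Q"
    by (simp only: mult_2 power_add)
  have expand: "(1 - Q * T) * (1 - Q * U) = (1 + Q * Q) - Q * (T + U)" if "T * U = 1" for Q T U ::
      "'a fps"
    using that by algebra
  have "fps_const (t - s) * (\<Prod>m<Suc N. (1 - fps_X ^ Suc m * fps_const (t^2)) *
      (1 - fps_X ^ Suc m * fps_const (s^2))) =
     (\<Sum>k\<le>N. ?a k * pdiff k) * ((1 - ?Q * fps_const (t^2)) * (1 - ?Q * fps_const (s^2)))"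
    unfolding prod.lessThan_Suc Suc.IH [symmetric] by (simp only: mult_ac)
  also have "(1 - ?Q * fps_const (t^2)) * (1 - ?Q * fps_const (s^2)) =
     (1 + fps_X ^ (2 * Suc N)) - ?Q * fps_const (t^2 + s^2)"
    unfolding 2 fps_const_add [symmetric] by (rule expand) (fact 1)
  also have "(\<Sum>k\<le>N. ?a k * pdiff k) * \<dots> = (1 + fps_X ^ (2 * Suc N)) * (\<Sum>k\<le>N. ?a k *
      pdiff k)
      - ?Q * (\<Sum>k\<le>N. ?a k * (fps_const (t^2 + s^2) * pdiff k))"
    by (simp only: right_diff_distrib sum_distrib_left sum_distrib_right sum_subtractf mult_ac)
  also have "(\<Sum>k\<le>N. ?a k * (fps_const (t^2 + s^2) * pdiff k)) =
      - (?a 0 * pdiff 0) + (\<Sum>k\<le>N. ?a k * pdiff (Suc k)) + (\<Sum>k<N. ?a (Suc k) * pdiff k)"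
    by (rule odd_power_sum_step)
  also have "(\<Sum>k<N. ?a (Suc k) * pdiff k) = (\<Sum>k\<le>Suc N. ?a (Suc k) * pdiff k)"
    by (simp add: odd_coeff_eq_0 atMost_Suc lessThan_Suc_atMost[symmetric] lessThan_Suc)
  also have "(\<Sum>k\<le>N. ?a k * pdiff k) = (\<Sum>k\<le>Suc N. ?a k * pdiff k)"
    by (simp add: odd_coeff_eq_0)
  also have "(1 + fps_X ^ (2 * Suc N)) * (\<Sum>k\<le>Suc N. ?a k * pdiff k) - ?Q *
      (- (?a 0 * pdiff 0) + (\<Sum>k\<le>N. ?a k * pdiff (Suc k)) + (\<Sum>k\<le>Suc N. ?a (Suc k) *
          pdiff k)) =
      (\<Sum>k\<le>Suc N. odd_coeff (Suc N) k * pdiff k)"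
    unfolding sum.atMost_Suc_shift odd_coeff.simps
    by (simp add: algebra_simps sum.distrib sum_subtractf sum_distrib_left del: power_Suc)
  finally show ?case .
qed

text \<open>With 2n factors and k at most n, all q-Pochhammer symbols in the closed form have index
  at least n, so each is congruent to \<open>qpoch n\<close>, and one of them cancels. For k above n
  both sides vanish to this order, as \<open>tri k\<close> is divisible by q^k.\<close>

lemma triple_product_upto:
  "eq_upto n (qpoch n * (fps_const (t - s) * (\<Prod>m<2*n. (1 - fps_X ^ Suc m * fps_const (t^2)) *
      (1 - fps_X ^ Suc m * fps_const (s^2))))) (\<Sum>k\<le>2*n. tri k * pdiff k)"
  unfolding finite_triple_product sum_distrib_left
proof (rule eq_upto_sum)
  fix k assume k: "k \<in> {..2 * n}"
  let ?a = "odd_coeff (2 * n) k :: 'a fps"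
  let ?N = "2 * n"
  have closed: "qpoch (?N - k) * qpoch (?N + 1 + k) * ?a = tri k * qpoch (2 * ?N + 1)"
    using odd_coeff_closed[of k ?N] k by simp
  have "eq_upto n (qpoch n * ?a) (tri k)"
  proof (cases "k \<le> n")
    case True
    have "eq_upto n (qpoch n * (qpoch n * ?a)) (qpoch (?N - k) * (qpoch (?N + 1 + k) * ?a))"
      using True by (intro eq_upto_mult eq_upto_refl eq_upto_sym[OF qpoch_stable]) auto
    also have "qpoch (?N - k) * (qpoch (?N + 1 + k) * ?a) = qpoch (2 * ?N + 1) * tri k"
      using closed by (simp add: mult_ac)
    also have "eq_upto n \<dots> (qpoch n * tri k)"
      by (intro eq_upto_mult eq_upto_refl qpoch_stable) auto
    finally show ?thesis
      by (rule eq_upto_cancel) (rule qpoch_nth_0)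
  next
    case False
    have "k \<le> \<Sum>{..k}"
      by (rule member_le_sum) auto
    then have tri0: "eq_upto n (tri k) (0 :: 'a fps)"
      using eq_upto_X_power[of n "\<Sum>{..k}" "(-1) ^ k :: 'a fps"] False
      by (simp add: tri_def mult.commute)
    let ?p = "qpoch (?N - k) * qpoch (?N + 1 + k) :: 'a fps"
    have "eq_upto n (?p * ?a) (0 * qpoch (2 * ?N + 1))"
      unfolding closed by (intro eq_upto_mult tri0) auto
    then have "eq_upto n (?p * ?a) (?p * 0)"
      by simp
    then have "eq_upto n ?a 0"
      by (rule eq_upto_cancel) (simp add: qpoch_nth_0)
    then have "eq_upto n (qpoch n * ?a) (qpoch n * 0)"
      by (intro eq_upto_mult) auto
    with tri0 show ?thesis
      by (metis eq_upto_sym eq_upto_trans mult_zero_right)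
  qed
  then show "eq_upto n (qpoch n * (?a * pdiff k)) (tri k * pdiff k)"
    unfolding mult.assoc[symmetric] by (intro eq_upto_mult) auto
qed

end

definition qpoch_inf :: "'a::idom fps" where
  "qpoch_inf = Abs_fps (\<lambda>n. fps_nth (qpoch n) n)"

lemma qpoch_inf_upto: "eq_upto n qpoch_inf (qpoch n :: 'a::idom fps)"
  unfolding eq_upto_def
proof safe
  fix i assume "i \<le> n"
  then show "fps_nth qpoch_inf i = fps_nth (qpoch n :: 'a fps) i"
    using qpoch_stable[of i n, where 'a = 'a] by (simp add: eq_upto_def qpoch_inf_def)
qed

lemma qpoch_inf_nonzero [simp]: "qpoch_inf \<noteq> 0"
proof -
  have "fps_nth qpoch_inf 0 = (1 :: 'a)"
    using qpoch_inf_upto[of 0] by (simp add: eq_upto_def)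
  then show ?thesis
    by (metis fps_zero_nth zero_neq_one)
qed

lemma ex_power: "ex u ^ k = ex (frag_cmul (int k) u)"
  by (induction k) (simp_all add: frag_cmul_distrib ex_add)

lemma theta_sum_upto:
  "eq_upto n (qpoch_inf * theta u)
     (\<Sum>k\<le>2*n. tri k * fps_const (ex (frag_cmul (int (2 * k + 1)) u) - ex (frag_cmul (- int
         (2 * k + 1)) u)))"
proof -
  have "eq_upto n (qpoch_inf * theta u) (qpoch n * theta_fin u (2 * n))"
    by (intro eq_upto_mult qpoch_inf_upto theta_upto) simp
  also have "frag_cmul c (- u) = frag_cmul (- c) u" for c
    by (intro poly_mapping_eqI) simp
  then have "eq_upto n (qpoch n * theta_fin u (2 * n))
     (\<Sum>k\<le>2*n. tri k * fps_const (ex (frag_cmul (int (2 * k + 1)) u) - ex (frag_cmul (- int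
         (2 * k + 1)) u)))"
    using triple_product_upto[OF ex_minus_mult(1)[of u], of n]
    unfolding theta_fin_def ex_power by simp
  finally show ?thesis .
qed

text \<open>The formal sum of F x times q^(Q x) over x in A, meaningful if Q has finite fibres on A.
  In this form theta series can be multiplied and re-indexed as sums over sets of integer
  pairs.\<close>

definition fibre_series :: "'i set \<Rightarrow> ('i \<Rightarrow> nat) \<Rightarrow>
    ('i \<Rightarrow> 'a) \<Rightarrow> 'a::comm_ring_1 fps" where
  "fibre_series A Q F = Abs_fps (\<lambda>n. \<Sum>x | x \<in> A \<and> Q x = n. F x)"

lemma fibre_series_mult:
  assumes "\<And>n. finite {x \<in> A. Q x = n}" "\<And>n. finite {x \<in> A'. Q' x = n}"
  shows "fibre_series A Q F * fibre_series A' Q' F' =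
    fibre_series (A \<times> A') (\<lambda>(x, y). Q x + Q' y) (\<lambda>(x, y). F x * F' y)"
proof (rule fps_ext)
  fix n
  let ?S = "\<lambda>i. {x \<in> A. Q x = i} \<times> {y \<in> A'. Q' y = n - i}"
  have "fps_nth (fibre_series A Q F * fibre_series A' Q' F') n =
    (\<Sum>i\<le>n. \<Sum>(x, y)\<in>?S i. F x * F' y)"
    by (simp add: fps_mult_nth fibre_series_def sum_product sum.cartesian_product atLeast0AtMost)
  also have "\<dots> = (\<Sum>(x, y)\<in>(\<Union>i\<le>n. ?S i). F x * F' y)"
    using assms by (intro sum.UNION_disjoint [symmetric]) auto
  also have "(\<Union>i\<le>n. ?S i) = {z. z \<in> A \<times> A' \<and> (case z of (x, y) \<Rightarrow> Q x + Q' y) =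
      n}"
    by auto
  finally show "fps_nth (fibre_series A Q F * fibre_series A' Q' F') n = fps_nth
      (fibre_series (A \<times> A') (\<lambda>(x, y). Q x + Q' y) (\<lambda>(x, y). F x * F' y)) n"
    by (simp add: fibre_series_def)
qed

lemma fibre_series_reindex:
  assumes "bij_betw h B A" "\<And>x. x \<in> B \<Longrightarrow> Q' x = Q (h x)"
      "\<And>x. x \<in> B \<Longrightarrow> F' x = F (h x)"
  shows "fibre_series A Q F = fibre_series B Q' F'"
proof (rule fps_ext)
  fix n
  have "bij_betw h {x. x \<in> B \<and> Q' x = n} {x. x \<in> A \<and> Q x = n}"
    unfolding bij_betw_def
  proof
    show "inj_on h {x. x \<in> B \<and> Q' x = n}"
      using assms(1) by (auto simp: bij_betw_def inj_on_def)
    show "h ` {x. x \<in> B \<and> Q' x = n} = {x. x \<in> A \<and> Q x = n}"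
    proof safe
      fix x assume "x \<in> A"
      then obtain y where "y \<in> B" "x = h y"
        using assms(1) by (auto simp: bij_betw_def)
      then show "x \<in> h ` {xa. xa \<in> B \<and> Q' xa = Q x}"
        using assms(2) by auto
    qed (use assms in \<open>auto simp: bij_betw_def\<close>)
  qed
  then have "(\<Sum>x | x \<in> B \<and> Q' x = n. F (h x)) = (\<Sum>x | x \<in> A \<and> Q x = n. F x)"
    by (rule sum.reindex_bij_betw)
  then have "(\<Sum>x | x \<in> B \<and> Q' x = n. F' x) = (\<Sum>x | x \<in> A \<and> Q x = n. F x)"
    using assms(3) by simp
  then show "fps_nth (fibre_series A Q F) n = fps_nth (fibre_series B Q' F') n"
    by (simp add: fibre_series_def)
qed

lemma fibre_series_union:
  assumes "\<And>n. finite {x \<in> A. Q x = n}" "\<And>n. finite {x \<in> B. Q x = n}" "A \<inter> B = {}"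
  shows "fibre_series (A \<union> B) Q F = fibre_series A Q F + fibre_series B Q F"
proof (rule fps_ext)
  fix n
  have "{x. x \<in> A \<union> B \<and> Q x = n} = {x \<in> A. Q x = n} \<union> {x \<in> B. Q x = n}"
    by auto
  moreover have "{x \<in> A. Q x = n} \<inter> {x \<in> B. Q x = n} = {}"
    using assms(3) by auto
  ultimately show "fps_nth (fibre_series (A \<union> B) Q F) n =
      fps_nth (fibre_series A Q F + fibre_series B Q F) n"
    using assms(1,2) by (simp add: fibre_series_def sum.union_disjoint)
qed

definition alt :: "int \<Rightarrow> 'a::comm_ring_1" where
  "alt m = (if even m then 1 else - 1)"

definition tri_int :: "int \<Rightarrow> nat" where
  "tri_int m = nat (m * (m + 1) div 2)"

lemma two_tri_int: "2 * int (tri_int m) = m * (m + 1)"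
proof -
  have "0 \<le> m * (m + 1)"
    by (cases "0 \<le> m") (auto intro: mult_nonneg_nonneg mult_nonpos_nonpos)
  moreover have "even (m * (m + 1))"
    by simp
  ultimately show ?thesis
    by (simp add: tri_int_def)
qed

lemma finite_tri_int: "finite {m. tri_int m = n}"
proof (rule finite_subset)
  show "{m. tri_int m = n} \<subseteq> {- int (2 * n) - 1..int (2 * n)}"
  proof safe
    fix m
    have *: "m * (m + 1) = 2 * int (tri_int m)"
      using two_tri_int[of m] by simp
    show "m \<in> {- int (2 * tri_int m) - 1..int (2 * tri_int m)}"
    proof (cases "0 \<le> m")
      case True
      then have "m * 1 \<le> m * (m + 1)"
        by (cases "m = 0") (auto intro: mult_left_mono)
      with True * show ?thesis by simp
    next
      case False
      then have "(- m - 1) * 1 \<le> (- m - 1) * (- m)"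
        by (intro mult_left_mono) auto
      also have "\<dots> = m * (m + 1)"
        by (simp add: algebra_simps)
      finally show ?thesis
        using False * by simp
    qed
  qed
qed simp

text \<open>The indices k and - k - 1 have the same triangular number, opposite signs and the
  exponents 2k+1 and -(2k+1). Together they make up the k-th term of the one-sided series.\<close>

lemma theta_eq_fibre_series:
  "qpoch_inf * theta u = fibre_series UNIV tri_int (\<lambda>m. alt m * ex (frag_cmul (2 * m + 1) u))"
  (is "_ = ?R")
proof (rule fps_ext)
  fix n :: nat
  let ?K = "{k. k \<le> 2 * n \<and> \<Sum>{..k} = n}"
  let ?F = "\<lambda>m. alt m * ex (frag_cmul (2 * m + 1) u)"
  have sumk: "\<Sum>{..k} = tri_int (int k)" for k :: nat
  proof -
    have "int k * (int k + 1) div 2 = int (k * Suc k div 2)"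
      by (simp add: zdiv_int algebra_simps)
    then show ?thesis
      using gauss_sum_nat[of k] by (simp add: tri_int_def atLeast0AtMost)
  qed
  have "fps_nth (qpoch_inf * theta u) n = (\<Sum>k\<le>2*n. fps_nth (tri k *
      fps_const (ex (frag_cmul (int (2 * k + 1)) u) - ex (frag_cmul (- int (2 * k + 1)) u))) n)"
    using theta_sum_upto[of n u] by (simp add: eq_upto_def fps_sum_nth)
  also have "\<dots> = (\<Sum>k\<le>2*n. if \<Sum>{..k} = n then ?F (int k) + ?F (- int k - 1) else 0)"
  proof (intro sum.cong refl)
    fix k
    have 1: "fps_nth (tri k) n = (if \<Sum>{..k} = n then alt (int k) else 0 :: 'a galg)"
    proof (cases "even k")
      case True
      then show ?thesis by (simp add: tri_def alt_def fps_X_power_nth)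
    next
      case False
      then show ?thesis by (simp add: tri_def alt_def fps_X_power_nth)
    qed
    have 2: "2 * (- int k - 1) + 1 = - int (2 * k + 1)" "2 * int k + 1 = int (2 * k + 1)"
      by simp_all
    have 3: "alt (- int k - 1) = (- alt (int k) :: 'a galg)"
      by (simp add: alt_def)
    show "fps_nth (tri k *
      fps_const (ex (frag_cmul (int (2 * k + 1)) u) - ex (frag_cmul (- int (2 * k + 1)) u))) n =
      (if \<Sum>{..k} = n then ?F (int k) + ?F (- int k - 1) else 0)"
      unfolding 2 3 fps_mult_right_const_nth 1 by (cases "\<Sum>{..k} = n")
          (simp_all only: right_diff_distrib mult_minus_left refl if_True if_False mult_zero_left
          diff_0_right add_uminus_conv_diff)
  qed
  also have "\<dots> = (\<Sum>k\<in>?K. ?F (int k) + ?F (- int k - 1))"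
    by (simp add: sum.If_cases Int_def)
  also have "\<dots> = (\<Sum>m\<in>int ` ?K. ?F m) + (\<Sum>m\<in>(\<lambda>k. - int k - 1) ` ?K. ?F m)"
    by (subst (1 2) sum.reindex) (auto simp: inj_on_def sum.distrib)
  also have "\<dots> = (\<Sum>m\<in>int ` ?K \<union> (\<lambda>k. - int k - 1) ` ?K. ?F m)"
    by (rule sum.union_disjoint [symmetric]) auto
  also have "int ` ?K \<union> (\<lambda>k. - int k - 1) ` ?K = {m. tri_int m = n}"
  proof (rule set_eqI)
    fix m
    have le: "k \<le> 2 * \<Sum>{..k}" for k :: nat
      using member_le_sum[of k "{..k}" "\<lambda>x. x"] by simp
    show "m \<in> int ` ?K \<union> (\<lambda>k. - int k - 1) ` ?K \<longleftrightarrow> m \<in> {m. tri_int m = n}"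
    proof (cases "0 \<le> m")
      case True
      then obtain k where k: "m = int k"
        by (metis nonneg_int_cases)
      show ?thesis
        unfolding k using le[of k] by (auto simp: sumk)
    next
      case False
      define k where "k = nat (- m - 1)"
      have k: "m = - int k - 1"
        using False by (simp add: k_def)
      have "tri_int m = tri_int (int k)"
        unfolding k tri_int_def by (simp add: algebra_simps)
      then show ?thesis
        unfolding k using le[of k] by (auto simp: sumk)
    qed
  qed
  finally show "fps_nth (qpoch_inf * theta u) n = fps_nth ?R n"
    by (simp add: fibre_series_def)
qed

section \<open>The three-term relation\<close>

text \<open>With \<open>theta_even\<close>, the two classical theta series in q^(s^2/4) over odd and
  over even s. The odd exponents are lowered by 1/4 to become integers; this is consistent because
  every product formed below has exactly one odd factor.\<close>

definition theta_odd :: "('v::countable) lattice \<Rightarrow> 'v series" where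
  "theta_odd p = fibre_series {s. odd s} (\<lambda>s. nat ((s\<^sup>2 - 1) div 4)) (\<lambda>s. ex (frag_cmul s p))"

definition theta_even :: "('v::countable) lattice \<Rightarrow> 'v series" where
  "theta_even p = fibre_series {s. even s} (\<lambda>s. nat (s\<^sup>2 div 4)) (\<lambda>s. ex (frag_cmul s p))"

lemma abs_le_square_int: "\<bar>s\<bar> \<le> (s::int)\<^sup>2"
proof (cases "s = 0")
  case False
  then have "\<bar>s\<bar> * 1 \<le> \<bar>s\<bar> * \<bar>s\<bar>"
    by (intro mult_left_mono) auto
  then show ?thesis
    by (simp add: power2_eq_square)
qed simp

lemma finite_square_fibre:
  assumes "\<And>s. s \<in> A \<Longrightarrow> s\<^sup>2 \<le> int (f (Q s))"
  shows "finite {s \<in> A. Q s = (n::nat)}"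
proof (rule finite_subset)
  show "{s \<in> A. Q s = n} \<subseteq> {- int (f n)..int (f n)}"
  proof safe
    fix s assume "s \<in> A"
    have "\<bar>s\<bar> \<le> s\<^sup>2"
      by (rule abs_le_square_int)
    with assms[OF \<open>s \<in> A\<close>] show "s \<in> {- int (f (Q s))..int (f (Q s))}"
      by auto
  qed
qed simp

lemma odd_square_div: "odd (s::int) \<Longrightarrow> 4 * int (nat ((s\<^sup>2 - 1) div 4)) = s\<^sup>2 - 1"
proof -
  assume "odd s"
  then obtain k where "s = 2 * k + 1"
    by (elim oddE)
  then have "s\<^sup>2 - 1 = 4 * (k * (k + 1))"
    by (simp add: power2_eq_square algebra_simps)
  moreover have "0 \<le> k * (k + 1)"
    by (cases "0 \<le> k") (auto intro: mult_nonneg_nonneg mult_nonpos_nonpos)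
  ultimately show ?thesis by simp
qed

lemma even_square_div: "even (s::int) \<Longrightarrow> 4 * int (nat (s\<^sup>2 div 4)) = s\<^sup>2"
  by (elim evenE) (simp add: power2_eq_square)

lemma finite_odd_fibre: "finite {s \<in> {s. odd s}. nat ((s\<^sup>2 - 1) div 4) = n}"
  by (rule finite_square_fibre[where f = "\<lambda>n. 4 * n + 1"])
    (use odd_square_div in \<open>force simp: algebra_simps\<close>)

lemma finite_even_fibre: "finite {s \<in> {s. even s}. nat (s\<^sup>2 div 4) = n}"
  by (rule finite_square_fibre[where f = "\<lambda>n. 4 * n"])
    (use even_square_div in \<open>force simp: algebra_simps\<close>)

lemma fibre_series_uminus: "fibre_series A Q (\<lambda>x. - F x) = - fibre_series A Q F"
  by (rule fps_ext) (simp add: fibre_series_def sum_negf)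

lemma nat_div4: "x = 4 * int k \<Longrightarrow> nat (x div 4) = k"
  by simp

text \<open>
  With \<open>s = m + m' + 1\<close> and \<open>d = m - m'\<close> the double series of \<open>\<theta>(u) \<theta>(v)\<close> separates into
  series in \<open>u + v\<close> and \<open>u - v\<close>, according to the parities of \<open>s\<close> and \<open>d\<close>.
\<close>

lemma theta_mult_theta:
  "(qpoch_inf * theta u) * (qpoch_inf * theta v) =
     theta_odd (u + v) * theta_even (u - v) - theta_even (u + v) * theta_odd (u - v)"
proof -
  define Q where "Q = (\<lambda>(s::int, d::int). nat ((s\<^sup>2 + d\<^sup>2 - 1) div 4))"
  \<comment> \<open>The sign is that of \<open>alt m * alt m'\<close>, which is (-1)^(m+m') =
    (-1)^(s-1).\<close>
  define F where "F = (\<lambda>(s::int, d). (if odd s then 1 else - 1) *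
      (ex (frag_cmul s (u + v)) * ex (frag_cmul d (u - v))))"
  let ?O = "{s::int. odd s}" and ?E = "{s::int. even s}"
  have "(qpoch_inf * theta u) * (qpoch_inf * theta v) =
    fibre_series (UNIV \<times> UNIV) (\<lambda>(x, y). tri_int x + tri_int y)
      (\<lambda>(x, y). alt x * ex (frag_cmul (2 * x + 1) u) * (alt y * ex (frag_cmul (2 * y + 1) v)))"
    unfolding theta_eq_fibre_series
    by (rule fibre_series_mult) (simp_all add: finite_tri_int)
  also have "\<dots> = fibre_series (?O \<times> ?E \<union> ?E \<times> ?O) Q F"
  proof (rule fibre_series_reindex)
    show "bij_betw (\<lambda>(s, d). ((s + d - 1) div 2, (s - d - 1) div 2)) (?O \<times> ?E \<union> ?E \<times> ?O)
        (UNIV \<times> UNIV)"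
      by (rule bij_betw_byWitness[where f' = "\<lambda>(m, m'). (m + m' + 1, m - m')"])
        (auto, presburger+)
  next
    fix z assume z: "z \<in> ?O \<times> ?E \<union> ?E \<times> ?O"
    obtain s d where sd: "z = (s, d)"
      by (cases z)
    define m m' where "m = (s + d - 1) div 2" and "m' = (s - d - 1) div 2"
    have "even (s + d - 1)" "even (s - d - 1)"
      using z by (auto simp: sd)
    then have "2 * m = s + d - 1" "2 * m' = s - d - 1"
      unfolding m_def m'_def by (simp_all only: dvd_mult_div_cancel)
    then have m: "s = m + m' + 1" "d = m - m'"
      by linarith+
    have "s\<^sup>2 + d\<^sup>2 - 1 = 2 * (m * (m + 1) + m' * (m' + 1))"
      unfolding m by (simp add: power2_eq_square algebra_simps)
    also have "\<dots> = 4 * int (tri_int m + tri_int m')"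
      by (simp flip: two_tri_int)
    finally show "Q z = (case case z of (s, d) \<Rightarrow> ((s + d - 1) div 2, (s - d - 1)
        div 2) of
        (x, y) \<Rightarrow> tri_int x + tri_int y)"
      by (simp add: Q_def sd flip: m_def m'_def)
    have lat: "frag_cmul (2 * m + 1) u + frag_cmul (2 * m' + 1) v =
      frag_cmul s (u + v) + frag_cmul d (u - v)"
      by (intro poly_mapping_eqI) (simp add: lookup_add lookup_minus m algebra_simps)
    have "alt m * alt m' = (if odd s then 1 else - 1 :: 'a galg)"
      by (simp add: m alt_def)
    moreover have "alt m * ex (frag_cmul (2 * m + 1) u) * (alt m' * ex (frag_cmul (2 * m' + 1) v)) =
      (alt m * alt m') * ex (frag_cmul (2 * m + 1) u + frag_cmul (2 * m' + 1) v)"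
      unfolding ex_add by (simp only: mult_ac)
    ultimately have "alt m * ex (frag_cmul (2 * m + 1) u) * (alt m' * ex (frag_cmul (2 * m' + 1)
        v)) =
      (if odd s then 1 else - 1) * ex (frag_cmul (2 * m + 1) u + frag_cmul (2 * m' + 1) v)"
      by simp
    then show "F z = (case case z of (s, d) \<Rightarrow> ((s + d - 1) div 2, (s - d - 1) div 2)
        of (x, y) \<Rightarrow>
        alt x * ex (frag_cmul (2 * x + 1) u) * (alt y * ex (frag_cmul (2 * y + 1) v)))"
      unfolding lat by (simp add: F_def sd ex_add flip: m_def m'_def)
  qed
  also have "\<dots> = fibre_series (?O \<times> ?E) Q F + fibre_series (?E \<times> ?O) Q F"
  proof (rule fibre_series_union)
    have bound: "{z \<in> A. Q z = n} \<subseteq> {- int (4 * n + 4)..int (4 * n + 4)} \<times> {- int (4 * n + 4)..int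
        (4 * n + 4)}"
      for n A
    proof
      fix z assume "z \<in> {z \<in> A. Q z = n}"
      then have "n = nat (((fst z)\<^sup>2 + (snd z)\<^sup>2 - 1) div 4)"
        by (simp add: Q_def split: prod.splits)
      then have "(fst z)\<^sup>2 + (snd z)\<^sup>2 \<le> int (4 * n + 4)"
        by linarith
      then have "\<bar>fst z\<bar> \<le> int (4 * n + 4)" "\<bar>snd z\<bar> \<le> int (4 * n + 4)"
        using abs_le_square_int[of "fst z"] abs_le_square_int[of "snd z"] by linarith+
      then show "z \<in> {- int (4 * n + 4)..int (4 * n + 4)} \<times> {- int (4 * n + 4)..int (4 * n + 4)}"
        by (cases z) auto
    qed
    show "finite {z \<in> ?O \<times> ?E. Q z = n}" "finite {z \<in> ?E \<times> ?O. Q z = n}" for n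
      by (rule finite_subset[OF bound], simp)+
  qed auto
  also have "fibre_series (?O \<times> ?E) Q F = theta_odd (u + v) * theta_even (u - v)"
    unfolding theta_odd_def theta_even_def
  proof (subst fibre_series_mult[OF finite_odd_fibre finite_even_fibre],
      rule fibre_series_reindex[OF bij_betw_id, symmetric, simplified id_apply])
    fix z assume z: "z \<in> ?O \<times> ?E"
    obtain s d where sd: "z = (s, d)" "odd s" "even d"
      using z by auto
    have "s\<^sup>2 + d\<^sup>2 - 1 = 4 * int (nat ((s\<^sup>2 - 1) div 4) + nat (d\<^sup>2 div 4))"
      using odd_square_div[of s] even_square_div[of d] sd by simp
    then have "nat ((s\<^sup>2 + d\<^sup>2 - 1) div 4) = nat ((s\<^sup>2 - 1) div 4) + nat (d\<^sup>2 div 4)"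
      by (rule nat_div4)
    then show "Q z = (case z of (x, y) \<Rightarrow> nat ((x\<^sup>2 - 1) div 4) + nat (y\<^sup>2 div 4))"
      by (simp add: Q_def sd)
    show "F z = (case z of (x, y) \<Rightarrow> ex (frag_cmul x (u + v)) * ex (frag_cmul y
        (u - v)))"
      by (simp add: F_def sd)
  qed
  also have "fibre_series (?E \<times> ?O) Q F = - (theta_even (u + v) * theta_odd (u - v))"
    unfolding theta_odd_def theta_even_def
  proof (subst fibre_series_mult[OF finite_even_fibre finite_odd_fibre],
      subst fibre_series_uminus [symmetric],
      rule fibre_series_reindex[OF bij_betw_id, symmetric, simplified id_apply])
    fix z assume z: "z \<in> ?E \<times> ?O"
    obtain s d where sd: "z = (s, d)" "even s" "odd d"
      using z by auto
    have "s\<^sup>2 + d\<^sup>2 - 1 = 4 * int (nat (s\<^sup>2 div 4) + nat ((d\<^sup>2 - 1) div 4))"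
      using odd_square_div[of d] even_square_div[of s] sd by simp
    then have "nat ((s\<^sup>2 + d\<^sup>2 - 1) div 4) = nat (s\<^sup>2 div 4) + nat ((d\<^sup>2 - 1) div 4)"
      by (rule nat_div4)
    then show "Q z = (case z of (x, y) \<Rightarrow> nat (x\<^sup>2 div 4) + nat ((y\<^sup>2 - 1) div 4))"
      by (simp add: Q_def sd)
    show "F z = - (case z of (x, y) \<Rightarrow> ex (frag_cmul x (u + v)) * ex (frag_cmul y
        (u - v)))"
      by (simp add: F_def sd)
  qed
  finally show ?thesis
    by simp
qed

text \<open>The points p, q, r, s index the columns of a 2 x 4 matrix with rows
  \<open>theta_odd\<close> and \<open>theta_even\<close>, and D is its 2 x 2 minor. Sums and
  differences are prescribed by hypotheses because half-sums such as (p + q)/2 need not exist in the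
  lattice.\<close>

theorem theta_three_term:
  assumes "p = u1 + v1" "q = u1 - v1" "r = u2 + v2" "s = u2 - v2"
    and "p = u3 + v3" "r = u3 - v3" "q = u4 + v4" "s = u4 - v4"
    and "p = u5 + v5" "s = u5 - v5" "q = u6 + v6" "r = u6 - v6"
  shows "theta u1 * theta v1 * theta u2 * theta v2 - theta u3 * theta v3 * theta u4 * theta v4
    + theta u5 * theta v5 * theta u6 * theta v6 = 0"
proof -
  let ?c = "qpoch_inf :: 'a series"
  define D where "D a b = theta_odd a * theta_even b - theta_even a * theta_odd b" for a b ::
      "'a lattice"
  have D: "(?c * theta u) * (?c * theta v) = D (u + v) (u - v)" for u v
    unfolding D_def by (rule theta_mult_theta)
  have "D p q * D r s - D p r * D q s + D p s * D q r = 0"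
    unfolding D_def by (simp add: algebra_simps)
  moreover have "D p q * D r s = ?c ^ 4 * (theta u1 * theta v1 * theta u2 * theta v2)"
    unfolding assms(1-4) D [symmetric] by (simp add: eval_nat_numeral mult_ac)
  moreover have "D p r * D q s = ?c ^ 4 * (theta u3 * theta v3 * theta u4 * theta v4)"
    unfolding assms(5-8) D [symmetric] by (simp add: eval_nat_numeral mult_ac)
  moreover have "D p s * D q r = ?c ^ 4 * (theta u5 * theta v5 * theta u6 * theta v6)"
    unfolding assms(9-12) D [symmetric] by (simp add: eval_nat_numeral mult_ac)
  ultimately have "?c ^ 4 * (theta u1 * theta v1 * theta u2 * theta v2 - theta u3 * theta v3 *
      theta u4 * theta v4
    + theta u5 * theta v5 * theta u6 * theta v6) = 0"
    by (simp add: distrib_left right_diff_distrib)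
  then show ?thesis
    by simp
qed

section \<open>Identities of the vertex weights and the operators attached to words of
  crossings\<close>

section \<open>Unitarity and the Yang--Baxter equation\<close>

definition thf :: "('v::countable) lattice \<Rightarrow> 'v frac" where
  "thf u = Fract (theta u) 1"

lemma thf_minus: "thf (- u) = - thf u"
  by (simp add: thf_def theta_minus)

lemma thf_0 [simp]: "thf 0 = 0"
  by (simp add: thf_def Zero_fract_def)

lemma thf_eq_0_iff [simp]: "thf u = 0 \<longleftrightarrow> u = 0"
  by (simp add: thf_def eq_fract Zero_fract_def)

lemma Pfun_conv: "Pfun x y = thf (x - y) * thf hbar / (thf (y + hbar) * thf x)"
  and Qfun_conv: "Qfun x y = thf (x + hbar) * thf y / (thf (y + hbar) * thf x)"
  by (simp_all add: Pfun_def Qfun_def thf_def)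

lemma thf_three_term:
  assumes "p = u1 + v1" "q = u1 - v1" "r = u2 + v2" "s = u2 - v2"
    and "p = u3 + v3" "r = u3 - v3" "q = u4 + v4" "s = u4 - v4"
    and "p = u5 + v5" "s = u5 - v5" "q = u6 + v6" "r = u6 - v6"
  shows "thf u1 * thf v1 * thf u2 * thf v2 - thf u3 * thf v3 * thf u4 * thf v4
    + thf u5 * thf v5 * thf u6 * thf v6 = 0"
  using theta_three_term[OF assms] by (simp add: thf_def Zero_fract_def)

lemma thf_swap: "thf (u - v) = - thf (v - u)"
  using thf_minus[of "v - u"] by simp

text \<open>Unitarity with its denominators cleared. The four points are the doubles of hbar, a, b
  and 0, so that all half-sums exist.\<close>

lemma thf_relation_1:
  "thf (a + hbar) * thf (hbar - a) * thf b ^ 2 - thf (b + hbar) * thf (hbar - b) * thf a ^ 2 =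
     - (thf hbar ^ 2 * thf (a + b) * thf (a - b))"
proof -
  have "thf (hbar + a) * thf (hbar - a) * thf b * thf b
      - thf (hbar + b) * thf (hbar - b) * thf a * thf a
      + thf hbar * thf hbar * thf (a + b) * thf (a - b) = 0"
    by (rule thf_three_term[where p = "hbar + hbar" and q = "a + a" and r = "b + b" and s = 0])
      (simp_all add: algebra_simps)
  then show ?thesis
    by (simp add: power2_eq_square add.commute algebra_simps eq_neg_iff_add_eq_0)
qed

lemma thf_relation_2:
  "thf (a - x) * thf (a - y) * thf (b - x - y) * thf b - thf (b - x) * thf (b - y) * thf
      (a - x - y) * thf a =
     - (thf (a + b - x - y) * thf (a - b) * thf x * thf y)"
proof -
  have "thf (a - x) * thf (a - y) * thf b * thf (b - x - y)
      - thf (a + b - x - y) * thf (a - b) * thf y * thf (- x)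
      + thf a * thf (a - x - y) * thf (b - x) * thf (y - b) = 0"
    by (rule thf_three_term[where p = "a + a - x - y" and q = "y - x" and r = "b + b - x - y"
        and s = "x + y"])
      (simp_all add: algebra_simps)
  then show ?thesis
    unfolding thf_minus thf_swap[of y b] by (simp add: algebra_simps)
qed

text \<open>The relation between the numerators in \<open>yang_baxter_swap\<close>, where the
  resulting arrangement of colours differs by one transposition.\<close>

lemma thf_relation_3:
  "thf x * thf (a + b - x - y) * thf (a + y) * thf b + thf (a - x) * thf (b - x - y) * thf y * thf
      (a + b) =
     thf (b - y) * thf (x + y) * thf (a + b - x) * thf a"
proof -
  have "thf (a + b - x - y) * thf (a + y) * thf x * thf b
      - thf (a + b) * thf (a - x) * thf (- y) * thf (b - x - y)
      + thf a * thf (a + b - x) * thf (b - y) * thf (- (x + y)) = 0"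
    by (rule thf_three_term[where p = "a + a + b - x" and q = "b - x - y - y" and r = "x + b"
        and s = "x - b"])
      (simp_all add: algebra_simps)
  then show ?thesis
    unfolding thf_minus by (simp add: algebra_simps)
qed

lemma PQ_at_0: "x \<noteq> 0 \<Longrightarrow> Pfun x 0 = 1" "Qfun x 0 = 0"
  by (simp_all add: Pfun_conv Qfun_conv)

lemma PQ_at_minus_hbar:
  assumes "y + hbar \<noteq> 0"
  shows "Pfun (- hbar) y = 1" "Qfun (- hbar) y = 0"
proof -
  have "- hbar - y = - (y + hbar)"
    by simp
  then have "thf (- hbar - y) = - thf (y + hbar)"
    by (simp only: thf_minus)
  moreover have "thf (y + hbar) \<noteq> 0"
    using assms by simp
  ultimately show "Pfun (- hbar) y = 1"
    by (simp add: Pfun_conv thf_minus)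
  show "Qfun (- hbar) y = 0"
    by (simp add: Qfun_conv)
qed

lemma unitarity_1:
  assumes "a \<noteq> 0" "y + hbar \<noteq> 0" "hbar - y \<noteq> 0"
  shows "Pfun a y * Pfun a (- y) + Qfun a y * Qfun (- a) (- y) = 1"
proof -
  have *: "thf a \<noteq> 0" "thf (y + hbar) \<noteq> 0" "thf (hbar - y) \<noteq> 0"
    using assms by simp_all
  have 1: "thf (a + hbar) * thf (hbar - a) * thf y ^ 2 + thf hbar ^ 2 * thf (a + y) * thf (a - y)
      = thf (y + hbar) * thf (hbar - y) * thf a ^ 2"
    using thf_relation_1[of a y] by (simp add: algebra_simps)
  have "Pfun a y * Pfun a (- y) + Qfun a y * Qfun (- a) (- y) =
     (thf (a + hbar) * thf (hbar - a) * thf y ^ 2 + thf hbar ^ 2 * thf (a + y) * thf (a - y)) /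
     (thf (y + hbar) * thf (hbar - y) * thf a ^ 2)"
    unfolding Pfun_conv Qfun_conv using *
    by (simp add: thf_minus power2_eq_square add_divide_distrib mult_ac)
  then show ?thesis
    unfolding 1 using * by simp
qed

text \<open>Only the oddness of theta enters: the two products consist of the same thetas with
  opposite signs.\<close>

lemma unitarity_2:
  assumes "a \<noteq> 0"
  shows "Pfun a y * Qfun a (- y) + Qfun a y * Pfun (- a) (- y) = 0"
proof -
  have "thf (y - a) = - thf (a - y)"
    by (rule thf_swap)
  then show ?thesis
    unfolding Pfun_conv Qfun_conv using thf_minus[of "a + y"] by (simp add: thf_minus mult_ac)
qed

text \<open>The coefficient of the unchanged arrangement of three colours, which needs two theta
  relations. Over the common denominator, the difference of the triple bounces (e1) and that of the
  double crossings (e2) reduce to the same product, and the two cancel.\<close>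

lemma yang_baxter_id:
  assumes "a \<noteq> 0" "b \<noteq> 0" "a + b \<noteq> 0"
    and "x + hbar \<noteq> 0" "y + hbar \<noteq> 0" "x + y + hbar \<noteq> 0"
  shows "Pfun a x * Pfun b (x + y) * Pfun a y + Qfun a x * Pfun (a + b) (x + y) * Qfun (- a) y =
    Pfun b y * Pfun a (x + y) * Pfun b x + Qfun b y * Pfun (a + b) (x + y) * Qfun (- b) x"
proof -
  define K where "K = thf (x + hbar) * thf (y + hbar) * thf (x + y + hbar)"
  have *: "thf a \<noteq> 0" "thf b \<noteq> 0" "thf (a + b) \<noteq> 0" "K \<noteq> 0"
    using assms by (simp_all add: K_def)
  let ?h = "thf hbar :: 'a frac"
  let ?s = "thf (a + b - x - y) :: 'a frac"
  have frac: "A / (u * v) * (B / (w * v')) * (C / (z * v'')) = A * B * C / (u * w * z * (v * v' *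
      v''))"
    for A B C u v w v' z v'' :: "'a frac"
    by simp
  define r1 where "r1 c d = ?h ^ 3 * (thf (c - x) * thf (c - y) * thf (d - x - y))" for c d
  define r2 where "r2 c = ?h * thf x * thf y * ?s * (thf (c + hbar) * thf (hbar - c))" for c
  have 1: "Pfun a x * Pfun b (x + y) * Pfun a y = r1 a b / (K * (thf a ^ 2 * thf b))"
    unfolding Pfun_conv frac r1_def K_def
    by (simp add: power2_eq_square power3_eq_cube diff_diff_add mult_ac)
  have 2: "Qfun a x * Pfun (a + b) (x + y) * Qfun (- a) y = - (r2 a / (K * (thf a ^ 2 * thf (a +
      b))))"
    unfolding Pfun_conv Qfun_conv frac r2_def K_def thf_minus
    by (simp add: power2_eq_square diff_diff_add mult_ac)
  have 3: "Pfun b y * Pfun a (x + y) * Pfun b x = r1 b a / (K * (thf b ^ 2 * thf a))"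
    unfolding Pfun_conv frac r1_def K_def
    by (simp add: power2_eq_square power3_eq_cube diff_diff_add mult_ac)
  have 4: "Qfun b y * Pfun (a + b) (x + y) * Qfun (- b) x = - (r2 b / (K * (thf b ^ 2 * thf (a +
      b))))"
    unfolding Pfun_conv Qfun_conv frac r2_def K_def thf_minus
    by (simp add: power2_eq_square diff_diff_add mult_ac)
  have e1: "r1 a b * thf b - r1 b a * thf a = - (?h ^ 3 * (?s * thf (a - b) * thf x * thf y))"
    unfolding r1_def using arg_cong[OF thf_relation_2[of a x y b], of "(*) (?h ^ 3)"]
    by (simp only: right_diff_distrib mult_minus_right mult_ac)
  have e2: "r2 a * thf b ^ 2 - r2 b * thf a ^ 2 = - (?h ^ 3 * (?s * thf (a - b) * thf x * thf y) *
      thf (a + b))"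
    unfolding r2_def using arg_cong[OF thf_relation_1[of a b], of "(*) (?h * thf x * thf y * ?s)"]
    by (simp add: right_diff_distrib power2_eq_square power3_eq_cube mult_ac)
  have "r1 a b / (K * (thf a ^ 2 * thf b)) + - (r2 a / (K * (thf a ^ 2 * thf (a + b)))) =
    ((r1 a b * thf b) * thf (a + b) - r2 a * thf b ^ 2) / (K * (thf a ^ 2 * thf b ^ 2 * thf (a +
        b)))"
    using * by (simp add: divide_simps power2_eq_square) (simp add: algebra_simps)
  also have "(r1 a b * thf b) * thf (a + b) - r2 a * thf b ^ 2 = (r1 b a * thf a) * thf (a + b)
      - r2 b * thf a ^ 2"
    using e1 e2 by algebra
  also have "\<dots> / (K * (thf a ^ 2 * thf b ^ 2 * thf (a + b))) =
    r1 b a / (K * (thf b ^ 2 * thf a)) + - (r2 b / (K * (thf b ^ 2 * thf (a + b))))"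
    using * by (simp add: divide_simps power2_eq_square) (simp add: algebra_simps)
  finally show ?thesis
    unfolding 1 2 3 4 .
qed

lemma yang_baxter_swap:
  assumes "a \<noteq> 0" "b \<noteq> 0" "a + b \<noteq> 0"
    and "x + hbar \<noteq> 0" "y + hbar \<noteq> 0" "x + y + hbar \<noteq> 0"
  shows "Qfun a x * Pfun (a + b) (x + y) * Pfun (- a) y + Pfun a x * Pfun b (x + y) * Qfun a y =
    Pfun b y * Qfun a (x + y) * Pfun (a + b) x"
proof -
  define K where "K = thf (x + hbar) * thf (y + hbar) * thf (x + y + hbar)"
  have *: "thf a \<noteq> 0" "thf b \<noteq> 0" "thf (a + b) \<noteq> 0" "K \<noteq> 0"
    using assms by (simp_all add: K_def)
  let ?h = "thf hbar :: 'a frac"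
  define c where "c = ?h ^ 2 * thf (a + hbar)"
  have frac: "A / (u * v) * (B / (w * v')) * (C / (z * v'')) = A * B * C / (u * w * z * (v * v' *
      v''))"
    for A B C u v w v' z v'' :: "'a frac"
    by simp
  have m: "thf (- a - y) = - thf (a + y)"
    using thf_minus[of "a + y"] by simp
  define r1 r2 r3 where "r1 = c * (thf x * thf (a + b - x - y) * thf (a + y))"
    and "r2 = c * (thf (a - x) * thf (b - x - y) * thf y)"
    and "r3 = c * (thf (b - y) * thf (x + y) * thf (a + b - x))"
  have 1: "Qfun a x * Pfun (a + b) (x + y) * Pfun (- a) y = r1 / (K * (thf a ^ 2 * thf (a + b)))"
    unfolding Pfun_conv Qfun_conv frac c_def K_def thf_minus m r1_def
    by (simp add: power2_eq_square diff_diff_add mult_ac)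
  have 2: "Pfun a x * Pfun b (x + y) * Qfun a y = r2 / (K * (thf a ^ 2 * thf b))"
    unfolding Pfun_conv Qfun_conv frac c_def K_def r2_def
    by (simp add: power2_eq_square diff_diff_add mult_ac)
  have 3: "Pfun b y * Qfun a (x + y) * Pfun (a + b) x = r3 / (K * (thf a * thf b * thf (a + b)))"
    unfolding Pfun_conv Qfun_conv frac c_def K_def r3_def
    by (simp add: power2_eq_square diff_diff_add mult_ac)
  have e: "r1 * thf b + r2 * thf (a + b) = r3 * thf a"
    unfolding r1_def r2_def r3_def using arg_cong[OF thf_relation_3[of x a b y], of "(*) c"]
    by (simp only: distrib_left mult_ac)
  have "r1 / (K * (thf a ^ 2 * thf (a + b))) + r2 / (K * (thf a ^ 2 * thf b)) =
    (r1 * thf b + r2 * thf (a + b)) / (K * (thf a ^ 2 * thf b * thf (a + b)))"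
    using * by (simp add: divide_simps power2_eq_square)
  also have "\<dots> = r3 / (K * (thf a * thf b * thf (a + b)))"
    unfolding e using * by (simp add: divide_simps power2_eq_square)
  finally show ?thesis
    unfolding 1 2 3 .
qed

lemma yang_baxter_swap':
  assumes "a \<noteq> 0" "b \<noteq> 0" "a + b \<noteq> 0"
    and "x + hbar \<noteq> 0" "y + hbar \<noteq> 0" "x + y + hbar \<noteq> 0"
  shows "Qfun b y * Pfun (a + b) (x + y) * Pfun (- b) x + Pfun b y * Pfun a (x + y) * Qfun b x =
    Pfun a x * Qfun b (x + y) * Pfun (a + b) y"
  using yang_baxter_swap[of b a y x] assms by (simp add: add.commute)

lemma yang_baxter_cycle:
  "Qfun a x * Qfun (a + b) (x + y) * Pfun b y = Pfun b y * Qfun a (x + y) * Qfun (a + b) x"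
  "Pfun a x * Qfun b (x + y) * Qfun (a + b) y = Qfun b y * Qfun (a + b) (x + y) * Pfun a x"
  by (simp_all add: Qfun_conv mult_ac)

section \<open>The lattice model\<close>

text \<open>
  A state assigns to every site a colour \<open>\<sigma>\<close> and the index \<open>\<zeta>\<close> of the spectral parameter of the line
  through it; \<open>c\<close> gives the dynamical parameter of a colour.  \<open>crossing c k\<close> lets the lines at the
  sites \<open>k\<close> and \<open>k + 1\<close> meet; the paths carrying the colours either bounce or cross there.
\<close>

type_synonym amplitude = "(nat \<Rightarrow> nat) \<Rightarrow> (nat \<Rightarrow> nat)
    \<Rightarrow> nat frac"

definition crossing :: "(nat \<Rightarrow> nat lattice) \<Rightarrow> nat \<Rightarrow> amplitude
    \<Rightarrow> amplitude" where
  "crossing c k \<Psi> = (\<lambda>\<zeta> \<sigma>.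
     let a = c (\<sigma> k) - c (\<sigma> (Suc k)); z = var (\<zeta> (Suc k)) - var (\<zeta> k) in
     Pfun a z * \<Psi> (\<zeta> \<circ> simple_refl k) \<sigma> + Qfun a z * \<Psi> (\<zeta> \<circ> simple_refl k)
         (\<sigma> \<circ> simple_refl k))"

text \<open>Operators act on functions of the state, so the head of the word is the crossing that
  the state meets first, and the innermost amplitude evaluates the final state.\<close>

definition crossings :: "(nat \<Rightarrow> nat lattice)
    \<Rightarrow> nat list \<Rightarrow> amplitude \<Rightarrow> amplitude" where
  "crossings c ks \<Psi> = foldr (crossing c) ks \<Psi>"

lemma crossings_Nil [simp]: "crossings c [] \<Psi> = \<Psi>"
  and crossings_Cons [simp]: "crossings c (k # ks) \<Psi> = crossing c k (crossings c ks \<Psi>)"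
  and crossings_append: "crossings c (ks @ ls) \<Psi> = crossings c ks (crossings c ls \<Psi>)"
  by (simp_all add: crossings_def)

lemma transpose_involutory_comp [simp]:
  "f \<circ> Transposition.transpose a b \<circ> Transposition.transpose a b = f"
  by (simp add: comp_assoc)

lemma inj_comp_transpose: "inj \<sigma> \<Longrightarrow> inj (\<sigma> \<circ> Transposition.transpose a b)"
  by (intro inj_compose) simp_all

lemma simple_refl_apply:
  "simple_refl k k = Suc k" "simple_refl k (Suc k) = k"
  "j \<noteq> k \<Longrightarrow> j \<noteq> Suc k \<Longrightarrow> simple_refl k j = j"
  by simp_all

lemma simple_refl_commute:
  "Suc k < l \<Longrightarrow> simple_refl k \<circ> simple_refl l = simple_refl l \<circ> simple_refl k"
  by (auto simp: fun_eq_iff Transposition.transpose_def)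

lemma simple_refl_braid:
  "simple_refl (Suc k) \<circ> simple_refl k \<circ> simple_refl (Suc k) = simple_refl k \<circ> simple_refl (Suc k)
      \<circ> simple_refl k"
  by (auto simp: fun_eq_iff Transposition.transpose_def)

lemma Hbar_coeff_ne [simp]:
  "var i - var j + hbar \<noteq> (0 :: 'v lattice)" "hbar - (var i - var j) \<noteq> (0 :: 'v lattice)"
proof -
  have "Poly_Mapping.lookup (var i - var j + hbar :: 'v lattice) Hbar = 1"
    "Poly_Mapping.lookup (hbar - (var i - var j) :: 'v lattice) Hbar = 1"
    by (simp_all add: lookup_add lookup_minus)
  then show "var i - var j + hbar \<noteq> (0 :: 'v lattice)" "hbar - (var i - var j) \<noteq> (0 :: 'v lattice)"
    by auto
qed

locale colouring =
  fixes c :: "nat \<Rightarrow> nat lattice"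
  assumes inj_c: "inj c"
begin

abbreviation "R \<equiv> crossing c"
abbreviation "W \<equiv> crossings c"

lemma colour_diff_ne: "inj \<sigma> \<Longrightarrow> i \<noteq> j \<Longrightarrow> c (\<sigma> i) - c (\<sigma> j) \<noteq> 0"
  using inj_c by (auto simp: inj_def)

text \<open>Equality is asked only on injective states: there the colours of neighbouring sites
  differ, and the denominators theta of their difference do not vanish.\<close>

definition word_eq :: "nat list \<Rightarrow> nat list \<Rightarrow> bool"  (infix \<open>\<simeq>\<close> 50) where
  "ks \<simeq> ls \<longleftrightarrow> (\<forall>\<Psi> \<zeta> \<sigma>. inj \<sigma> \<longrightarrow> W ks \<Psi> \<zeta> \<sigma> = W ls \<Psi> \<zeta> \<sigma>)"

lemma word_eq_refl [simp, intro]: "ks \<simeq> ks"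
  and word_eq_sym: "ks \<simeq> ls \<Longrightarrow> ls \<simeq> ks"
  and word_eq_trans [trans]: "ks \<simeq> ls \<Longrightarrow> ls \<simeq> ms \<Longrightarrow> ks \<simeq> ms"
  by (auto simp: word_eq_def)

lemma crossings_cong:
  assumes "\<And>\<zeta> \<sigma>. inj \<sigma> \<Longrightarrow> \<Psi> \<zeta> \<sigma> = \<Phi> \<zeta> \<sigma>" "inj \<sigma>"
  shows "W ks \<Psi> \<zeta> \<sigma> = W ks \<Phi> \<zeta> \<sigma>"
  using assms(2)
proof (induction ks arbitrary: \<zeta> \<sigma>)
  case (Cons k ks)
  have "W ks \<Psi> \<zeta>' \<sigma> = W ks \<Phi> \<zeta>' \<sigma>" for \<zeta>'
    by (intro Cons)
  moreover have "W ks \<Psi> \<zeta>' (\<sigma> \<circ> simple_refl k) = W ks \<Phi> \<zeta>' (\<sigma> \<circ> simple_refl k)" for \<zeta>'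
    by (intro Cons inj_comp_transpose)
  ultimately show ?case
    by (simp only: crossings_Cons crossing_def)
qed (simp add: assms(1))

lemma word_eq_append: "ks \<simeq> ks' \<Longrightarrow> ls \<simeq> ls' \<Longrightarrow> ks @ ls \<simeq> ks' @ ls'"
  unfolding word_eq_def crossings_append by (metis (no_types, lifting) crossings_cong)

lemma word_eq_context: "ls \<simeq> ls' \<Longrightarrow> ks @ ls @ ms \<simeq> ks @ ls' @ ms"
  by (intro word_eq_append word_eq_refl)

lemma word_eq_cancel: "[k, k] \<simeq> []"
  unfolding word_eq_def
proof (intro allI impI)
  fix \<Psi> :: amplitude and \<zeta> \<sigma> :: "nat \<Rightarrow> nat" assume "inj \<sigma>"
  let ?a = "c (\<sigma> k) - c (\<sigma> (Suc k))" and ?z = "var (\<zeta> (Suc k)) - var (\<zeta> k) :: nat lattice"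
  have a: "?a \<noteq> 0"
    using \<open>inj \<sigma>\<close> by (intro colour_diff_ne) auto
  have m: "c (\<sigma> (Suc k)) - c (\<sigma> k) = - ?a" "var (\<zeta> k) - var (\<zeta> (Suc k)) = - ?z"
    by simp_all
  have "W [k, k] \<Psi> \<zeta> \<sigma> = (Pfun ?a ?z * Pfun ?a (- ?z) + Qfun ?a ?z * Qfun (- ?a) (- ?z)) *
      \<Psi> \<zeta> \<sigma>
      + (Pfun ?a ?z * Qfun ?a (- ?z) + Qfun ?a ?z * Pfun (- ?a) (- ?z)) * \<Psi> \<zeta>
          (\<sigma> \<circ> simple_refl k)"
    by (simp add: crossing_def Let_def algebra_simps del: minus_diff_eq)
      (simp only: m mult_ac add_ac)
  then show "W [k, k] \<Psi> \<zeta> \<sigma> = W [] \<Psi> \<zeta> \<sigma>"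
    by (simp only: unitarity_1[OF a Hbar_coeff_ne] unitarity_2[OF a] mult_1_left mult_zero_left
        add_0_right crossings_Nil)
qed

lemma word_eq_commute:
  assumes "Suc k < l"
  shows "[k, l] \<simeq> [l, k]"
  unfolding word_eq_def
proof (intro allI impI)
  fix \<Psi> :: amplitude and \<zeta> \<sigma> :: "nat \<Rightarrow> nat" assume "inj \<sigma>"
  have "simple_refl k l = l" "simple_refl k (Suc l) = Suc l" "simple_refl l k = k" "simple_refl l
      (Suc k) = Suc k"
    using assms by (auto simp: simple_refl_apply)
  moreover have "f \<circ> simple_refl k \<circ> simple_refl l = f \<circ> simple_refl l \<circ> simple_refl k" for f ::
      "nat \<Rightarrow> nat"
    unfolding comp_assoc simple_refl_commute[OF assms] ..
  ultimately show "W [k, l] \<Psi> \<zeta> \<sigma> = W [l, k] \<Psi> \<zeta> \<sigma>"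
    by (simp add: crossing_def Let_def algebra_simps)
qed

text \<open>Three lines meet in two orders. Both sides are combinations of the values of the
  amplitude at the six arrangements of three colours, with the same final spectral parameters, and
  the coefficients are compared one by one.\<close>

lemma word_eq_braid: "[k, Suc k, k] \<simeq> [Suc k, k, Suc k]"
  unfolding word_eq_def
proof (intro allI impI)
  fix \<Psi> :: amplitude and \<zeta> \<sigma> :: "nat \<Rightarrow> nat" assume "inj \<sigma>"
  define a b where "a = c (\<sigma> k) - c (\<sigma> (Suc k))" and "b = c (\<sigma> (Suc k)) - c (\<sigma> (Suc (Suc k)))"
  define x y :: "nat lattice" where "x = var (\<zeta> (Suc k)) - var (\<zeta> k)" and "y = var (\<zeta> (Suc
      (Suc k))) - var (\<zeta> (Suc k))"
  have ab: "c (\<sigma> k) - c (\<sigma> (Suc (Suc k))) = a + b" "c (\<sigma> (Suc k)) - c (\<sigma> k) = - a"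
    "c (\<sigma> (Suc (Suc k))) - c (\<sigma> (Suc k)) = - b"
    by (simp_all add: a_def b_def)
  have xy: "var (\<zeta> (Suc (Suc k))) - var (\<zeta> k) = x + y"
    by (simp add: x_def y_def)
  have ne: "a \<noteq> 0" "b \<noteq> 0" "a + b \<noteq> 0"
    unfolding ab(1) [symmetric] unfolding a_def b_def
    by (rule colour_diff_ne[OF \<open>inj \<sigma>\<close>], simp)+
  have nez: "x + hbar \<noteq> 0" "y + hbar \<noteq> 0" "x + y + hbar \<noteq> 0"
    unfolding xy [symmetric] unfolding x_def y_def by simp_all
  let ?s = "simple_refl k" and ?t = "simple_refl (Suc k)"
  let ?\<zeta> = "\<zeta> \<circ> ?s \<circ> ?t \<circ> ?s"
  have braid: "f \<circ> ?t \<circ> ?s \<circ> ?t = f \<circ> ?s \<circ> ?t \<circ> ?s" for f :: "nat \<Rightarrow> nat"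
    using simple_refl_braid[of k] by (metis comp_assoc)
  define F where "F = \<Psi> ?\<zeta>"
  have [simp]: "?s k = Suc k" "?s (Suc k) = k" "?s (Suc (Suc k)) = Suc (Suc k)"
    "?t k = k" "?t (Suc k) = Suc (Suc k)" "?t (Suc (Suc k)) = Suc k"
    by (auto simp: simple_refl_apply)
  \<comment> \<open>Coefficients in the order: identity, the two transpositions, the two 3-cycles,
    the reversal. The reversal has the same three Q factors on both sides.\<close>
  have L: "W [k, Suc k, k] \<Psi> \<zeta> \<sigma> =
     (Pfun a x * Pfun b (x + y) * Pfun a y + Qfun a x * Pfun (a + b) (x + y) * Qfun (- a) y) * F \<sigma>
     + (Qfun a x * Pfun (a + b) (x + y) * Pfun (- a) y + Pfun a x * Pfun b (x + y) * Qfun a y) * F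
         (\<sigma> \<circ> ?s)
     + Pfun a x * Qfun b (x + y) * Pfun (a + b) y * F (\<sigma> \<circ> ?t)
     + Qfun a x * Qfun (a + b) (x + y) * Pfun b y * F (\<sigma> \<circ> ?s \<circ> ?t)
     + Pfun a x * Qfun b (x + y) * Qfun (a + b) y * F (\<sigma> \<circ> ?t \<circ> ?s)
     + Qfun a x * Qfun (a + b) (x + y) * Qfun b y * F (\<sigma> \<circ> ?s \<circ> ?t \<circ> ?s)"
    by (simp add: crossing_def Let_def ab xy F_def flip: a_def b_def x_def y_def)
      (simp add: algebra_simps)
  have R: "W [Suc k, k, Suc k] \<Psi> \<zeta> \<sigma> =
     (Pfun b y * Pfun a (x + y) * Pfun b x + Qfun b y * Pfun (a + b) (x + y) * Qfun (- b) x) * F \<sigma>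
     + Pfun b y * Qfun a (x + y) * Pfun (a + b) x * F (\<sigma> \<circ> ?s)
     + (Qfun b y * Pfun (a + b) (x + y) * Pfun (- b) x + Pfun b y * Pfun a (x + y) * Qfun b x) * F
         (\<sigma> \<circ> ?t)
     + Pfun b y * Qfun a (x + y) * Qfun (a + b) x * F (\<sigma> \<circ> ?s \<circ> ?t)
     + Qfun b y * Qfun (a + b) (x + y) * Pfun a x * F (\<sigma> \<circ> ?t \<circ> ?s)
     + Qfun b y * Qfun (a + b) (x + y) * Qfun a x * F (\<sigma> \<circ> ?s \<circ> ?t \<circ> ?s)"
    by (simp add: crossing_def Let_def ab xy F_def braid flip: a_def b_def x_def y_def)
      (simp add: algebra_simps)
  show "W [k, Suc k, k] \<Psi> \<zeta> \<sigma> = W [Suc k, k, Suc k] \<Psi> \<zeta> \<sigma>"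
    unfolding L R yang_baxter_id[OF ne nez] yang_baxter_swap[OF ne nez] yang_baxter_swap'[OF ne nez]
      yang_baxter_cycle by (simp only: mult_ac)
qed

lemma word_eq_commute': "Suc k < l \<or> Suc l < k \<Longrightarrow> [k, l] \<simeq> [l, k]"
  using word_eq_commute word_eq_sym by blast

lemma word_eq_commute_list:
  assumes "\<And>l. l \<in> set ls \<Longrightarrow> Suc k < l \<or> Suc l < k"
  shows "[k] @ ls \<simeq> ls @ [k]"
  using assms
proof (induction ls)
  case (Cons l ls)
  have "[k] @ l # ls \<simeq> [l, k] @ ls"
    using word_eq_append[OF word_eq_commute'[of k l] word_eq_refl[of ls]] Cons.prems by simp
  also have "[l, k] @ ls \<simeq> (l # ls) @ [k]"
    using word_eq_append[OF word_eq_refl[of "[l]"] Cons.IH] Cons.prems by simp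
  finally show ?case .
qed simp

text \<open>The letter k commutes with the letters of the run below k - 1, meets k - 1, k in a braid
  relation that turns k, k - 1, k into k - 1, k, k - 1, and commutes as k - 1 with the letters that
  remain. Geometrically, a crossing is pulled through a line.\<close>

lemma word_eq_shift:
  assumes "a < k" "k < b"
  shows "[k] @ [a..<b] \<simeq> [a..<b] @ [k - 1]"
proof -
  obtain j where k: "k = Suc j"
    using assms by (cases k) auto
  have split: "[a..<b] = [a..<j] @ [j, Suc j] @ [Suc (Suc j)..<b]"
    using assms unfolding k
    by (metis Cons_eq_appendI Suc_lessD append_Nil le_add_diff_inverse less_Suc_eq_le
        less_imp_le_nat
        upt_add_eq_append upt_conv_Cons)
  have "[k] @ [a..<b] \<simeq> ([a..<j] @ [k]) @ [j, Suc j] @ [Suc (Suc j)..<b]"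
    unfolding split append_assoc[symmetric, of "[k]"]
    by (intro word_eq_append word_eq_refl word_eq_commute_list) (auto simp: k)
  also have "([a..<j] @ [k]) @ [j, Suc j] @ [Suc (Suc j)..<b] = [a..<j] @ [Suc j, j, Suc j] @ [Suc
      (Suc j)..<b]"
    by (simp add: k)
  also have "\<dots> \<simeq> [a..<j] @ [j, Suc j, j] @ [Suc (Suc j)..<b]"
    by (intro word_eq_context word_eq_sym[OF word_eq_braid])
  also have "\<dots> = [a..<j] @ [j, Suc j] @ ([j] @ [Suc (Suc j)..<b])"
    by simp
  also have "\<dots> \<simeq> [a..<j] @ [j, Suc j] @ ([Suc (Suc j)..<b] @ [j])"
    by (intro word_eq_append word_eq_refl word_eq_commute_list) auto
  also have "\<dots> = [a..<b] @ [k - 1]"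
    by (simp add: split k)
  finally show ?thesis .
qed

lemma word_eq_rev: "ks @ rev ks \<simeq> []"
proof (induction ks)
  case (Cons k ks)
  have "[k] @ (ks @ rev ks) @ [k] \<simeq> [k] @ [] @ [k]"
    by (rule word_eq_context[OF Cons])
  also have "\<dots> \<simeq> []"
    using word_eq_cancel by simp
  finally show ?case by simp
qed simp

end

section \<open>Homomorphisms on fractions and the action of W x W\<close>

section \<open>Extending homomorphisms to fractions\<close>

locale frac_hom =
  fixes h :: "'a::idom \<Rightarrow> 'b::idom"
  assumes h_1: "h 1 = 1"
    and h_add: "h (a + b) = h a + h b"
    and h_mult: "h (a * b) = h a * h b"
begin

lemma h_0 [simp]: "h 0 = 0"
  by (metis add_cancel_right_right h_add)

text \<open>The graph of the partial extension. Since \<open>frac_extend\<close> is a definite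
  description, sums and products are handled in this relational form, and uniqueness is invoked only
  at the end.\<close>

definition extends_to :: "'a fract \<Rightarrow> 'b fract \<Rightarrow> bool" where
  "extends_to x y \<longleftrightarrow> (\<exists>a b. h b \<noteq> 0 \<and> x = Fract a b \<and> y = Fract (h a) (h b))"

lemma extends_to_unique:
  assumes "extends_to x y" "extends_to x y'"
  shows "y = y'"
proof -
  obtain a b a' b' where *: "h b \<noteq> 0" "x = Fract a b" "y = Fract (h a) (h b)"
    "h b' \<noteq> 0" "x = Fract a' b'" "y' = Fract (h a') (h b')"
    using assms unfolding extends_to_def by blast
  then have "b \<noteq> 0" "b' \<noteq> 0"
    by auto
  with * have "a * b' = a' * b"
    by (simp add: eq_fract)
  then have "h a * h b' = h a' * h b"
    by (simp flip: h_mult)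
  with * show ?thesis
    by (simp add: eq_fract)
qed

lemma frac_extend_eq: "extends_to x y \<Longrightarrow> frac_extend h x = y"
  unfolding frac_extend_def extends_to_def [symmetric]
  by (rule the_equality) (auto intro: extends_to_unique)

lemma extends_to_Fract: "h b \<noteq> 0 \<Longrightarrow> extends_to (Fract a b) (Fract (h a) (h b))"
  by (auto simp: extends_to_def)

lemma extends_to_0: "extends_to 0 0" and extends_to_1: "extends_to 1 1"
  using extends_to_Fract[of 1 0] extends_to_Fract[of 1 1]
  by (simp_all add: h_1 Zero_fract_def One_fract_def)

lemma extends_to_add:
  assumes "extends_to x y" "extends_to x' y'"
  shows "extends_to (x + x') (y + y')"
proof -
  obtain a b a' b' where *: "h b \<noteq> 0" "x = Fract a b" "y = Fract (h a) (h b)"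
    "h b' \<noteq> 0" "x' = Fract a' b'" "y' = Fract (h a') (h b')"
    using assms unfolding extends_to_def by blast
  then have "b \<noteq> 0" "b' \<noteq> 0"
    by auto
  with * extends_to_Fract[of "b * b'" "a * b' + a' * b"] show ?thesis
    by (simp add: h_mult h_add)
qed

lemma extends_to_mult:
  assumes "extends_to x y" "extends_to x' y'"
  shows "extends_to (x * x') (y * y')"
proof -
  obtain a b a' b' where *: "h b \<noteq> 0" "x = Fract a b" "y = Fract (h a) (h b)"
    "h b' \<noteq> 0" "x' = Fract a' b'" "y' = Fract (h a') (h b')"
    using assms unfolding extends_to_def by blast
  with extends_to_Fract[of "b * b'" "a * a'"] show ?thesis
    by (simp add: h_mult)
qed

lemma extends_to_sum: "(\<And>i. i \<in> A \<Longrightarrow> extends_to (f i) (g i)) \<Longrightarrow>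
    extends_to (sum f A) (sum g A)"
  by (induction A rule: infinite_finite_induct) (auto intro: extends_to_0 extends_to_add)

lemma extends_to_prod: "(\<And>i. i \<in> A \<Longrightarrow> extends_to (f i) (g i))
    \<Longrightarrow> extends_to (prod f A) (prod g A)"
  by (induction A rule: infinite_finite_induct) (auto intro: extends_to_1 extends_to_mult)

end

lemma frac_hom_series_subst: "frac_hom (series_subst \<sigma> :: ('v::countable) series \<Rightarrow>
    ('w::countable) series)"
proof -
  interpret lattice_hom "gen_map \<sigma> :: 'v lattice \<Rightarrow> 'w lattice"
    by (rule lattice_hom_gen_map)
  show ?thesis
    by standard (simp_all add: series_subst_conv series_map_add series_map_mult)
qed

lemma series_subst_theta:
  "series_subst \<sigma> (theta u) = theta (gen_map \<sigma> u)"
  unfolding series_subst_conv by (rule series_map_theta[OF lattice_hom_gen_map])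

lemma gen_map_add: "gen_map \<sigma> (u + v) = gen_map \<sigma> u + gen_map \<sigma> v"
  and gen_map_diff: "gen_map \<sigma> (u - v) = gen_map \<sigma> u - gen_map \<sigma> v"
  by (simp_all add: frag_extend_add frag_extend_diff)

lemma extends_to_PQ:
  fixes \<sigma> :: "('v::countable) gen \<Rightarrow> ('w::countable) gen"
  assumes "\<sigma> Hbar = Hbar" "gen_map \<sigma> x \<noteq> 0" "gen_map \<sigma> y + hbar \<noteq> 0"
  shows "frac_hom.extends_to (series_subst \<sigma>) (Pfun x y) (Pfun (gen_map \<sigma> x) (gen_map \<sigma> y))"
    and "frac_hom.extends_to (series_subst \<sigma>) (Qfun x y) (Qfun (gen_map \<sigma> x) (gen_map \<sigma> y))"
proof -
  interpret frac_hom "series_subst \<sigma> :: 'v series \<Rightarrow> 'w series"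
    by (rule frac_hom_series_subst)
  have "series_subst \<sigma> (theta (y + hbar) * theta x) \<noteq> 0"
    using assms by (simp add: h_mult series_subst_theta gen_map_add)
  from extends_to_Fract[OF this, of "theta (x - y) * theta hbar"]
    extends_to_Fract[OF this, of "theta (x + hbar) * theta y"] show "extends_to (Pfun x y) (Pfun
        (gen_map \<sigma> x) (gen_map \<sigma> y))"
    "extends_to (Qfun x y) (Qfun (gen_map \<sigma> x) (gen_map \<sigma> y))"
    unfolding Pfun_def Qfun_def
    by (simp_all add: h_mult series_subst_theta gen_map_add gen_map_diff assms(1))
qed

section \<open>The action on the field of fractions\<close>

lemma gen_map_comp: "gen_map \<sigma> (gen_map \<tau> u) = gen_map (\<sigma> \<circ> \<tau>) u"
  using frag_extend_compose[of "\<lambda>g. frag_of (\<sigma> g)" \<tau> u] by (simp add: comp_def)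

lemma gen_map_id: "gen_map id = id"
  by (simp add: fun_eq_iff flip: frag_expansion)

lemma galg_map_comp: "galg_map \<phi> (galg_map \<psi> p) = galg_map (\<phi> \<circ> \<psi>) p"
  by (induction p rule: poly_mapping_single_induct) (simp_all add: galg_map_add)

lemma galg_map_id: "galg_map id p = p"
  by (induction p rule: poly_mapping_single_induct) (simp_all add: galg_map_add)

lemma series_subst_comp: "series_subst \<sigma> (series_subst \<tau> f) = series_subst (\<sigma> \<circ> \<tau>) f"
  by (rule fps_ext) (simp add: series_subst_conv galg_map_comp gen_map_comp comp_def)

lemma series_subst_id: "series_subst id f = f"
  by (rule fps_ext) (simp add: series_subst_def gen_map_id[unfolded id_def] galg_map_id[unfolded
      id_def])

lemma act_gen_comp: "act_gen w v \<circ> act_gen w' v' = act_gen (w \<circ> w') (v \<circ> v')"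
proof
  show "(act_gen w v \<circ> act_gen w' v') g = act_gen (w \<circ> w') (v \<circ> v') g" for g
    by (cases g) simp_all
qed

lemma act_gen_id: "act_gen id id = id"
proof
  show "act_gen id id g = id g" for g
    by (cases g) simp_all
qed

context
  fixes w v :: "nat \<Rightarrow> nat"
  assumes wv: "bij w" "bij v"
begin

interpretation frac_hom "series_subst (act_gen w v) :: nat series \<Rightarrow> nat series"
  by (rule frac_hom_series_subst)

lemma act_gen_left_inverse: "act_gen (inv w) (inv v) \<circ> act_gen w v = id"
  using wv by (simp add: act_gen_comp act_gen_id inv_o_cancel bij_is_inj)

lemma series_subst_act_eq_0: "series_subst (act_gen w v) f = 0 \<Longrightarrow> f = 0"
  by (metis act_gen_left_inverse series_subst_comp series_subst_id
      frac_hom.h_0[OF frac_hom_series_subst])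

lemma gen_map_act_eq_0: "gen_map (act_gen w v) u = 0 \<longleftrightarrow> u = 0"
  by (metis act_gen_left_inverse gen_map_comp gen_map_id id_apply frag_extend_0)

text \<open>A bijective renaming is injective on series, so its extension to fractions is defined
  everywhere; \<open>act\<close> then inherits the laws of a homomorphism from the graph.\<close>

lemma act_extends_to: "extends_to x (act w v x)"
proof (cases x)
  case (Fract a b)
  then have "series_subst (act_gen w v) b \<noteq> 0"
    using series_subst_act_eq_0 by blast
  from extends_to_Fract[OF this, of a] show ?thesis
    unfolding act_def Fract by (simp add: frac_extend_eq)
qed

lemma act_eqI: "extends_to x y \<Longrightarrow> act w v x = y"
  using act_extends_to extends_to_unique by blast

lemma act_0 [simp]: "act w v 0 = 0"
  and act_1 [simp]: "act w v 1 = 1"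
  and act_add: "act w v (x + y) = act w v x + act w v y"
  and act_mult: "act w v (x * y) = act w v x * act w v y"
  and act_sum: "act w v (sum f A) = (\<Sum>i\<in>A. act w v (f i))"
  by (intro act_eqI extends_to_0 extends_to_1 extends_to_add extends_to_mult extends_to_sum
      act_extends_to)+

lemma act_PQ:
  assumes "x \<noteq> 0" "y + hbar \<noteq> 0"
  shows "act w v (Pfun x y) = Pfun (gen_map (act_gen w v) x) (gen_map (act_gen w v) y)"
    and "act w v (Qfun x y) = Qfun (gen_map (act_gen w v) x) (gen_map (act_gen w v) y)"
proof -
  have "gen_map (act_gen w v) (y + hbar) \<noteq> 0"
    using assms gen_map_act_eq_0 by blast
  then have "gen_map (act_gen w v) y + hbar \<noteq> 0"
    by (simp add: gen_map_add)
  with assms show "act w v (Pfun x y) = Pfun (gen_map (act_gen w v) x) (gen_map (act_gen w v) y)"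
    "act w v (Qfun x y) = Qfun (gen_map (act_gen w v) x) (gen_map (act_gen w v) y)"
    by (auto intro!: act_eqI extends_to_PQ simp: gen_map_act_eq_0)
qed

end

lemma act_comp:
  assumes "bij w" "bij v" "bij w'" "bij v'"
  shows "act w v (act w' v' x) = act (w \<circ> w') (v \<circ> v') x"
proof (cases x)
  case (Fract a b)
  have act_Fract: "act w v (Fract a b) = Fract (series_subst (act_gen w v) a) (series_subst
      (act_gen w v) b)"
    if "bij w" "bij v" "b \<noteq> 0" for w v a b
    using that series_subst_act_eq_0[OF that(1,2)]
    by (intro act_eqI frac_hom.extends_to_Fract[OF frac_hom_series_subst]) auto
  have "series_subst (act_gen w' v') b \<noteq> 0"
    using series_subst_act_eq_0[OF assms(3,4)] Fract by blast
  with Fract assms show ?thesis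
    by (simp add: act_Fract bij_comp series_subst_comp act_gen_comp)
qed

lemma act_id: "act id id x = x"
proof (cases x)
  case (Fract a b)
  interpret frac_hom "series_subst (act_gen id id) :: nat series \<Rightarrow> nat series"
    by (rule frac_hom_series_subst)
  have "extends_to x x"
    unfolding extends_to_def using Fract by (intro exI[of _ a] exI[of _ b])
        (simp add: act_gen_id series_subst_id)
  then show ?thesis
    by (rule act_eqI[OF bij_id bij_id])
qed

section \<open>The grid, its partition function and the recursion in u\<close>

section \<open>The grid\<close>

lemma word_perm_Nil [simp]: "word_perm [] = id"
  and word_perm_Cons: "word_perm (k # ks) = simple_refl k \<circ> word_perm ks"
  and word_perm_append: "word_perm (ks @ ls) = word_perm ks \<circ> word_perm ls"
proof -
  show "word_perm [] = id" "word_perm (k # ks) = simple_refl k \<circ> word_perm ks" for k ks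
    by (simp_all add: word_perm_def)
  then show "word_perm (ks @ ls) = word_perm ks \<circ> word_perm ls" for ks ls
    by (induction ks) (simp_all add: comp_assoc)
qed

lemma word_perm_rev_upt:
  assumes "a \<le> b"
  shows "word_perm (rev [a..<b]) x = (if x = a then b else if a < x \<and> x \<le> b then x - 1 else x)"
  using assms
proof (induction b rule: dec_induct)
  case (step b)
  then show ?case
    by (auto simp: word_perm_Cons Transposition.transpose_def)
qed simp

lemma word_perm_upt:
  assumes "a \<le> b"
  shows "word_perm [a..<b] x = (if x = b then a else if a \<le> x \<and> x < b then Suc x else x)"
  using assms
proof (induction b arbitrary: x rule: dec_induct)
  case (step b)
  then show ?case
    by (auto simp: word_perm_append word_perm_Cons Transposition.transpose_def)
qed simp

text \<open>
  The first \<open>m\<close> rows, counted from the bottom, of the \<open>n \<times> n\<close> grid occupying the sites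
  \<open>o' + 1, \<dots>, o' + 2n\<close>; the tile \<open>(i, j)\<close> lies at the sites \<open>o' + i + j - 1\<close> and \<open>o' + i + j\<close>.
\<close>

primrec grid_word :: "nat \<Rightarrow> nat \<Rightarrow> nat \<Rightarrow> nat list" where
  "grid_word n o' 0 = []"
| "grid_word n o' (Suc m) = grid_word n o' m @ [o' + (n - m)..<o' + (n - m) + n]"

lemma set_grid_word: "m \<le> n \<Longrightarrow> k \<in> set (grid_word n o' m) \<Longrightarrow> o' +
    n - m < k \<and> k < o' + 2 * n"
  by (induction m) auto

lemma map_pred_grid_word:
  "m \<le> n \<Longrightarrow> map (\<lambda>k. k - 1) (grid_word n (Suc o') m) = grid_word n o' m"
  by (induction m) (auto simp: map_Suc_upt[symmetric] comp_def simp del: upt_Suc)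

context colouring
begin

text \<open>Colours may cross or bounce, but spectral parameters always change places. After the
  word \<open>ks\<close> they are therefore known, and the remaining amplitude matters only at these
  parameters.\<close>

lemma crossings_at:
  assumes "\<And>\<sigma>. inj \<sigma> \<Longrightarrow> \<Psi> (\<zeta> \<circ> word_perm ks) \<sigma> = \<Phi>
      (\<zeta> \<circ> word_perm ks) \<sigma>" "inj \<sigma>"
  shows "W ks \<Psi> \<zeta> \<sigma> = W ks \<Phi> \<zeta> \<sigma>"
  using assms
proof (induction ks arbitrary: \<zeta> \<sigma>)
  case (Cons k ks)
  have "W ks \<Psi> (\<zeta> \<circ> simple_refl k) \<sigma>' = W ks \<Phi> (\<zeta> \<circ> simple_refl k) \<sigma>'" if "inj \<sigma>'" for \<sigma>'
    using Cons.prems(1) that by (intro Cons.IH) (simp_all only: word_perm_Cons comp_assoc)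
  with Cons.prems(2) show ?case
    by (simp only: crossings_Cons crossing_def inj_comp_transpose)
qed simp

lemma crossing_trivial:
  assumes "\<zeta> k = \<zeta> (Suc k)" "inj \<sigma>"
  shows "R k \<Psi> \<zeta> \<sigma> = \<Psi> \<zeta> \<sigma>"
proof -
  have "\<zeta> \<circ> simple_refl k = \<zeta>"
    using assms(1) by (auto simp: fun_eq_iff Transposition.transpose_def)
  moreover have "c (\<sigma> k) - c (\<sigma> (Suc k)) \<noteq> 0"
    using assms(2) by (intro colour_diff_ne) auto
  ultimately show ?thesis
    using assms(1) by (simp add: crossing_def PQ_at_0)
qed

lemma word_eq_shift_word:
  assumes "\<And>k. k \<in> set ks \<Longrightarrow> a < k \<and> k < b"
  shows "ks @ [a..<b] \<simeq> [a..<b] @ map (\<lambda>k. k - 1) ks"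
  using assms
proof (induction ks)
  case (Cons k ks)
  have "[k] @ (ks @ [a..<b]) \<simeq> [k] @ ([a..<b] @ map (\<lambda>k. k - 1) ks)"
    using Cons by (intro word_eq_append[OF word_eq_refl]) simp
  also have "\<dots> = ([k] @ [a..<b]) @ map (\<lambda>k. k - 1) ks"
    by simp
  also have "\<dots> \<simeq> ([a..<b] @ [k - 1]) @ map (\<lambda>k. k - 1) ks"
    using Cons.prems by (intro word_eq_append word_eq_shift) auto
  finally show ?case by simp
qed simp

text \<open>Every row is an ascending run of sites, so a crossing of two columns is shifted down by
  one site by each row that it passes.\<close>

lemma column_exchange:
  assumes "1 \<le> i" "i < n" "m \<le> n"
  shows "[o' + n + i] @ grid_word n o' m \<simeq> grid_word n o' m @ [o' + n + i - m]"
  using assms(3)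
proof (induction m)
  case (Suc m)
  let ?r = "[o' + (n - m)..<o' + (n - m) + n]"
  have "([o' + n + i] @ grid_word n o' m) @ ?r \<simeq> (grid_word n o' m @ [o' + n + i - m]) @ ?r"
    using Suc by (intro word_eq_append[OF _ word_eq_refl]) simp
  also have "\<dots> = grid_word n o' m @ [o' + n + i - m] @ ?r"
    by simp
  also have "\<dots> \<simeq> grid_word n o' m @ ?r @ [o' + n + i - m - 1]"
    using Suc.prems assms by (intro word_eq_append word_eq_shift word_eq_refl) auto
  finally show ?case
    by (simp del: upt_Suc)
qed simp

text \<open>The tile of column 1 in a new row lies at least two sites to the left of all earlier
  tiles of the other columns. It commutes with them, so column 1 can be completed first; the other
  columns form a grid of width n.\<close>

lemma grid_word_column:
  assumes "m \<le> n"
  shows "grid_word (Suc n) o' m \<simeq> rev [o' + Suc n - m + 1..<o' + Suc n + 1] @ grid_word n (o' + 2)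
      m"
  using assms
proof (induction m)
  case (Suc m)
  let ?k = "o' + (Suc n - m)" and ?G = "grid_word n (o' + 2) m"
  let ?r = "[Suc ?k..<?k + Suc n]" and ?v = "rev [o' + Suc n - m + 1..<o' + Suc n + 1]"
  have row: "[?k..<?k + Suc n] = [?k] @ ?r"
    by (simp add: upt_conv_Cons del: upt_Suc)
  have "Suc ?k < l" if "l \<in> set ?G" for l
    using set_grid_word[OF _ that] Suc.prems by auto
  then have comm: "?G @ [?k] \<simeq> [?k] @ ?G"
    by (intro word_eq_sym[OF word_eq_commute_list]) auto
  have "grid_word (Suc n) o' m @ [?k..<?k + Suc n] \<simeq> (?v @ ?G) @ [?k] @ ?r"
    unfolding row using Suc by (intro word_eq_append[OF _ word_eq_refl]) simp
  also have "\<dots> = ?v @ (?G @ [?k]) @ ?r"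
    by simp
  also have "\<dots> \<simeq> ?v @ ([?k] @ ?G) @ ?r"
    by (intro word_eq_context comm)
  also have "\<dots> = (?v @ [?k]) @ ?G @ ?r"
    by simp
  also have "?v @ [?k] = rev [o' + Suc n - Suc m + 1..<o' + Suc n + 1]"
    using Suc.prems by (simp add: upt_conv_Cons[of "Suc (o' + n - m)"] Suc_diff_le del: upt_Suc)
  also have "?r = [o' + 2 + (n - m)..<o' + 2 + (n - m) + n]"
    using Suc.prems by (simp add: Suc_diff_le del: upt_Suc)
  finally show ?case
    by (simp del: upt_Suc)
qed simp

text \<open>
  If row and column parameters coincide, the line of column 1 can be detached at the trivial tile
  \<open>(1, 1)\<close> and pulled over the remaining \<open>(n - 1) \<times> (n - 1)\<close> grid.
\<close>

lemma grid_trivial: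
  assumes "\<And>j. j \<in> {1..n} \<Longrightarrow> \<zeta> (o' + j) = \<zeta> (o' + n + j)" "inj \<sigma>"
  shows "W (grid_word n o' n) \<Psi> \<zeta> \<sigma> = \<Psi> \<zeta> \<sigma>"
  using assms
proof (induction n arbitrary: o' \<zeta> \<sigma> \<Psi>)
  case (Suc n)
  let ?v = "rev [o' + 2..<o' + n + 2]" and ?G = "grid_word n (o' + 2) n"
  let ?G' = "grid_word n (o' + 1) n"
  let ?A = "[o' + n + 2..<o' + 2 * n + 2]"
  have row: "[o' + 1..<o' + 1 + Suc n] = [o' + 1] @ [o' + 2..<o' + n + 2]"
    by (simp add: upt_conv_Cons del: upt_Suc)
  have v: "rev [o' + Suc n - n + 1..<o' + Suc n + 1] = ?v"
    by (simp del: upt_Suc)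
  have "Suc (o' + 1) < l" if "l \<in> set ?G" for l
    using set_grid_word[OF _ that] by auto
  then have comm: "?G @ [o' + 1] \<simeq> [o' + 1] @ ?G"
    by (intro word_eq_sym[OF word_eq_commute_list]) auto
  have "grid_word (Suc n) o' (Suc n) = grid_word (Suc n) o' n @ [o' + 1] @ [o' + 2..<o' + n + 2]"
    using row by (simp del: upt_Suc)
  also have "\<dots> \<simeq> (?v @ ?G) @ [o' + 1] @ [o' + 2..<o' + n + 2]"
    using grid_word_column[of n n o'] unfolding v by (intro word_eq_append word_eq_refl) auto
  also have "\<dots> = ?v @ (?G @ [o' + 1]) @ [o' + 2..<o' + n + 2]"
    by simp
  also have "\<dots> \<simeq> ?v @ ([o' + 1] @ ?G) @ [o' + 2..<o' + n + 2]"
    by (intro word_eq_context comm)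
  finally have 1: "grid_word (Suc n) o' (Suc n) \<simeq> ?v @ [o' + 1] @ ?G @ [o' + 2..<o' + n + 2]"
    by simp
  have upt: "[o' + 2..<o' + n + 2] @ ?A = [o' + 2..<o' + 2 * n + 2]"
  proof -
    have "o' + n + 2 + n = o' + 2 * n + 2"
      by simp
    then show ?thesis
      using upt_add_eq_append[of "o' + 2" "o' + n + 2" n] by
          (simp only: add_le_mono le_add1 order_refl)
  qed
  have "?v @ ?G @ [o' + 2..<o' + n + 2] = ?v @ ?G @ [o' + 2..<o' + n + 2] @ []"
    by simp
  \<comment> \<open>Appending \<open>?A @ rev ?A\<close>, trivial by unitarity, lengthens the line
    of column 1 until it passes all sites of the remaining grid, which can then be shifted by one
    site as a whole.\<close>
  also have "\<dots> \<simeq> ?v @ ?G @ [o' + 2..<o' + n + 2] @ (?A @ rev ?A)"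
    by (intro word_eq_append word_eq_refl word_eq_sym[OF word_eq_rev])
  also have "\<dots> = ?v @ (?G @ [o' + 2..<o' + 2 * n + 2]) @ rev ?A"
    by (simp only: append_assoc flip: upt)
  also have "\<dots> \<simeq> ?v @ ([o' + 2..<o' + 2 * n + 2] @ map (\<lambda>k. k - 1) ?G) @ rev ?A"
    using set_grid_word[of n n _ "o' + 2"] by (intro word_eq_context word_eq_shift_word) fastforce
  also have "map (\<lambda>k. k - 1) ?G = ?G'"
    using map_pred_grid_word[of n n "o' + 1"] by simp
  also have "?v @ ([o' + 2..<o' + 2 * n + 2] @ ?G') @ rev ?A =
      (?v @ rev ?v) @ ?A @ ?G' @ rev ?A"
    by (simp only: append_assoc rev_rev_ident flip: upt)
  also have "\<dots> \<simeq> [] @ ?A @ ?G' @ rev ?A"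
    by (intro word_eq_append word_eq_rev word_eq_refl)
  finally have 2: "?v @ ?G @ [o' + 2..<o' + n + 2] \<simeq> ?A @ ?G' @ rev ?A"
    by simp
  let ?\<zeta> = "\<zeta> \<circ> word_perm ?v"
  have "W (grid_word (Suc n) o' (Suc n)) \<Psi> \<zeta> \<sigma> =
      W ?v (R (o' + 1) (W (?G @ [o' + 2..<o' + n + 2]) \<Psi>)) \<zeta> \<sigma>"
    using 1 \<open>inj \<sigma>\<close> by (simp add: word_eq_def crossings_append)
  also have "\<dots> = W ?v (W (?G @ [o' + 2..<o' + n + 2]) \<Psi>) \<zeta> \<sigma>"
  proof (rule crossings_at[OF crossing_trivial \<open>inj \<sigma>\<close>])
    \<comment> \<open>After column 1 has gone up along \<open>?v\<close>, its line lies next to that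
      of row 1, and both carry the same parameter.\<close>
    show "?\<zeta> (o' + 1) = ?\<zeta> (Suc (o' + 1))"
      using Suc.prems(1)[of 1] by (simp add: word_perm_rev_upt del: upt_Suc)
  qed
  also have "\<dots> = W (?A @ ?G' @ rev ?A) \<Psi> \<zeta> \<sigma>"
    using 2 \<open>inj \<sigma>\<close> by (simp add: word_eq_def flip: crossings_append)
  also have "\<dots> = W ?A (W ?G' (W (rev ?A) \<Psi>)) \<zeta> \<sigma>"
    by (simp add: crossings_append)
  also have "\<dots> = W ?A (W (rev ?A) \<Psi>) \<zeta> \<sigma>"
  proof (rule crossings_at[OF Suc.IH \<open>inj \<sigma>\<close>])
    fix j assume "j \<in> {1..n}"
    then show "(\<zeta> \<circ> word_perm ?A) (o' + 1 + j) = (\<zeta> \<circ> word_perm ?A) (o' + 1 + n + j)"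
      using Suc.prems(1)[of "Suc j"] by (simp add: word_perm_upt del: upt_Suc)
  qed
  also have "\<dots> = \<Psi> \<zeta> \<sigma>"
    using word_eq_rev[of ?A] \<open>inj \<sigma>\<close> by (simp add: word_eq_def flip: crossings_append)
  finally show ?case .
qed simp

end

lemma word_perm_row:
  "word_perm [i..<i + n] x = (if x = i + n then i else if i \<le> x \<and> x < i + n then Suc x else x)"
  by (rule word_perm_upt) simp

lemma word_perm_grid:
  assumes "m \<le> n" "j \<in> {1..n}"
  shows "word_perm (grid_word n 0 m) (n - m + j) = n + j"
  using assms(1)
proof (induction m)
  case (Suc m)
  have "word_perm [n - m..<n - m + n] (n - Suc m + j) = n - m + j"
    using Suc.prems assms(2) by (subst word_perm_row) auto
  with Suc show ?case
    by (simp only: grid_word.simps word_perm_append comp_apply add_0 Suc_leD)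
qed simp

section \<open>The partition function\<close>

definition colour :: "nat \<Rightarrow> nat \<Rightarrow> 'v lattice" where
  "colour n a = (if a \<le> n then lam a else frag_cmul (int a - int n - 1) hbar)"

lemma inj_colour: "inj (colour n :: nat \<Rightarrow> 'v lattice)"
proof (rule injI)
  fix a b assume *: "colour n a = (colour n b :: 'v lattice)"
  have 1: "Poly_Mapping.lookup (colour n a :: 'v lattice) (Lam k) = (if a = k \<and>
      a \<le> n then 1 else 0)"
    "Poly_Mapping.lookup (colour n a :: 'v lattice) Hbar =
        (if a \<le> n then 0 else int a - int n - 1)" for a k
    by (auto simp: colour_def)
  show "a = b"
    using 1(1)[of a a] 1(1)[of b a] 1(1)[of b b] 1(1)[of a b] 1(2)[of a] 1(2)[of b] unfolding *
    by (auto split: if_splits)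
qed

definition top_amplitude :: "nat \<Rightarrow> (nat \<Rightarrow> nat) \<Rightarrow> amplitude"
    where
  "top_amplitude n w = (\<lambda>\<zeta> \<sigma>. if \<forall>i\<in>{1..n}. \<sigma> (w i) = i then 1 else 0)"

definition spectral :: "nat \<Rightarrow> (nat \<Rightarrow> nat)
    \<Rightarrow> nat \<Rightarrow> nat" where
  "spectral n u k = (if k \<le> n then u k else k - n)"

text \<open>The state \<open>id\<close> puts colour i at the left end of row i and colour n + j, of
  value (j - 1) hbar, at the bottom of column j. Row i has the parameter z_u(i), the image of x_i
  under localization, and column j has z_j.\<close>

definition partition_fun :: "nat \<Rightarrow> (nat \<Rightarrow> nat) \<Rightarrow>
    (nat \<Rightarrow> nat) \<Rightarrow> nat frac" where
  "partition_fun n u w =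
     crossings (colour n) (grid_word n 0 n) (top_amplitude n w) (spectral n u) id"

global_interpretation gl: colouring "colour n" for n
  by standard (rule inj_colour)

lemma partition_fun_id:
  assumes "w \<in> Sym n"
  shows "partition_fun n id w = (if w = id then 1 else 0)"
proof -
  have "(\<forall>i\<in>{1..n}. id (w i) = i) \<longleftrightarrow> w = id"
    using assms by (auto simp: fun_eq_iff permutes_def)
  moreover have "partition_fun n id w = top_amplitude n w (spectral n id) id"
    unfolding partition_fun_def by (rule gl.grid_trivial) (auto simp: spectral_def)
  ultimately show ?thesis
    by (simp add: top_amplitude_def)
qed

lemma gen_map_act_var [simp]: "gen_map (act_gen w v) (var i) = var (w i)"
  and gen_map_act_lam [simp]: "gen_map (act_gen w v) (lam i) = lam (v i)"
  by simp_all

lemma gen_map_colour: "gen_map (act_gen w id) (colour n a) = colour n a"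
  by (simp add: colour_def frag_extend_cmul)

text \<open>The colours involve only lambda and hbar, which are fixed when the second permutation is
  \<open>id\<close>. Permuting the z_i thus only renames spectral parameters.\<close>

lemma act_crossings:
  assumes "bij f" "\<And>\<zeta> \<sigma>. act f id (\<Psi> \<zeta> \<sigma>) = \<Psi> (f \<circ> \<zeta>) \<sigma>" "inj \<sigma>"
  shows "act f id (crossings (colour n) ks \<Psi> \<zeta> \<sigma>) = crossings (colour n) ks \<Psi> (f \<circ> \<zeta>) \<sigma>"
  using assms(3)
proof (induction ks arbitrary: \<zeta> \<sigma>)
  case (Cons k ks)
  have ne: "colour n (\<sigma> k) - colour n (\<sigma> (Suc k)) \<noteq> (0 :: nat lattice)"
    by (rule gl.colour_diff_ne[OF Cons.prems]) simp
  note IH = Cons.IH[OF Cons.prems] Cons.IH[OF inj_comp_transpose[OF Cons.prems]]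
  show ?case
    unfolding crossings_Cons crossing_def Let_def act_add[OF assms(1) bij_id]
        act_mult[OF assms(1) bij_id] act_PQ[OF assms(1) bij_id ne Hbar_coeff_ne(1)] IH gen_map_diff
        gen_map_colour gen_map_act_var comp_assoc comp_apply ..
qed (simp add: assms(2))

text \<open>Exchanging z_i and z_(i+1) undoes the factor \<open>simple_refl i\<close> in the row
  parameters and exchanges the parameters of the columns i and i + 1.\<close>

lemma spectral_refl:
  assumes "1 \<le> i" "i < n"
  shows "simple_refl i \<circ> spectral n (simple_refl i \<circ> u) = spectral n u \<circ> simple_refl (n + i)"
proof
  fix k
  show "(simple_refl i \<circ> spectral n (simple_refl i \<circ> u)) k = (spectral n u \<circ> simple_refl (n + i)) k"
    using assms by (auto simp: spectral_def Transposition.transpose_def)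
qed

text \<open>The two terms are the bounce and the crossing above the grid. In the second the colours
  prescribed at the top positions i and i + 1 are exchanged, hence the argument - L of Q.\<close>

lemma partition_fun_step:
  assumes w: "w \<in> Sym n" and i: "i \<in> {1..<n}"
  defines "L \<equiv> lam (inv w i) - lam (inv w (Suc i))" and "z \<equiv> var (Suc i) - var i :: nat lattice"
  shows "act (simple_refl i) id (partition_fun n (simple_refl i \<circ> u) w) =
    Pfun L z * partition_fun n u w + Qfun (- L) z * partition_fun n u (simple_refl i \<circ> w)"
proof -
  let ?s = "simple_refl i" and ?c = "colour n :: nat \<Rightarrow> nat lattice" and ?g =
      "grid_word n 0 n"
  let ?W = "crossings ?c" and ?\<zeta> = "spectral n u"
  have "bij ?s"
    by simp
  have "act ?s id (partition_fun n (?s \<circ> u) w) = ?W ?g (top_amplitude n w) (?\<zeta> \<circ> simple_refl (n +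
      i)) id"
    unfolding partition_fun_def using i
    by (subst act_crossings) (auto simp: top_amplitude_def act_0 act_1 spectral_refl)
  \<comment> \<open>Below the grid the sites n + i and n + i + 1 carry neighbouring empty strands. A
    crossing inserted there merely exchanges the two column parameters.\<close>
  also have "\<dots> = crossing ?c (n + i) (?W ?g (top_amplitude n w)) ?\<zeta> id"
  proof -
    have "?c (n + i) - ?c (Suc (n + i)) = - hbar"
      using i by (auto simp: colour_def frag_cmul_diff_distrib[symmetric] algebra_simps simp flip:
          frag_cmul_minus_one)
    then show ?thesis
      by (simp add: crossing_def PQ_at_minus_hbar)
  qed
  also have "\<dots> = ?W ([n + i] @ ?g) (top_amplitude n w) ?\<zeta> id"
    by simp
  also have "\<dots> = ?W (?g @ [i]) (top_amplitude n w) ?\<zeta> id"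
    using gl.column_exchange[of i n n n 0] i by (simp add: gl.word_eq_def)
  also have "\<dots> = ?W ?g (crossing ?c i (top_amplitude n w)) ?\<zeta> id"
    by (simp add: crossings_append)
  also have "\<dots> = ?W ?g (\<lambda>\<zeta> \<sigma>. Pfun L z * top_amplitude n w \<zeta> \<sigma> + Qfun (- L) z * top_amplitude n
      (?s \<circ> w) \<zeta> \<sigma>) ?\<zeta> id"
  \<comment> \<open>Above the grid the parameter of column j is at site j, so the last crossing has
    the fixed argument z.\<close>
  proof (rule gl.crossings_at)
    fix \<sigma> :: "nat \<Rightarrow> nat" assume "inj \<sigma>"
    let ?\<zeta>' = "?\<zeta> \<circ> word_perm ?g"
    have "?\<zeta>' j = j" if "j \<in> {1..n}" for j
      using word_perm_grid[of n n j] that by (simp add: spectral_def)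
    then have z: "var (?\<zeta>' (Suc i)) - var (?\<zeta>' i) = z"
      using i by (simp add: z_def)
    have wi: "inv w j \<in> {1..n}" "w (inv w j) = j" if "j \<in> {1..n}" for j
      using w that by (simp_all only: mem_Collect_eq permutes_in_image[OF permutes_inv]
          permutes_inverses(1))
    have in_n: "i \<in> {1..n}" "Suc i \<in> {1..n}"
      using i by auto
    have 1: "?c (\<sigma> i) - ?c (\<sigma> (Suc i)) = L" if "\<forall>j\<in>{1..n}. \<sigma> (w j) = j"
    proof -
      have "\<sigma> j = inv w j" if "j \<in> {1..n}" for j
        using \<open>\<forall>j\<in>{1..n}. \<sigma> (w j) = j\<close> wi[OF that] by metis
      then show ?thesis
        using wi in_n by (simp add: L_def colour_def)
    qed
    have 2: "?c (\<sigma> i) - ?c (\<sigma> (Suc i)) = - L" if "\<forall>j\<in>{1..n}. \<sigma> (?s (w j)) = j"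
    proof -
      have "\<sigma> (?s j) = inv w j" if "j \<in> {1..n}" for j
        using \<open>\<forall>j\<in>{1..n}. \<sigma> (?s (w j)) = j\<close> wi[OF that] by metis
      from this[OF in_n(1)] this[OF in_n(2)] show ?thesis
        using wi in_n by (simp add: L_def colour_def)
    qed
    show "crossing ?c i (top_amplitude n w) ?\<zeta>' \<sigma> = Pfun L z * top_amplitude n w ?\<zeta>' \<sigma>
        + Qfun (- L) z * top_amplitude n (?s \<circ> w) ?\<zeta>' \<sigma>"
    proof -
      let ?a = "?c (\<sigma> i) - ?c (\<sigma> (Suc i))"
      have "Pfun ?a z * top_amplitude n w \<zeta>' \<sigma> = Pfun L z * top_amplitude n w \<zeta>'' \<sigma>" for \<zeta>' \<zeta>''
        using 1 by (simp add: top_amplitude_def)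
      moreover have "Qfun ?a z * top_amplitude n w \<zeta>' (\<sigma> \<circ> ?s) =
          Qfun (- L) z * top_amplitude n (?s \<circ> w) \<zeta>'' \<sigma>" for \<zeta>' \<zeta>''
        using 2 by (simp add: top_amplitude_def)
      ultimately show ?thesis
        unfolding crossing_def Let_def z by metis
    qed
  qed simp
  also have "\<dots> = Pfun L z * partition_fun n u w + Qfun (- L) z * partition_fun n u (?s \<circ> w)"
  proof -
    have "?W ks (\<lambda>\<zeta> \<sigma>. p * \<Psi> \<zeta> \<sigma> + q * \<Phi> \<zeta> \<sigma>) \<zeta> \<sigma> = p * ?W ks \<Psi> \<zeta> \<sigma> + q *
        ?W ks \<Phi> \<zeta> \<sigma>"
      for ks p q \<Psi> \<Phi> \<zeta> \<sigma>
      by (induction ks arbitrary: \<zeta> \<sigma>) (simp_all add: crossing_def Let_def algebra_simps)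
    then show ?thesis
      by (simp add: partition_fun_def)
  qed
  finally show ?thesis .
qed

section \<open>Bruhat order, triangularity of the partition functions and their inverse
  matrix\<close>

section \<open>Inversions and the Bruhat order\<close>

definition inversions :: "nat \<Rightarrow> (nat \<Rightarrow> nat) \<Rightarrow> (nat \<times> nat) set"
    where
  "inversions n w = {(a, b). a \<in> {1..n} \<and> b \<in> {1..n} \<and> a < b \<and> w b < w a}"

lemma finite_inversions [simp]: "finite (inversions n w)"
  by (rule finite_subset[of _ "{1..n} \<times> {1..n}"]) (auto simp: inversions_def)

lemma Sym_comp: "u \<in> Sym n \<Longrightarrow> v \<in> Sym n \<Longrightarrow> u \<circ> v \<in> Sym n"
  by (simp add: permutes_compose)

lemma transpose_Sym: "i \<in> {1..n} \<Longrightarrow> j \<in> {1..n} \<Longrightarrow>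
    Transposition.transpose i j \<in> Sym n"
  by (simp add: permutes_swap_id)

lemma simple_refl_Sym: "i \<in> {1..<n} \<Longrightarrow> simple_refl i \<in> Sym n"
  by (rule transpose_Sym) auto

text \<open>The injection f moves a pair by the transposition if this keeps the pair increasing, and
  leaves it alone otherwise. Its image consists of inversions of the new permutation and misses (i,
  j), which is an inversion as well.\<close>

lemma card_inversions_less:
  assumes w: "w \<in> Sym n" and ij: "i \<in> {1..n}" "j \<in> {1..n}" "i < j" and less: "w i < w j"
  shows "card (inversions n w) < card (inversions n (w \<circ> Transposition.transpose i j))"
proof -
  let ?t = "Transposition.transpose i j"
  define f where "f = (\<lambda>(a, b). if ?t a < ?t b then (?t a, ?t b) else (a, b))"
  have inj: "inj_on f (inversions n w)"
  proof (rule inj_onI)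
    fix p q assume "p \<in> inversions n w" "q \<in> inversions n w" "f p = f q"
    then show "p = q"
      by (cases p; cases q) (auto simp: f_def inversions_def split: if_splits dest:
          transpose_eq_imp_eq)
  qed
  have sub: "f ` inversions n w \<subseteq> inversions n (w \<circ> ?t) - {(i, j)}"
  proof (rule image_subsetI)
    fix p assume "p \<in> inversions n w"
    then obtain a b where *: "p = (a, b)" "a \<in> {1..n}" "b \<in> {1..n}" "a < b" "w b < w a"
      by (auto simp: inversions_def)
    have "f p \<in> inversions n (w \<circ> ?t)"
      using * ij less by (auto simp: f_def inversions_def Transposition.transpose_def split:
          if_splits)
    moreover have "f p \<noteq> (i, j)"
      using * ij less by (auto simp: f_def Transposition.transpose_def split: if_splits)
    ultimately show "f p \<in> inversions n (w \<circ> ?t) - {(i, j)}"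
      by simp
  qed
  have "(i, j) \<in> inversions n (w \<circ> ?t)"
    using ij less by (simp add: inversions_def)
  then have "inversions n (w \<circ> ?t) - {(i, j)} \<subset> inversions n (w \<circ> ?t)"
    by auto
  then have "card (f ` inversions n w) < card (inversions n (w \<circ> ?t))"
    using sub by (intro psubset_card_mono) auto
  then show ?thesis
    by (simp add: card_image inj)
qed

lemma simple_refl_comp_eq:
  assumes "w permutes S"
  shows "simple_refl i \<circ> w = w \<circ> Transposition.transpose (inv w i) (inv w (Suc i))"
proof
  fix x
  have inv: "w (inv w y) = y" "inv w (w y) = y" for y
    using assms by (auto simp: permutes_inverses)
  then have "x = inv w y \<longleftrightarrow> w x = y" for y
    by metis
  then show "(simple_refl i \<circ> w) x = (w \<circ> Transposition.transpose (inv w i) (inv w (Suc i))) x"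
    by (simp add: Transposition.transpose_def inv)
qed

lemma Sym_inv_apply:
  assumes "w \<in> Sym n"
  shows "x \<in> {1..n} \<Longrightarrow> inv w x \<in> {1..n}" "w (inv w x) = x" "inv w (w x) = x"
      "inv w \<in> Sym n"
proof -
  have "w permutes {1..n}"
    using assms by simp
  then show "x \<in> {1..n} \<Longrightarrow> inv w x \<in> {1..n}" "w (inv w x) = x" "inv w (w x) = x"
      "inv w \<in> Sym n"
    using permutes_inv[of w "{1..n}"] permutes_in_image[of "inv w" "{1..n}" x]
    by (simp_all only: permutes_inverses mem_Collect_eq)
qed

lemma Sym_inv_inject: "w \<in> Sym n \<Longrightarrow> inv w x = inv w y \<longleftrightarrow> x = y"
  by (metis Sym_inv_apply(2))

lemma inversions_simple_refl:
  assumes "w \<in> Sym n" "i \<in> {1..<n}"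
  shows "card (inversions n (simple_refl i \<circ> w)) \<le> Suc (card (inversions n w))"
proof -
  have "inversions n (simple_refl i \<circ> w) \<subseteq> insert (inv w i, inv w (Suc i)) (inversions n w)"
  proof safe
    fix a b assume *: "(a, b) \<in> inversions n (simple_refl i \<circ> w)" "(a, b) \<notin> inversions n w"
    then have "w a = i" "w b = Suc i"
      by (auto simp: inversions_def Transposition.transpose_def split: if_splits)
    then show "a = inv w i" "b = inv w (Suc i)"
      using Sym_inv_apply(3)[OF assms(1)] by metis+
  qed
  then have "card (inversions n (simple_refl i \<circ> w)) \<le> card (insert (inv w i, inv w (Suc i))
      (inversions n w))"
    by (intro card_mono) auto
  also have "\<dots> \<le> Suc (card (inversions n w))"
    by (simp add: card_insert_if)
  finally show ?thesis .
qed

lemma Sym_descent: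
  assumes "w \<in> Sym n" "w \<noteq> id"
  obtains i where "i \<in> {1..<n}" "inv w (Suc i) < inv w i"
proof -
  have "\<exists>i\<in>{1..<n}. inv w (Suc i) < inv w i"
  proof (rule ccontr)
    assume "\<not> ?thesis"
    then have mono: "inv w i < inv w (Suc i)" if "i \<in> {1..<n}" for i
      using that Sym_inv_inject[OF assms(1), of i "Suc i"] by (auto simp: not_less le_less)
    \<comment> \<open>Used from 1 to i and from i to n, this bounds \<open>inv w i\<close> by i from
      below and from above.\<close>
    have up: "inv w i + d \<le> inv w (i + d)" if "1 \<le> i" "i + d \<le> n" for i d
      using that
    proof (induction d)
      case (Suc d)
      have "inv w (i + d) < inv w (Suc (i + d))"
        using Suc.prems by (intro mono) auto
      with Suc show ?case by simp
    qed simp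
    have "inv w i = i" if "i \<in> {1..n}" for i
      using up[of 1 "i - 1"] up[of i "n - i"] that Sym_inv_apply(1)[OF assms(1), of 1]
        Sym_inv_apply(1)[OF assms(1), of n] by auto
    then have "w i = i" if "i \<in> {1..n}" for i
      using that Sym_inv_apply(2)[OF assms(1), of i] by simp
    then have "w = id"
      using assms(1) by (auto simp: fun_eq_iff permutes_def)
    with assms(2) show False by simp
  qed
  with that show ?thesis by blast
qed

lemma word_of_Sym: "word_of n ks w \<Longrightarrow> w \<in> Sym n"
proof (induction ks arbitrary: w)
  case (Cons k ks)
  then have "word_of n ks (word_perm ks)" "k \<in> {1..<n}" "w = simple_refl k \<circ> word_perm ks"
    by (auto simp: word_of_def word_perm_Cons)
  with Cons.IH show ?case
    by (metis Sym_comp simple_refl_Sym)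
qed (simp add: word_of_def permutes_id)

lemma inversions_le_length: "word_of n ks w \<Longrightarrow> card (inversions n w) \<le> length ks"
proof (induction ks arbitrary: w)
  case Nil
  then have "inversions n w = {}"
    by (auto simp: word_of_def inversions_def)
  then show ?case by simp
next
  case (Cons k ks)
  then have *: "word_of n ks (word_perm ks)" "k \<in> {1..<n}" "w = simple_refl k \<circ> word_perm ks"
    by (auto simp: word_of_def word_perm_Cons)
  show ?case
    using Cons.IH[OF *(1)] inversions_simple_refl[OF word_of_Sym[OF *(1)] *(2)]
    unfolding *(3) list.size by linarith
qed

lemma inversions_descent:
  assumes "w \<in> Sym n" "i \<in> {1..<n}" "inv w (Suc i) < inv w i"
  shows "card (inversions n w) = Suc (card (inversions n (simple_refl i \<circ> w)))"
proof -
  let ?s = "simple_refl i" and ?a = "inv w (Suc i)" and ?b = "inv w i"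
  have sw: "?s \<circ> w \<in> Sym n"
    using assms(1,2) by (intro Sym_comp simple_refl_Sym)
  have "(?s \<circ> w) ?a = i" "(?s \<circ> w) ?b = Suc i"
    using Sym_inv_apply(2)[OF assms(1)] by auto
  moreover have "?a \<in> {1..n}" "?b \<in> {1..n}"
    using assms(2) by (intro Sym_inv_apply(1)[OF assms(1)]; simp)+
  ultimately have "card (inversions n (?s \<circ> w)) < card (inversions n
      (?s \<circ> w \<circ> Transposition.transpose ?a ?b))"
    using assms(3) by (intro card_inversions_less[OF sw]) (simp_all only: lessI)
  moreover have "?s \<circ> w \<circ> Transposition.transpose ?a ?b = w"
    using simple_refl_comp_eq[of w "{1..n}" i] assms(1) by (simp add: transpose_commute)
  moreover have "card (inversions n (?s \<circ> (?s \<circ> w))) \<le> Suc (card (inversions n (?s \<circ> w)))"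
    by (rule inversions_simple_refl[OF sw assms(2)])
  ultimately show ?thesis
    by (simp flip: comp_assoc)
qed

lemma exists_word:
  assumes "w \<in> Sym n"
  shows "\<exists>ks. word_of n ks w \<and> length ks = card (inversions n w)"
  using assms
proof (induction "card (inversions n w)" arbitrary: w rule: less_induct)
  case less
  show ?case
  proof (cases "w = id")
    case True
    then have "inversions n w = {}"
      by (auto simp: inversions_def)
    then show ?thesis
      using True by (intro exI[of _ "[]"]) (simp add: word_of_def)
  next
    case False
    with less.prems obtain i where i: "i \<in> {1..<n}" "inv w (Suc i) < inv w i"
      using Sym_descent by blast
    note * = inversions_descent[OF less.prems i]
    have "simple_refl i \<circ> w \<in> Sym n"
      using i(1) less.prems by (intro Sym_comp simple_refl_Sym)
    with less.hyps[of "simple_refl i \<circ> w"] * obtain ks where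
      "word_of n ks (simple_refl i \<circ> w)" "length ks = card (inversions n (simple_refl i \<circ> w))"
      by auto
    with i(1) * show ?thesis
      by (intro exI[of _ "i # ks"]) (auto simp: word_of_def word_perm_Cons simp flip: comp_assoc)
  qed
qed

lemma cox_length_eq:
  assumes "w \<in> Sym n"
  shows "cox_length n w = card (inversions n w)"
  unfolding cox_length_def
proof (rule Least_equality)
  show "\<exists>ks. word_of n ks w \<and> length ks = card (inversions n w)"
    by (rule exists_word[OF assms])
qed (auto dest: inversions_le_length)

lemma cox_length_transpose:
  assumes "w \<in> Sym n" "i \<in> {1..n}" "j \<in> {1..n}" "i < j"
  shows "cox_length n w < cox_length n (w \<circ> Transposition.transpose i j) \<longleftrightarrow> w i < w j"
proof -
  let ?t = "Transposition.transpose i j"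
  have wt: "w \<circ> ?t \<in> Sym n"
    using assms(1-3) by (intro Sym_comp transpose_Sym)
  have "w i \<noteq> w j"
    using assms permutes_inj[of w] by (auto simp: inj_def)
  then consider "w i < w j" | "w j < w i"
    by linarith
  then show ?thesis
  proof cases
    case 1
    with card_inversions_less[OF assms] show ?thesis
      by (simp only: cox_length_eq[OF assms(1)] cox_length_eq[OF wt])
  next
    case 2
    then have "(w \<circ> ?t) i < (w \<circ> ?t) j"
      by simp
    from card_inversions_less[OF wt assms(2-4) this] 2 show ?thesis
      unfolding cox_length_eq[OF assms(1)] cox_length_eq[OF wt] transpose_involutory_comp
          by linarith
  qed
qed

definition reflection_step :: "nat \<Rightarrow> (nat \<Rightarrow> nat) \<Rightarrow>
    (nat \<Rightarrow> nat) \<Rightarrow> bool" where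
  "reflection_step n u v \<longleftrightarrow> (\<exists>i\<in>{1..n}. \<exists>j\<in>{1..n}. i \<noteq> j \<and> v = u \<circ> Transposition.transpose i j \<and>
     cox_length n u < cox_length n v)"

lemma bruhat_le_conv: "bruhat_le n = (reflection_step n)\<^sup>*\<^sup>*"
  by (simp add: bruhat_le_def reflection_step_def [abs_def])

lemma reflection_stepI:
  assumes "u \<in> Sym n" "i \<in> {1..n}" "j \<in> {1..n}" "i < j" "u i < u j"
  shows "reflection_step n u (u \<circ> Transposition.transpose i j)"
proof -
  have "cox_length n u < cox_length n (u \<circ> Transposition.transpose i j)"
    using cox_length_transpose[OF assms(1-4)] assms(5) by (rule iffD2)
  then show ?thesis
    unfolding reflection_step_def using assms(2-4) by (intro bexI[of _ i] bexI[of _ j] conjI refl)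
        auto
qed

lemma reflection_stepE:
  assumes "reflection_step n u v" "u \<in> Sym n"
  obtains i j where "i \<in> {1..n}" "j \<in> {1..n}" "i < j" "u i < u j"
    "v = u \<circ> Transposition.transpose i j" "v \<in> Sym n"
proof -
  obtain a b where ab: "a \<in> {1..n}" "b \<in> {1..n}" "a \<noteq> b" "v = u \<circ> Transposition.transpose a b"
    "cox_length n u < cox_length n v"
    using assms(1) unfolding reflection_step_def by blast
  define i j where "i = min a b" and "j = max a b"
  have "Transposition.transpose i j = Transposition.transpose a b"
    by (cases "a \<le> b") (simp_all add: i_def j_def min_def max_def transpose_commute)
  with ab have *: "i \<in> {1..n}" "j \<in> {1..n}" "i < j" "v = u \<circ> Transposition.transpose i j"
    "cox_length n u < cox_length n v"
    by (auto simp: i_def j_def)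
  have "v \<in> Sym n"
    unfolding *(4) using *(1,2) assms(2) by (intro Sym_comp transpose_Sym)
  moreover have "u i < u j"
    using cox_length_transpose[OF assms(2) *(1-3)] *(5) unfolding *(4) by (rule iffD1)
  ultimately show ?thesis
    using that[OF *(1-3) _ *(4)] by blast
qed

lemma bruhat_le_Sym: "bruhat_le n u v \<Longrightarrow> u \<in> Sym n \<Longrightarrow> v \<in> Sym n"
  unfolding bruhat_le_conv by (induction rule: rtranclp_induct) (auto elim: reflection_stepE)

lemma bruhat_le_length: "bruhat_le n u v \<Longrightarrow> u = v \<or> cox_length n u < cox_length n v"
  unfolding bruhat_le_conv by (induction rule: rtranclp_induct) (auto simp: reflection_step_def)

lemma simple_refl_step:
  assumes "u \<in> Sym n" "i \<in> {1..<n}" "inv u i < inv u (Suc i)"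
  shows "reflection_step n u (simple_refl i \<circ> u)"
proof -
  have "simple_refl i \<circ> u = u \<circ> Transposition.transpose (inv u i) (inv u (Suc i))"
    using assms by (intro simple_refl_comp_eq) simp
  moreover have "i \<in> {1..n}" "Suc i \<in> {1..n}"
    using assms(2) by auto
  ultimately show ?thesis
    using reflection_stepI[OF assms(1) Sym_inv_apply(1)[OF assms(1)] Sym_inv_apply(1)[OF assms(1)]
        assms(3)]
    by (simp only: Sym_inv_apply(2)[OF assms(1)] lessI)
qed

text \<open>A weak form of the lifting property, by induction along a chain of reflections. A step
  from u to u' either is left multiplication by s_i, so that s_i u = u', or remains
  length-increasing after left multiplication by s_i.\<close>

lemma bruhat_lifting:
  assumes "bruhat_le n v u" "v \<in> Sym n" "i \<in> {1..<n}"
  shows "bruhat_le n (simple_refl i \<circ> v) u \<or> bruhat_le n (simple_refl i \<circ> v) (simple_refl i \<circ> u)"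
  using assms(1) unfolding bruhat_le_conv
proof (induction rule: rtranclp_induct)
  case (step u u')
  let ?s = "simple_refl i"
  have u: "u \<in> Sym n"
    using bruhat_le_Sym[OF _ assms(2)] step.hyps(1) by (simp add: bruhat_le_conv)
  obtain a b where ab: "a \<in> {1..n}" "b \<in> {1..n}" "a < b" "u a < u b"
    "u' = u \<circ> Transposition.transpose a b"
    using reflection_stepE[OF step.hyps(2) u] by metis
  show ?case
  proof (cases "u a = i \<and> u b = Suc i")
    case True
    then have "inv u i = a" "inv u (Suc i) = b"
      using Sym_inv_apply(3)[OF u] by metis+
    then have "?s \<circ> u = u'"
      using simple_refl_comp_eq[of u "{1..n}" i] u ab(5) by simp
    with step show ?thesis
      by (metis rtranclp.rtrancl_into_rtrancl)
  next
    case False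
    have su: "?s \<circ> u \<in> Sym n"
      using u assms(3) by (intro Sym_comp simple_refl_Sym)
    have "(?s \<circ> u) a < (?s \<circ> u) b"
      using ab(4) False by (auto simp: Transposition.transpose_def)
    then have "reflection_step n (?s \<circ> u) (?s \<circ> u')"
      using reflection_stepI[OF su ab(1-3)] by (simp add: ab(5) comp_assoc)
    with step show ?thesis
      by (metis rtranclp.rtrancl_into_rtrancl)
  qed
qed simp

lemma bruhat_lifting_up:
  assumes "bruhat_le n v u" "v \<in> Sym n" "u \<in> Sym n" "i \<in> {1..<n}" "inv u i < inv u (Suc i)"
  shows "bruhat_le n (simple_refl i \<circ> v) (simple_refl i \<circ> u)" "bruhat_le n v (simple_refl i \<circ> u)"
proof -
  have "reflection_step n u (simple_refl i \<circ> u)"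
    using assms by (intro simple_refl_step) auto
  then show "bruhat_le n (simple_refl i \<circ> v) (simple_refl i \<circ> u)" "bruhat_le n v
      (simple_refl i \<circ> u)"
    using bruhat_lifting[OF assms(1,2,4)] assms(1) unfolding bruhat_le_conv
    by (metis rtranclp.rtrancl_into_rtrancl)+
qed

section \<open>Inverting the partition function\<close>

text \<open>Back substitution: if m has maximal rank, column m vanishes outside row m. The system
  without m is solved by induction, and row m then determines the unknown at m.\<close>

lemma triangular_solve:
  fixes M :: "'w \<Rightarrow> 'w \<Rightarrow> 'f::field" and r :: "'w \<Rightarrow> int"
  assumes "finite S"
    and "\<And>u w. u \<in> S \<Longrightarrow> w \<in> S \<Longrightarrow> M u w \<noteq> 0 \<Longrightarrow>
        u \<noteq> w \<Longrightarrow> r w < r u"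
    and "\<And>u. u \<in> S \<Longrightarrow> M u u \<noteq> 0"
  shows "\<exists>x. \<forall>u\<in>S. (\<Sum>w\<in>S. M u w * x w) = e u"
  using assms
proof (induction "card S" arbitrary: S)
  case (Suc k)
  then have "S \<noteq> {}" "finite S"
    by auto
  then have "Max (r ` S) \<in> r ` S"
    by (intro Max_in) auto
  then obtain m where m: "m \<in> S" "r m = Max (r ` S)"
    by auto
  then have max: "r u \<le> r m" if "u \<in> S" for u
    using that \<open>finite S\<close> by simp
  let ?S = "S - {m}"
  have "\<exists>x. \<forall>u\<in>?S. (\<Sum>w\<in>?S. M u w * x w) = e u"
    using Suc m by (intro Suc.hyps(1)) auto
  then obtain x where x: "\<And>u. u \<in> ?S \<Longrightarrow> (\<Sum>w\<in>?S. M u w * x w) = e u"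
    by blast
  define y where "y = x(m := (e m - (\<Sum>w\<in>?S. M m w * x w)) / M m m)"
  have split: "(\<Sum>w\<in>S. M u w * y w) = M u m * y m + (\<Sum>w\<in>?S. M u w * x w)" for u
    unfolding sum.remove[OF \<open>finite S\<close> m(1)] by (simp add: y_def)
  have "(\<Sum>w\<in>S. M u w * y w) = e u" if "u \<in> S" for u
  proof (cases "u = m")
    case True
    then show ?thesis
      unfolding split using Suc.prems(3)[OF m(1)] by (simp add: y_def)
  next
    case False
    then have "M u m = 0"
      using Suc.prems(2)[OF that m(1)] max[OF that] by fastforce
    then show ?thesis
      unfolding split using False that x by simp
  qed
  then show ?case by blast
qed simp

text \<open>The columns of a right inverse solve the given system, the rows of a left inverse the
  transposed one, for which - r takes the place of r; this is why r has integer values. The two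
  inverses agree by associativity.\<close>

lemma triangular_inverse:
  fixes M :: "'w \<Rightarrow> 'w \<Rightarrow> 'f::field" and r :: "'w \<Rightarrow> int"
  assumes fin: "finite S"
    and tri: "\<And>u w. u \<in> S \<Longrightarrow> w \<in> S \<Longrightarrow>
        M u w \<noteq> 0 \<Longrightarrow> u \<noteq> w \<Longrightarrow> r w < r u"
    and diag: "\<And>u. u \<in> S \<Longrightarrow> M u u \<noteq> 0"
  shows "\<exists>C. \<forall>u\<in>S. \<forall>v\<in>S. (\<Sum>w\<in>S. M u w * C w v) = (if u = v then 1 else 0) \<and>
    (\<Sum>w\<in>S. C u w * M w v) = (if u = v then 1 else 0)"
proof -
  have "\<exists>x. \<forall>u\<in>S. (\<Sum>w\<in>S. M u w * x w) = (if u = v then 1 else 0)" for v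
    using assms by (rule triangular_solve)
  then obtain C where C: "\<And>u v. u \<in> S \<Longrightarrow> (\<Sum>w\<in>S. M u w * C v w) = (if u =
      v then 1 else 0)"
    by metis
  have "\<exists>x. \<forall>v\<in>S. (\<Sum>w\<in>S. M w v * x w) = (if u = v then 1 else 0)" for u
    by (rule triangular_solve[where M = "\<lambda>v w. M w v" and r = "\<lambda>u. - r u", OF fin])
        (use tri diag in auto)
  then obtain D where D: "\<And>u v. v \<in> S \<Longrightarrow> (\<Sum>w\<in>S. M w v * D u w) = (if u =
      v then 1 else 0)"
    by metis
  have "D u v = C v u" if "u \<in> S" "v \<in> S" for u v
  proof -
    have "D u v = (\<Sum>x\<in>S. D u x * (\<Sum>w\<in>S. M x w * C v w))"
      using that fin by (simp add: C if_distrib cong: if_cong)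
    also have "\<dots> = (\<Sum>w\<in>S. (\<Sum>x\<in>S. M x w * D u x) * C v w)"
      by (simp add: sum_distrib_left sum_distrib_right mult_ac) (rule sum.swap)
    also have "\<dots> = C v u"
      using that fin by (simp add: D if_distrib[of "\<lambda>a. a * _"] cong: if_cong)
    finally show ?thesis .
  qed
  then have "(\<Sum>w\<in>S. C w u * M w v) = (if u = v then 1 else 0)" if "u \<in> S" "v \<in> S" for u v
    using D[OF that(2), of u] that by (simp add: mult.commute cong: sum.cong)
  with C show ?thesis
    by (intro exI[of _ "\<lambda>w v. C v w"]) simp
qed

declare finite_permutations [simp]

lemma finite_Sym: "finite (Sym n)"
  by simp

lemma id_Sym: "id \<in> Sym n"
  by (simp add: permutes_id)

lemma bij_simple_refl: "bij (simple_refl i)"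
  by simp

lemma simple_refl_cancel: "simple_refl i \<circ> (simple_refl i \<circ> w) = w"
  by (simp flip: comp_assoc)

lemma refl_Sym: "i \<in> {1..<n} \<Longrightarrow> w \<in> Sym n \<Longrightarrow>
    simple_refl i \<circ> w \<in> Sym n"
  by (intro Sym_comp simple_refl_Sym)

lemma inv_refl:
  assumes "w \<in> Sym n"
  shows "inv (simple_refl i \<circ> w) x = inv w (simple_refl i x)"
proof -
  have "bij w"
    using assms permutes_bij by auto
  then have "inv (simple_refl i \<circ> w) = inv w \<circ> inv (simple_refl i)"
    by (intro o_inv_distrib) auto
  then show ?thesis
    by simp
qed

definition dyn_root :: "nat \<Rightarrow> (nat \<Rightarrow> nat) \<Rightarrow> nat lattice" where
  "dyn_root i w = lam (inv w i) - lam (inv w (Suc i))"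

abbreviation spec_root :: "nat \<Rightarrow> nat lattice" where
  "spec_root i \<equiv> var i - var (Suc i)"

lemma dyn_root_refl: "w \<in> Sym n \<Longrightarrow> dyn_root i (simple_refl i \<circ> w) = - dyn_root i w"
  by (simp add: dyn_root_def inv_refl)

lemma lam_diff_ne: "a \<noteq> b \<Longrightarrow> lam a - lam b \<noteq> (0 :: 'v lattice)"
  by (simp add: frag_of_eq)

lemma var_diff_ne: "a \<noteq> b \<Longrightarrow> var a - var b \<noteq> (0 :: 'v lattice)"
  by (simp add: frag_of_eq)

lemma lam_diff_hbar_ne: "lam a - lam b + hbar \<noteq> (0 :: 'v lattice)"
proof
  assume "lam a - lam b + hbar = (0 :: 'v lattice)"
  then have "Poly_Mapping.lookup (lam a - lam b + hbar :: 'v lattice) Hbar = 0"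
    by simp
  then show False
    by (simp add: lookup_add lookup_minus)
qed

lemma dyn_root_ne:
  assumes "w \<in> Sym n"
  shows "dyn_root i w \<noteq> 0" "dyn_root i w + hbar \<noteq> 0" "- dyn_root i w + hbar \<noteq> 0"
proof -
  show "dyn_root i w \<noteq> 0"
    unfolding dyn_root_def using Sym_inv_inject[OF assms, of i "Suc i"] by (intro lam_diff_ne) simp
  show "dyn_root i w + hbar \<noteq> 0" "- dyn_root i w + hbar \<noteq> 0"
    unfolding dyn_root_def minus_diff_eq by (rule lam_diff_hbar_ne)+
qed

lemma spec_root_ne: "spec_root i \<noteq> 0" "spec_root i + hbar \<noteq> 0" "- spec_root i + hbar \<noteq> 0"
  unfolding minus_diff_eq by (rule var_diff_ne Hbar_coeff_ne, simp?)+

text \<open>The roles of the two arguments of \<open>P\<close> and \<open>Q\<close> are exchanged when an identity is solved for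
    \<open>\<delta>\<^sub>s\<close>.\<close>

lemma PQ_duality:
  assumes "x \<noteq> 0" "y \<noteq> 0" "x + hbar \<noteq> 0" "y + hbar \<noteq> 0"
  shows "Qfun x y * Qfun y x = 1" "Qfun y x * Pfun x y = - Pfun y x" "Qfun x y \<noteq> 0"
proof -
  have "thf x \<noteq> 0" "thf y \<noteq> 0" "thf (x + hbar) \<noteq> 0" "thf (y + hbar) \<noteq> 0"
    using assms by simp_all
  then show "Qfun x y * Qfun y x = 1" "Qfun y x * Pfun x y = - Pfun y x" "Qfun x y \<noteq> 0"
    unfolding Pfun_conv Qfun_conv thf_swap[of x y] by simp_all
qed

lemma act_refl_refl: "act (simple_refl i) id (act (simple_refl i) id x) = x"
  by (simp add: act_comp act_id bij_simple_refl)

lemma act_refl_PQ: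
  assumes "w \<in> Sym n"
  shows "act (simple_refl i) id (Pfun (dyn_root i w) (- spec_root i)) = Pfun (dyn_root i w)
      (spec_root i)"
    "act (simple_refl i) id (Qfun (- dyn_root i w) (- spec_root i)) = Qfun (- dyn_root i w)
        (spec_root i)"
proof -
  have 1: "gen_map (act_gen (simple_refl i) id) (dyn_root i w) = dyn_root i w"
    "gen_map (act_gen (simple_refl i) id) (- dyn_root i w) = - dyn_root i w"
    "gen_map (act_gen (simple_refl i) id) (- spec_root i) = spec_root i"
    unfolding dyn_root_def minus_diff_eq gen_map_diff by simp_all
  have "- dyn_root i w \<noteq> 0"
    using dyn_root_ne(1)[OF assms, of i] by simp
  then show "act (simple_refl i) id (Pfun (dyn_root i w) (- spec_root i)) = Pfun (dyn_root i w)
      (spec_root i)"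
    "act (simple_refl i) id (Qfun (- dyn_root i w) (- spec_root i)) = Qfun (- dyn_root i w)
        (spec_root i)"
    using act_PQ[OF bij_simple_refl bij_id _ spec_root_ne(3)] dyn_root_ne(1)[OF assms]
    by (simp_all only: 1 not_False_eq_True)
qed

lemma partition_fun_refl:
  assumes "w \<in> Sym n" "i \<in> {1..<n}"
  shows "act (simple_refl i) id (partition_fun n (simple_refl i \<circ> u) w) =
    Pfun (dyn_root i w) (- spec_root i) * partition_fun n u w +
    Qfun (- dyn_root i w) (- spec_root i) * partition_fun n u (simple_refl i \<circ> w)"
  using partition_fun_step[OF assms] by (simp add: dyn_root_def)

lemma partition_fun_refl':
  assumes "w \<in> Sym n" "i \<in> {1..<n}"
  shows "partition_fun n (simple_refl i \<circ> u) w =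
    Pfun (dyn_root i w) (spec_root i) * act (simple_refl i) id (partition_fun n u w) +
    Qfun (- dyn_root i w) (spec_root i) * act (simple_refl i) id (partition_fun n u
        (simple_refl i \<circ> w))"
  using arg_cong[OF partition_fun_refl[OF assms], of "act (simple_refl i) id"]
  by (simp only: act_refl_refl act_add[OF bij_simple_refl bij_id] act_mult[OF bij_simple_refl
      bij_id]
      act_refl_PQ[OF assms(1)])

text \<open>Induction on the number of inversions. A descent writes u as s_i u' with u' shorter; the
  recursion expresses the value at (u, w) by those at (u', w) and (u', s_i w), and the lifting
  property carries the Bruhat support from u' to u.\<close>

lemma partition_fun_triangular:
  assumes "u \<in> Sym n"
  shows "(\<forall>w\<in>Sym n. partition_fun n u w \<noteq> 0 \<longrightarrow> bruhat_le n w u) \<and> partition_fun n u u \<noteq> 0"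
  using assms
proof (induction "card (inversions n u)" arbitrary: u rule: less_induct)
  case less
  show ?case
  proof (cases "u = id")
    case True
    then show ?thesis
      by (simp add: partition_fun_id permutes_id bruhat_le_conv)
  next
    case False
    with less.prems obtain i where i: "i \<in> {1..<n}" "inv u (Suc i) < inv u i"
      using Sym_descent by blast
    define u' where "u' = simple_refl i \<circ> u"
    have u: "u = simple_refl i \<circ> u'"
      by (simp add: u'_def simple_refl_cancel del: comp_apply)
    have u': "u' \<in> Sym n"
      unfolding u'_def using i(1) less.prems by (rule refl_Sym)
    have len: "card (inversions n u') < card (inversions n u)"
      using inversions_descent[OF less.prems i] by (simp add: u'_def)
    note IH = less.hyps[OF len u']
    have up: "inv u' i < inv u' (Suc i)"
      using i(2) by (simp add: u'_def inv_refl[OF less.prems])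
    have "bruhat_le n w u" if w: "w \<in> Sym n" and ne: "partition_fun n u w \<noteq> 0" for w
    proof -
      have "partition_fun n u' w \<noteq> 0 \<or> partition_fun n u' (simple_refl i \<circ> w) \<noteq> 0"
      proof (rule ccontr)
        assume "\<not> ?thesis"
        then have "partition_fun n u w = 0"
          unfolding u partition_fun_refl'[OF w i(1)] by (simp add: act_0 bij_simple_refl)
        with ne show False by simp
      qed
      then have "bruhat_le n w u' \<or> bruhat_le n (simple_refl i \<circ> w) u'"
        using IH w refl_Sym[OF i(1) w] by blast
      then show ?thesis
      proof
        assume "bruhat_le n w u'"
        from bruhat_lifting_up(2)[OF this w u' i(1) up] show ?thesis
          unfolding u .
      next
        assume "bruhat_le n (simple_refl i \<circ> w) u'"
        from bruhat_lifting_up(1)[OF this refl_Sym[OF i(1) w] u' i(1) up] show ?thesis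
          unfolding u simple_refl_cancel .
      qed
    qed
    moreover have "partition_fun n u u \<noteq> 0"
    proof -
      \<comment> \<open>As u is longer than u', only the Q term of the recursion survives on the
        diagonal, and its coefficient is nonzero.\<close>
      have "\<not> bruhat_le n u u'"
        using bruhat_le_length[of n u u'] len
        unfolding cox_length_eq[OF u'] cox_length_eq[OF less.prems] by auto
      then have "partition_fun n u' u = 0"
        using IH less.prems by blast
      then have "act (simple_refl i) id (partition_fun n u u) =
          Qfun (- dyn_root i u) (- spec_root i) * partition_fun n u' u'"
        using partition_fun_refl[OF less.prems i(1), of u'] by
            (simp only: u [symmetric] u'_def [symmetric]) simp
      moreover have "Qfun (- dyn_root i u) (- spec_root i) \<noteq> 0"
        using dyn_root_ne[OF less.prems, of i] spec_root_ne[of i] by (intro PQ_duality(3)) auto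
      ultimately have "act (simple_refl i) id (partition_fun n u u) \<noteq> 0"
        using IH by simp
      then show ?thesis
        by (auto simp: act_0 bij_simple_refl)
    qed
    ultimately show ?thesis by blast
  qed
qed

definition inverse_of_partition_fun :: "nat \<Rightarrow> ((nat \<Rightarrow> nat) \<Rightarrow>
    (nat \<Rightarrow> nat) \<Rightarrow> nat frac) \<Rightarrow> bool" where
  "inverse_of_partition_fun n C \<longleftrightarrow> (\<forall>u\<in>Sym n. \<forall>v\<in>Sym n.
     (\<Sum>w\<in>Sym n. partition_fun n u w * C w v) = (if u = v then 1 else 0) \<and>
     (\<Sum>w\<in>Sym n. C u w * partition_fun n w v) = (if u = v then 1 else 0))"

lemma exists_inverse: "\<exists>C. inverse_of_partition_fun n C"
proof -
  have "int (cox_length n w) < int (cox_length n u)"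
    if "u \<in> Sym n" "w \<in> Sym n" "partition_fun n u w \<noteq> 0" "u \<noteq> w" for u w
    using partition_fun_triangular[OF that(1)] that(2-4) bruhat_le_length[of n w u] by auto
  note * = this
  have diag: "partition_fun n u u \<noteq> 0" if "u \<in> Sym n" for u
    using partition_fun_triangular[OF that] by (rule conjunct2)
  show ?thesis
    unfolding inverse_of_partition_fun_def
    by (rule triangular_inverse[of "Sym n" "partition_fun n" "\<lambda>u. int (cox_length n u)",
        OF finite_Sym * diag])
qed

context
  fixes n :: nat and C
  assumes C: "inverse_of_partition_fun n C"
begin

lemma inverse_right:
  "u \<in> Sym n \<Longrightarrow> v \<in> Sym n \<Longrightarrow> (\<Sum>w\<in>Sym n. partition_fun n u w *
      C w v) = (if u = v then 1 else 0)"
  and inverse_left: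
  "u \<in> Sym n \<Longrightarrow> v \<in> Sym n \<Longrightarrow> (\<Sum>w\<in>Sym n. C u w *
      partition_fun n w v) = (if u = v then 1 else 0)"
  using C by (auto simp: inverse_of_partition_fun_def)

lemma inverse_id:
  assumes "v \<in> Sym n"
  shows "C id v = (if v = id then 1 else 0)"
proof -
  have "(\<Sum>w\<in>Sym n. partition_fun n id w * C w v) = (\<Sum>w\<in>Sym n. if w =
      id then C w v else 0)"
    by (intro sum.cong refl) (simp add: partition_fun_id)
  then have "(\<Sum>w\<in>Sym n. partition_fun n id w * C w v) = C id v"
    by (simp add: permutes_id)
  with inverse_right[OF id_Sym assms] show ?thesis
    by (auto split: if_splits)
qed

lemma sum_refl_reindex:
  assumes "i \<in> {1..<n}"
  shows "(\<Sum>u\<in>Sym n. f (simple_refl i \<circ> u)) = (\<Sum>u\<in>Sym n. f u)"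
proof (rule sum.reindex_bij_witness[where i = "\<lambda>u. simple_refl i \<circ> u" and j =
    "\<lambda>u. simple_refl i \<circ> u"])
qed (use refl_Sym[OF assms] in \<open>simp_all only: simple_refl_cancel\<close>)

text \<open>The recursion is transported to the inverse matrix: s is applied to C b = 1, where b is
  the matrix of partition functions, which evaluates the sum in \<open>key\<close>; multiplication
  by C from the right then isolates one entry.\<close>

lemma inverse_refl_aux:
  assumes w: "w \<in> Sym n" and v: "v \<in> Sym n" and i: "i \<in> {1..<n}"
  defines "s \<equiv> simple_refl i"
  shows "act s id (C w (s \<circ> v)) =
    Pfun (dyn_root i w) (spec_root i) * C w v + Qfun (dyn_root i w) (spec_root i) * C (s \<circ> w) v"
proof -
  let ?b = "partition_fun n" and ?a = "act s id"
  have bij: "bij s"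
    by (simp add: s_def)
  note act_simps = act_sum[OF bij bij_id] act_mult[OF bij bij_id] act_0[OF bij bij_id] act_1[OF
      bij bij_id]
  have sw: "s \<circ> w' \<in> Sym n" if "w' \<in> Sym n" for w'
    unfolding s_def using i that by (rule refl_Sym)
  have act_delta: "(\<Sum>u\<in>Sym n. ?a (C w u) * ?a (?b u w')) = (if w = w' then 1 else 0)" if
      "w' \<in> Sym n" for w'
    using arg_cong[OF inverse_left[OF w that], of ?a] by (simp add: act_simps split: if_splits)
  have key: "(\<Sum>u\<in>Sym n. ?a (C w (s \<circ> u)) * ?b u w') =
      (if w' = w then Pfun (dyn_root i w) (spec_root i) else 0) +
      (if w' = s \<circ> w then Qfun (dyn_root i w) (spec_root i) else 0)" if w': "w' \<in> Sym n" for w'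
  proof -
    have "(\<Sum>u\<in>Sym n. ?a (C w (s \<circ> u)) * ?b u w') = (\<Sum>u\<in>Sym n. ?a (C w u) * ?b (s \<circ> u) w')"
      using sum_refl_reindex[OF i, of "\<lambda>u. ?a (C w u) * ?b (s \<circ> u) w'"]
      by (simp only: s_def simple_refl_cancel)
    also have "\<dots> = (\<Sum>u\<in>Sym n. Pfun (dyn_root i w') (spec_root i) * (?a (C w u) * ?a
        (?b u w')) +
        Qfun (- dyn_root i w') (spec_root i) * (?a (C w u) * ?a (?b u (s \<circ> w'))))"
      unfolding s_def partition_fun_refl'[OF w' i] by (simp add: algebra_simps)
    also have "\<dots> = Pfun (dyn_root i w') (spec_root i) * (if w = w' then 1 else 0) +
        Qfun (- dyn_root i w') (spec_root i) * (if w = s \<circ> w' then 1 else 0)"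
      by (simp only: sum.distrib act_delta[OF w'] act_delta[OF sw[OF w']] flip: sum_distrib_left)
    also have "\<dots> = (if w' = w then Pfun (dyn_root i w) (spec_root i) else 0) +
        (if w' = s \<circ> w then Qfun (dyn_root i w) (spec_root i) else 0)"
    proof -
      have "w = s \<circ> w' \<longleftrightarrow> w' = s \<circ> w"
        unfolding s_def by (metis simple_refl_cancel)
      moreover have "- dyn_root i (s \<circ> w) = dyn_root i w"
        unfolding s_def dyn_root_refl[OF w] by simp
      ultimately show ?thesis
        by auto
    qed
    finally show ?thesis .
  qed
  have "?a (C w (s \<circ> v)) = (\<Sum>u\<in>Sym n. ?a (C w (s \<circ> u)) * (if u = v then 1 else 0))"
    using v by (simp add: if_distrib cong: if_cong)
  also have "\<dots> = (\<Sum>u\<in>Sym n. ?a (C w (s \<circ> u)) * (\<Sum>w'\<in>Sym n. ?b u w' * C w' v))"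
    by (intro sum.cong refl) (simp only: inverse_right[OF _ v])
  also have "\<dots> = (\<Sum>w'\<in>Sym n. (\<Sum>u\<in>Sym n. ?a (C w (s \<circ> u)) * ?b u w') * C w' v)"
    by (simp only: sum_distrib_left sum_distrib_right mult.assoc) (rule sum.swap)
  also have "\<dots> = (\<Sum>w'\<in>Sym n. (if w' = w then Pfun (dyn_root i w) (spec_root i) *
      C w v else 0) +
      (if w' = s \<circ> w then Qfun (dyn_root i w) (spec_root i) * C (s \<circ> w) v else 0))"
  proof (intro sum.cong refl)
    fix w' assume "w' \<in> Sym n"
    show "(\<Sum>u\<in>Sym n. ?a (C w (s \<circ> u)) * ?b u w') * C w' v =
      (if w' = w then Pfun (dyn_root i w) (spec_root i) * C w v else 0) +
      (if w' = s \<circ> w then Qfun (dyn_root i w) (spec_root i) * C (s \<circ> w) v else 0)"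
      unfolding key[OF \<open>w' \<in> Sym n\<close>] by (simp add: distrib_right)
  qed
  also have "\<dots> = Pfun (dyn_root i w) (spec_root i) * C w v + Qfun (dyn_root i w) (spec_root i) * C
      (s \<circ> w) v"
    unfolding sum.distrib using w sw[OF w] by (simp only: sum.delta finite_Sym if_True)
  finally show ?thesis .
qed

text \<open>The preceding identity solved for the entry at s w. By \<open>PQ_duality\<close> the
  coefficients become P and Q with their arguments exchanged, which is the form in which they occur
  in T_i.\<close>

lemma inverse_refl:
  assumes w: "w \<in> Sym n" and v: "v \<in> Sym n" and i: "i \<in> {1..<n}"
  defines "s \<equiv> simple_refl i"
  shows "C (s \<circ> w) v = Pfun (spec_root i) (dyn_root i w) * C w v +
    Qfun (spec_root i) (dyn_root i w) * act s id (C w (s \<circ> v))"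
proof -
  note dual = PQ_duality[OF dyn_root_ne(1)[OF w, of i] spec_root_ne(1)[of i] dyn_root_ne(2)[OF w,
      of i] spec_root_ne(2)[of i]]
  have "y = p' * x + q' * (p * x + q * y)" if "q * q' = 1" "q' * p = - p'" for p q p' q' x y ::
      "nat frac"
    using that by algebra
  from this[OF dual(1,2)] show ?thesis
    unfolding s_def inverse_refl_aux[OF w v i] .
qed

end

section \<open>Products of the generators T_i and the coefficients b(u,w)\<close>

section \<open>Products of the generators\<close>

lemma basis_sum:
  assumes "a \<in> Sym n" "b \<in> Sym n"
  shows "(\<Sum>x\<in>Sym n. \<Sum>y\<in>Sym n. basis a b x y * F x y) = F a b"
proof -
  have "(\<Sum>y\<in>Sym n. basis a b x y * F x y) = (if x = a then F a b else 0)" for x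
  proof -
    have "(\<Sum>y\<in>Sym n. basis a b x y * F x y) = (\<Sum>y\<in>Sym n. if y = b then (if x =
        a then F a b else 0) else 0)"
      by (intro sum.cong) (auto simp: basis_def)
    then show ?thesis
      using assms by (simp only: sum.delta finite_Sym if_True)
  qed
  then show ?thesis
    using assms by (simp only: sum.delta finite_Sym if_True)
qed

text \<open>Moving delta^d_s to the right past the coefficients P and Q applies s to the lambda
  variables in them.\<close>

lemma T_gen_eq:
  assumes i: "i \<in> {1..<n}"
  defines "s \<equiv> simple_refl i"
  defines "p \<equiv> act id s (Pfun (spec_root i) (lam i - lam (Suc i)))"
    and "q \<equiv> act id s (Qfun (spec_root i) (lam i - lam (Suc i)))"
  shows "T_gen n i x y = p * basis id s x y + q * basis s s x y"
proof -
  have s: "s \<in> Sym n" "inv s = s" "bij s"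
    using simple_refl_Sym[OF i] by (simp_all add: s_def)
  have sy: "inv s \<circ> y = id \<longleftrightarrow> y = s"
    unfolding s(2) unfolding s_def by (metis comp_id simple_refl_cancel)
  have ne: "s \<noteq> id"
    unfolding s_def by (metis id_apply n_not_Suc_n transpose_apply_first)
  show ?thesis
  proof (cases "x \<in> Sym n \<and> y \<in> Sym n")
    case True
    then show ?thesis
      unfolding T_gen_def tw_mult_def s_def [symmetric]
      by (simp only: basis_sum[OF id_Sym s(1)] if_True)
        (simp add: tw_add_def tw_scale_def basis_def sy ne p_def q_def act_add act_mult act_0
            act_1 bij_id s(3))
  next
    case False
    then show ?thesis
      using s(1) id_Sym[of n] by (auto simp: T_gen_def tw_mult_def basis_def)
  qed
qed

lemma tw_mult_T_gen:
  assumes i: "i \<in> {1..<n}" and xy: "x \<in> Sym n" "y \<in> Sym n"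
  defines "s \<equiv> simple_refl i"
  defines "p \<equiv> act id s (Pfun (spec_root i) (lam i - lam (Suc i)))"
    and "q \<equiv> act id s (Qfun (spec_root i) (lam i - lam (Suc i)))"
  shows "tw_mult n (T_gen n i) t x y = p * act id s (t x (s \<circ> y)) + q * act s s (t (s \<circ> x) (s \<circ> y))"
proof -
  have s: "s \<in> Sym n" "inv s = s"
    using simple_refl_Sym[OF i] by (simp_all add: s_def)
  have "tw_mult n (T_gen n i) t x y =
      (\<Sum>w\<in>Sym n. \<Sum>v\<in>Sym n. p * (basis id s w v * act w v (t (inv w \<circ> x) (inv v \<circ> y)))
        + q * (basis s s w v * act w v (t (inv w \<circ> x) (inv v \<circ> y))))"
    using xy unfolding tw_mult_def T_gen_eq[OF i] p_def q_def s_def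
    by (simp add: distrib_right mult.assoc)
  also have "\<dots> = p * act id s (t (inv id \<circ> x) (inv s \<circ> y)) + q * act s s (t (inv s \<circ> x)
      (inv s \<circ> y))"
    by (simp only: sum.distrib basis_sum[OF id_Sym s(1)] basis_sum[OF s(1)
        s(1)] flip: sum_distrib_left)
  finally show ?thesis
    by (simp add: s(2) inv_id)
qed

text \<open>Only delta^d_v with v = \<open>word_perm ks\<close> occurs, and its coefficients form
  row v of C, twisted by v. A further factor T_i acts on this row as \<open>inverse_refl\<close>
  prescribes.\<close>

lemma T_word_eq:
  assumes C: "inverse_of_partition_fun n C" and ks: "set ks \<subseteq> {1..<n}"
  shows "foldr (\<lambda>i t. tw_mult n (T_gen n i) t) ks (basis id id) =
    (\<lambda>x v. if x \<in> Sym n \<and> v = word_perm ks then act id v (C v x) else 0)"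
  using ks
proof (induction ks)
  case Nil
  show ?case
  proof (intro ext)
    fix x v :: "nat \<Rightarrow> nat"
    show "foldr (\<lambda>i t. tw_mult n (T_gen n i) t) [] (basis id id) x v =
      (if x \<in> Sym n \<and> v = word_perm [] then act id v (C v x) else 0)"
      using inverse_id[OF C, of x] id_Sym[of n] by (auto simp: basis_def act_id)
  qed
next
  case (Cons i ks)
  define s y where "s = simple_refl i" and "y = word_perm ks"
  have i: "i \<in> {1..<n}" and ks: "set ks \<subseteq> {1..<n}"
    using Cons.prems by auto
  have y: "y \<in> Sym n"
    using ks by (intro word_of_Sym[of n ks]) (simp add: word_of_def y_def)
  have s: "s \<in> Sym n" "bij s" "s \<circ> s = id"
    using simple_refl_Sym[OF i] by (simp_all add: s_def)
  have bij_y: "bij y"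
    using y permutes_bij by auto
  have sy: "s \<circ> y \<in> Sym n"
    using s(1) y by (rule Sym_comp)
  let ?t = "\<lambda>x v. if x \<in> Sym n \<and> v = y then act id v (C v x) else 0"
  show ?case
  proof (intro ext)
    fix x v :: "nat \<Rightarrow> nat"
    let ?l = "lam i - lam (Suc i) :: nat lattice"
    have v: "s \<circ> v = y \<longleftrightarrow> v = s \<circ> y"
      unfolding s_def by (metis simple_refl_cancel)
    have "tw_mult n (T_gen n i) ?t x v = (if x \<in> Sym n \<and> v = s \<circ> y then act id v (C v x) else 0)"
    proof (cases "x \<in> Sym n \<and> v \<in> Sym n")
      case False
      then show ?thesis
        using sy by (auto simp: tw_mult_def)
    next
      case True
      then have x: "x \<in> Sym n" and "v \<in> Sym n"
        by auto
      have sx: "s \<circ> x \<in> Sym n"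
        using s(1) x by (rule Sym_comp)
      have 1: "tw_mult n (T_gen n i) ?t x v = act id s (Pfun (spec_root i) ?l) * act id s (?t x
          (s \<circ> v)) +
          act id s (Qfun (spec_root i) ?l) * act s s (?t (s \<circ> x) (s \<circ> v))"
        unfolding s_def by (rule tw_mult_T_gen[OF i x \<open>v \<in> Sym n\<close>])
      show ?thesis
      proof (cases "v = s \<circ> y")
        case False
        then show ?thesis
          unfolding 1 by (simp add: v act_0 s(2) bij_id)
      next
        case True
        \<comment> \<open>The twist by s y carries the dynamical root of y at i to \<lambda>(i+1) -
          \<lambda>(i). By root' below, this is also what delta^d_s makes of the argument in
          T_i.\<close>
        have root: "gen_map (act_gen id (s \<circ> y)) (dyn_root i y) = lam (Suc i) - lam i"
          unfolding dyn_root_def gen_map_diff gen_map_act_lam comp_apply Sym_inv_apply(2)[OF y]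
              s_def by simp
        have root': "gen_map (act_gen id s) ?l = lam (Suc i) - lam i"
          unfolding gen_map_diff gen_map_act_lam s_def by simp
        have sp: "gen_map (act_gen id f) (spec_root i) = spec_root i" for f
          unfolding gen_map_diff gen_map_act_var by simp
        have bij_sy: "bij (s \<circ> y)"
          using s(2) bij_y by (intro bij_comp)
        have l: "?l + hbar \<noteq> 0"
          by (rule lam_diff_hbar_ne)
        note PQ = act_PQ[OF bij_id s(2) spec_root_ne(1) l] act_PQ[OF bij_id bij_sy spec_root_ne(1)
            dyn_root_ne(2)[OF y]]
        have "act id (s \<circ> y) (C (s \<circ> y) x) =
            Pfun (spec_root i) (lam (Suc i) - lam i) * act id (s \<circ> y) (C y x) +
            Qfun (spec_root i) (lam (Suc i) - lam i) * act id (s \<circ> y) (act s id (C y (s \<circ> x)))"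
          using inverse_refl[OF C y x i]
          unfolding s_def [symmetric] by (simp only: act_add[OF bij_id bij_sy] act_mult[OF bij_id
              bij_sy] PQ root sp)
        also have "act id (s \<circ> y) (C y x) = act id s (act id y (C y x))"
          using act_comp[OF bij_id s(2) bij_id bij_y] by (simp only: comp_id)
        also have "act id (s \<circ> y) (act s id (C y (s \<circ> x))) = act s s (act id y (C y (s \<circ> x)))"
          using act_comp[OF s(2) s(2) bij_id bij_y] act_comp[OF bij_id bij_sy s(2) bij_id]
          by (simp only: comp_id id_comp)
        finally have 2: "act id (s \<circ> y) (C (s \<circ> y) x) =
            act id s (Pfun (spec_root i) ?l) * act id s (act id y (C y x)) +
            act id s (Qfun (spec_root i) ?l) * act s s (act id y (C y (s \<circ> x)))"
          unfolding PQ root' sp .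
        show ?thesis
          unfolding 1 using True v x sx 2 by simp
      qed
    qed
    then show "foldr (\<lambda>i t. tw_mult n (T_gen n i) t) (i # ks) (basis id id) x v =
      (if x \<in> Sym n \<and> v = word_perm (i # ks) then act id v (C v x) else 0)"
      by (simp only: foldr.simps comp_apply Cons.IH[OF ks] word_perm_Cons s_def y_def)
  qed
qed

text \<open>The factor delta^d(w^-1) removes the twist by w and leaves the plain entries of row w of
  C.\<close>

lemma dual_T_elem:
  assumes C: "inverse_of_partition_fun n C" and w: "w \<in> Sym n"
  shows "tw_mult n (basis id (inv w)) (T_elem n w) x v = (if x \<in> Sym n \<and> v = id then C w x else 0)"
proof -
  let ?ks = "SOME ks. word_of n ks w \<and> length ks = cox_length n w"
  have "word_of n ?ks w \<and> length ?ks = cox_length n w"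
    using exists_word[OF w] unfolding cox_length_eq[OF w] by (rule someI_ex)
  then have T: "T_elem n w = (\<lambda>x v. if x \<in> Sym n \<and> v = w then act id v (C v x) else 0)"
    unfolding T_elem_def using T_word_eq[OF C, of ?ks] by (simp add: word_of_def)
  have inv: "inv w \<in> Sym n" "inv (inv w) = w" "bij w" "bij (inv w)" "inv w \<circ> w = id"
    using w permutes_inv[of w "{1..n}"] permutes_inv_inv[of w "{1..n}"] permutes_bij[of w "{1..n}"]
      permutes_bij[of "inv w" "{1..n}"] permutes_inv_o(2)[of w "{1..n}"] by simp_all
  show ?thesis
  proof (cases "x \<in> Sym n \<and> v \<in> Sym n")
    case True
    have "w \<circ> v = w \<longleftrightarrow> v = id"
      by (metis comp_id comp_assoc id_comp inv(5))
    with True show ?thesis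
      unfolding tw_mult_def basis_sum[OF id_Sym inv(1)] inv(2) T
      by (auto simp: inv_id act_comp inv(3,4,5) bij_id act_id act_0)
  next
    case False
    then show ?thesis
      using id_Sym[of n] by (auto simp: tw_mult_def)
  qed
qed

text \<open>By \<open>dual_T_elem\<close> the expansion of delta_u reads b C = 1. The partition
  functions solve it by \<open>inverse_right\<close> and have the required Bruhat support. Any
  solution, multiplied from the right by the partition functions, agrees with them by
  \<open>inverse_left\<close>.\<close>

theorem b_coeff_eq:
  assumes "u \<in> Sym n" "w \<in> Sym n"
  shows "b_coeff n u w = partition_fun n u w"
proof -
  obtain C where C: "inverse_of_partition_fun n C"
    using exists_inverse by blast
  define b0 where "b0 u w = (if u \<in> Sym n \<and> w \<in> Sym n \<and> bruhat_le n w u then partition_fun n u w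
      else 0)" for u w
  have b0: "b0 u w = partition_fun n u w" if "u \<in> Sym n" "w \<in> Sym n" for u w
    using partition_fun_triangular[OF that(1)] that by (auto simp: b0_def)
  define spec where "spec b \<longleftrightarrow>
     (\<forall>u w. \<not> (u \<in> Sym n \<and> w \<in> Sym n \<and> bruhat_le n w u) \<longrightarrow> b u w = 0) \<and>
     (\<forall>u\<in>Sym n. basis u id =
        (\<lambda>w' v'. \<Sum>w\<in>{w \<in> Sym n. bruhat_le n w u}.
           tw_scale (b u w) (tw_mult n (basis id (inv w)) (T_elem n w)) w' v'))" for b
  have expand: "(\<Sum>w\<in>{w \<in> Sym n. bruhat_le n w u}.
      tw_scale (b u w) (tw_mult n (basis id (inv w)) (T_elem n w)) x v) =
      (if x \<in> Sym n \<and> v = id then \<Sum>w\<in>Sym n. b u w * C w x else 0)"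
    if supp: "\<And>u w. \<not> (u \<in> Sym n \<and> w \<in> Sym n \<and> bruhat_le n w u) \<Longrightarrow> b u w = 0"
        for b u x v
  proof -
    have "(\<Sum>w\<in>{w \<in> Sym n. bruhat_le n w u}.
        tw_scale (b u w) (tw_mult n (basis id (inv w)) (T_elem n w)) x v) =
        (\<Sum>w\<in>{w \<in> Sym n. bruhat_le n w u}. b u w * (if x \<in> Sym n \<and> v = id then C w x else 0))"
      by (intro sum.cong refl) (auto simp: tw_scale_def dual_T_elem[OF C])
    also have "\<dots> = (\<Sum>w\<in>Sym n. b u w * (if x \<in> Sym n \<and> v = id then C w x else 0))"
      using supp by (intro sum.mono_neutral_left) auto
    finally show ?thesis
      by auto
  qed
  have supp0: "b0 u w = 0" if "\<not> (u \<in> Sym n \<and> w \<in> Sym n \<and> bruhat_le n w u)" for u w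
    using that by (auto simp: b0_def)
  have "spec b0"
    unfolding spec_def
  proof (intro conjI allI impI ballI ext)
    fix u x v :: "nat \<Rightarrow> nat" assume u: "u \<in> Sym n"
    have "(\<Sum>w\<in>Sym n. b0 u w * C w x) = (if u = x then 1 else 0)" if "x \<in> Sym n"
    proof -
      have "(\<Sum>w\<in>Sym n. b0 u w * C w x) = (\<Sum>w\<in>Sym n. partition_fun n u w * C w x)"
        by (intro sum.cong refl) (simp only: b0[OF u])
      then show ?thesis
        by (simp only: inverse_right[OF C u that])
    qed
    then have "basis u id x v = (if x \<in> Sym n \<and> v = id then \<Sum>w\<in>Sym n. b0 u w * C w x else 0)"
      using u by (auto simp: basis_def)
    also have "\<dots> = (\<Sum>w\<in>{w \<in> Sym n. bruhat_le n w u}.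
        tw_scale (b0 u w) (tw_mult n (basis id (inv w)) (T_elem n w)) x v)"
      by (rule expand [symmetric]) (rule supp0)
    finally show "basis u id x v = (\<Sum>w\<in>{w \<in> Sym n. bruhat_le n w u}.
        tw_scale (b0 u w) (tw_mult n (basis id (inv w)) (T_elem n w)) x v)" .
  qed (fact supp0)
  moreover have "b = b0" if "spec b" for b
  proof (intro ext)
    fix u w
    have supp: "b u w = 0" if "\<not> (u \<in> Sym n \<and> w \<in> Sym n \<and> bruhat_le n w u)" for u w
      using \<open>spec b\<close> that unfolding spec_def by blast
    have b_spec: "\<forall>u\<in>Sym n. basis u id = (\<lambda>w' v'. \<Sum>w\<in>{w \<in> Sym n. bruhat_le n w u}.
           tw_scale (b u w) (tw_mult n (basis id (inv w)) (T_elem n w)) w' v')"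
      using \<open>spec b\<close> unfolding spec_def by (rule conjunct2)
    show "b u w = b0 u w"
    proof (cases "u \<in> Sym n \<and> w \<in> Sym n")
      case True
      then have u: "u \<in> Sym n" and w: "w \<in> Sym n"
        by auto
      have bC: "(\<Sum>w\<in>Sym n. b u w * C w x) = (if u = x then 1 else 0)" if x: "x \<in> Sym n" for x
      proof -
        have "basis u id x id = (\<Sum>w\<in>{w \<in> Sym n. bruhat_le n w u}.
           tw_scale (b u w) (tw_mult n (basis id (inv w)) (T_elem n w)) x id)"
          by (subst b_spec[rule_format, OF u]) (rule refl)
        also have "\<dots> = (if x \<in> Sym n \<and> id = (id :: nat \<Rightarrow> nat)
            then \<Sum>w\<in>Sym n. b u w * C w x else 0)"
          by (rule expand) (rule supp)
        also have "\<dots> = (\<Sum>w\<in>Sym n. b u w * C w x)"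
          using x by (simp only: refl if_True simp_thms)
        finally show ?thesis
          by (auto simp: basis_def)
      qed
      have "b u w = (\<Sum>y\<in>Sym n. b u y * (if y = w then 1 else 0))"
        using w by (simp add: if_distrib cong: if_cong)
      also have "\<dots> = (\<Sum>y\<in>Sym n. b u y * (\<Sum>x\<in>Sym n. C y x * partition_fun n x w))"
        by (intro sum.cong refl) (simp only: inverse_left[OF C _ w])
      also have "\<dots> = (\<Sum>x\<in>Sym n. (\<Sum>y\<in>Sym n. b u y * C y x) * partition_fun n x w)"
        by (simp only: sum_distrib_left sum_distrib_right mult.assoc) (rule sum.swap)
      also have "\<dots> = (\<Sum>x\<in>Sym n. if x = u then partition_fun n u w else 0)"
      proof (intro sum.cong refl)
        fix x assume "x \<in> Sym n"
        then show "(\<Sum>y\<in>Sym n. b u y * C y x) * partition_fun n x w =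
            (if x = u then partition_fun n u w else 0)"
          by (subst bC) auto
      qed
      also have "\<dots> = b0 u w"
        using u b0[OF u w] by (simp only: sum.delta finite_Sym if_True)
      finally show ?thesis .
    next
      case False
      then show ?thesis
        using supp by (auto simp: b0_def)
    qed
  qed
  ultimately have "(THE b. spec b) = b0"
    by (rule the_equality)
  then show ?thesis
    using b0[OF assms] by (simp add: b_coeff_def spec_def)
qed

section \<open>State sums over sets of crossings and the order of the empty strands\<close>

section \<open>Expanding the partition function\<close>

definition site :: "nat \<times> nat \<Rightarrow> nat" where
  "site t = fst t + snd t - 1"

text \<open>Polymorphic in the variables, because the same weight occurs before localization with
  y_j - x_i and after it with z_j - z_u(i).\<close>

definition vertex :: "nat \<Rightarrow> bool \<Rightarrow> nat \<Rightarrow> nat \<Rightarrow>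
    ('v::countable) lattice \<Rightarrow> 'v frac" where
  "vertex n cross a b z = (if cross then Qfun else Pfun) (colour n a - colour n b) z"

text \<open>\<open>S\<close> is the set of those tiles in which the two paths cross.\<close>

primrec run :: "(nat \<times> nat) set \<Rightarrow> (nat \<times> nat) list \<Rightarrow>
    (nat \<Rightarrow> nat) \<Rightarrow> nat \<Rightarrow> nat" where
  "run S [] \<sigma> = \<sigma>"
| "run S (t # ts) \<sigma> = run S ts (if t \<in> S then \<sigma> \<circ> simple_refl (site t) else \<sigma>)"

primrec run_weight ::
    "nat \<Rightarrow> (nat \<times> nat) set \<Rightarrow> (nat \<times> nat) list \<Rightarrow>
        (nat \<Rightarrow> nat) \<Rightarrow> (nat \<Rightarrow> nat) \<Rightarrow> nat frac" where
  "run_weight n S [] \<zeta> \<sigma> = 1"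
| "run_weight n S (t # ts) \<zeta> \<sigma> =
     vertex n (t \<in> S) (\<sigma> (site t)) (\<sigma> (Suc (site t))) (var (\<zeta> (Suc (site t))) - var (\<zeta> (site t))) *
     run_weight n S ts (\<zeta> \<circ> simple_refl (site t)) (if t \<in> S then \<sigma> \<circ> simple_refl (site t) else \<sigma>)"

lemma run_append: "run S (ts @ ts') \<sigma> = run S ts' (run S ts \<sigma>)"
  by (induction ts arbitrary: \<sigma>) simp_all

lemma run_weight_append:
  "run_weight n S (ts @ ts') \<zeta> \<sigma> = run_weight n S ts \<zeta> \<sigma> * run_weight n S ts' (run UNIV ts \<zeta>)
      (run S ts \<sigma>)"
  by (induction ts arbitrary: \<zeta> \<sigma>) (simp_all add: mult.assoc)

lemma inj_run: "inj \<sigma> \<Longrightarrow> inj (run S ts \<sigma>)"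
  by (induction ts arbitrary: \<sigma>) (simp_all add: inj_comp_transpose)

lemma run_cong: "(\<And>t. t \<in> set ts \<Longrightarrow> t \<in> S \<longleftrightarrow> t \<in> S') \<Longrightarrow>
    run S ts = run S' ts"
  by (induction ts) (auto simp: fun_eq_iff)

lemma run_weight_cong:
  "(\<And>t. t \<in> set ts \<Longrightarrow> t \<in> S \<longleftrightarrow> t \<in> S') \<Longrightarrow> run_weight n S ts =
      run_weight n S' ts"
  by (induction ts) (auto simp: fun_eq_iff)

lemma sum_Pow_insert:
  assumes "finite A" "t \<notin> A"
  shows "(\<Sum>S\<in>Pow (insert t A). f S) = (\<Sum>S\<in>Pow A. f S) + (\<Sum>S\<in>Pow A. f (insert t S))"
proof -
  have "inj_on (insert t) (Pow A)"
    using assms(2) by (auto simp: inj_on_def dest: insert_ident[THEN iffD1, rotated 2])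
  then have "(\<Sum>S\<in>insert t ` Pow A. f S) = (\<Sum>S\<in>Pow A. f (insert t S))"
    by (simp add: sum.reindex)
  moreover have "Pow A \<inter> insert t ` Pow A = {}"
    using assms(2) by auto
  ultimately show ?thesis
    using assms(1) by (simp add: Pow_insert sum.union_disjoint)
qed

text \<open>At each tile the colours bounce or cross, and distinctness of the tiles makes the
  choices a subset S. The spectral parameters change places in either case, hence
  \<open>run UNIV\<close> for them.\<close>

lemma crossings_expand:
  assumes "distinct ts"
  shows "crossings (colour n) (map site ts) \<Psi> \<zeta> \<sigma> =
    (\<Sum>S\<in>Pow (set ts). run_weight n S ts \<zeta> \<sigma> * \<Psi> (run UNIV ts \<zeta>) (run S ts \<sigma>))"
  using assms
proof (induction ts arbitrary: \<zeta> \<sigma>)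
  case (Cons t ts)
  let ?s = "simple_refl (site t)" and ?z = "var (\<zeta> (Suc (site t))) - var (\<zeta> (site t))
      :: nat lattice"
  let ?v = "\<lambda>b. vertex n b (\<sigma> (site t)) (\<sigma> (Suc (site t))) ?z"
  have t: "t \<notin> set ts"
    using Cons.prems by simp
  have 1: "run_weight n S (t # ts) \<zeta> \<sigma> = ?v False * run_weight n S ts (\<zeta> \<circ> ?s) \<sigma>"
    "run S (t # ts) \<sigma> = run S ts \<sigma>"
    "run_weight n (insert t S) (t # ts) \<zeta> \<sigma> = ?v True * run_weight n S ts (\<zeta> \<circ> ?s) (\<sigma> \<circ> ?s)"
    "run (insert t S) (t # ts) \<sigma> = run S ts (\<sigma> \<circ> ?s)" if "S \<in> Pow (set ts)" for S
  proof -
    have "t \<notin> S"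
      using that t by auto
    moreover have "run (insert t S) ts = run S ts" "run_weight n (insert t S) ts =
        run_weight n S ts"
      using t by (intro run_cong run_weight_cong; auto)+
    ultimately show "run_weight n S (t # ts) \<zeta> \<sigma> = ?v False * run_weight n S ts (\<zeta> \<circ> ?s) \<sigma>"
      "run S (t # ts) \<sigma> = run S ts \<sigma>"
      "run_weight n (insert t S) (t # ts) \<zeta> \<sigma> = ?v True * run_weight n S ts (\<zeta> \<circ> ?s) (\<sigma> \<circ> ?s)"
      "run (insert t S) (t # ts) \<sigma> = run S ts (\<sigma> \<circ> ?s)"
      by simp_all
  qed
  have "crossings (colour n) (map site (t # ts)) \<Psi> \<zeta> \<sigma> =
      ?v False * crossings (colour n) (map site ts) \<Psi> (\<zeta> \<circ> ?s) \<sigma> +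
      ?v True * crossings (colour n) (map site ts) \<Psi> (\<zeta> \<circ> ?s) (\<sigma> \<circ> ?s)"
    by (simp add: crossing_def Let_def vertex_def)
  also have "\<dots> = (\<Sum>S\<in>Pow (set ts). run_weight n S (t # ts) \<zeta> \<sigma> *
        \<Psi> (run UNIV (t # ts) \<zeta>) (run S (t # ts) \<sigma>)) +
      (\<Sum>S\<in>Pow (set ts). run_weight n (insert t S) (t # ts) \<zeta> \<sigma> *
        \<Psi> (run UNIV (t # ts) \<zeta>) (run (insert t S) (t # ts) \<sigma>))"
  proof -
    have z: "run UNIV (t # ts) \<zeta> = run UNIV ts (\<zeta> \<circ> ?s)"
      by simp
    have ih: "crossings (colour n) (map site ts) \<Psi> \<zeta> \<sigma> =
        (\<Sum>S\<in>Pow (set ts). run_weight n S ts \<zeta> \<sigma> * \<Psi> (run UNIV ts \<zeta>) (run S ts \<sigma>))" for \<zeta> \<sigma>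
      using Cons by simp
    show ?thesis
      unfolding ih sum_distrib_left z
      by (intro arg_cong2[of _ _ _ _ "(+)"] sum.cong refl) (simp_all only: 1 mult.assoc)
  qed
  also have "\<dots> = (\<Sum>S\<in>Pow (set (t # ts)). run_weight n S (t # ts) \<zeta> \<sigma> *
        \<Psi> (run UNIV (t # ts) \<zeta>) (run S (t # ts) \<sigma>))"
    unfolding list.set(2) by (rule sum_Pow_insert[OF finite_set t, symmetric])
  finally show ?case .
qed simp

text \<open>
  The colours on the edges of the grid: \<open>hor\<close> leaves the tile \<open>(i, j)\<close> of a row on the right, if \<open>a\<close>
  enters the row on the left and \<open>\<beta>\<close> enters it from below, and \<open>top_edge\<close> leaves it at the top.
\<close>

primrec hor :: "(nat \<times> nat) set \<Rightarrow> nat \<Rightarrow> nat \<Rightarrow>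
    (nat \<Rightarrow> nat) \<Rightarrow> nat \<Rightarrow> nat" where
  "hor S i a \<beta> 0 = a"
| "hor S i a \<beta> (Suc j) = (if (i, Suc j) \<in> S then hor S i a \<beta> j else \<beta> (Suc j))"

definition top_edge :: "(nat \<times> nat) set \<Rightarrow> nat \<Rightarrow> nat \<Rightarrow>
    (nat \<Rightarrow> nat) \<Rightarrow> nat \<Rightarrow> nat" where
  "top_edge S i a \<beta> j = (if (i, j) \<in> S then \<beta> j else hor S i a \<beta> (j - 1))"

definition row :: "nat \<Rightarrow> nat \<Rightarrow> (nat \<times> nat) list" where
  "row i j = map (Pair i) [1..<Suc j]"

lemma row_0 [simp]: "row i 0 = []"
  and row_Suc: "row i (Suc j) = row i j @ [(i, Suc j)]"
  by (simp_all add: row_def)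

lemma run_row:
  "run S (row i j) \<sigma> k = (if k < i \<or> i + j < k then \<sigma> k
     else if k < i + j then top_edge S i (\<sigma> i) (\<lambda>j. \<sigma> (i + j)) (Suc (k - i))
     else hor S i (\<sigma> i) (\<lambda>j. \<sigma> (i + j)) j)"
proof (induction j arbitrary: k)
  case (Suc j)
  have site: "site (i, Suc j) = i + j"
    by (simp add: site_def)
  have at: "run S (row i j) \<sigma> (i + j) = hor S i (\<sigma> i) (\<lambda>j. \<sigma> (i + j)) j"
    "run S (row i j) \<sigma> (Suc (i + j)) = \<sigma> (i + Suc j)"
    by (simp_all add: Suc)
  consider "k < i + j" | "k = i + j" | "k = Suc (i + j)" | "Suc (i + j) < k"
    by linarith
  then show ?case
  proof cases
    case 1
    then show ?thesis
      by (simp add: row_Suc run_append site Suc)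
  next
    case 2
    then show ?thesis
      by (simp add: row_Suc run_append site at top_edge_def)
  next
    case 3
    then show ?thesis
      by (simp add: row_Suc run_append site at)
  next
    case 4
    then show ?thesis
      by (simp add: row_Suc run_append site Suc)
  qed
qed auto

lemma hor_UNIV [simp]: "hor UNIV i a \<beta> j = a"
  by (induction j) simp_all

lemma top_edge_UNIV [simp]: "top_edge UNIV i a \<beta> j = \<beta> j"
  by (simp add: top_edge_def)

lemma run_weight_row:
  "run_weight n S (row i j) \<zeta> \<sigma> =
    (\<Prod>j=1..j. vertex n ((i, j) \<in> S) (hor S i (\<sigma> i) (\<lambda>j. \<sigma> (i + j)) (j - 1)) (\<sigma> (i + j))
      (var (\<zeta> (i + j)) - var (\<zeta> i)))"
proof (induction j)
  case (Suc j)
  have site: "site (i, Suc j) = i + j"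
    by (simp add: site_def)
  show ?case
    by (simp add: row_Suc run_weight_append Suc site run_row mult.commute)
qed simp

primrec bottoms :: "(nat \<times> nat) set \<Rightarrow> nat \<Rightarrow> (nat \<Rightarrow> nat)
    \<Rightarrow> nat \<Rightarrow> nat \<Rightarrow> nat" where
  "bottoms S n \<sigma> 0 = (\<lambda>j. \<sigma> (n + j))"
| "bottoms S n \<sigma> (Suc m) = top_edge S (n - m) (\<sigma> (n - m)) (bottoms S n \<sigma> m)"

primrec grid_rows :: "nat \<Rightarrow> nat \<Rightarrow> (nat \<times> nat) list" where
  "grid_rows n 0 = []"
| "grid_rows n (Suc m) = grid_rows n m @ row (n - m) n"

lemma map_site_rows: "m \<le> n \<Longrightarrow> map site (grid_rows n m) = grid_word n 0 m"
proof (induction m)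
  case (Suc m)
  have "map site (row i j) = [i..<i + j]" for i j
    by (induction j) (simp_all add: row_Suc site_def)
  with Suc show ?case
    by (simp del: upt_Suc)
qed simp

lemma set_rows: "m \<le> n \<Longrightarrow> set (grid_rows n m) = {n - m<..n} \<times> {1..n}"
proof (induction m)
  case (Suc m)
  have "{n - Suc m<..n} = insert (n - m) {n - m<..n}"
    using Suc.prems by auto
  with Suc show ?case
    by (auto simp: row_def)
qed simp

lemma distinct_rows: "m \<le> n \<Longrightarrow> distinct (grid_rows n m)"
proof (induction m)
  case (Suc m)
  then have "distinct (grid_rows n m)" "set (grid_rows n m) = {n - m<..n} \<times> {1..n}"
    using set_rows by auto
  moreover have "distinct (row (n - m) n)" "set (row (n - m) n) = {n - m} \<times> {1..n}"
    by (auto simp: row_def distinct_map inj_on_def)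
  ultimately show ?case
    by auto
qed simp

lemma hor_cong: "(\<And>j'. 1 \<le> j' \<Longrightarrow> j' \<le> j \<Longrightarrow> \<beta> j' = \<beta>' j')
    \<Longrightarrow> hor S i a \<beta> j = hor S i a \<beta>' j"
  by (induction j) auto

text \<open>After m rows, counted from the bottom, the sites hold three kinds of edges: left ends of
  the rows still to come, then the columns, then right ends of the finished rows.\<close>

lemma run_rows:
  assumes "m \<le> n"
  shows "k \<le> n - m \<Longrightarrow> run S (grid_rows n m) \<sigma> k = \<sigma> k"
    and "j \<in> {1..n} \<Longrightarrow> run S (grid_rows n m) \<sigma> (n - m + j) = bottoms S n \<sigma> m j"
    and "i \<in> {n - m<..n} \<Longrightarrow> run S (grid_rows n m) \<sigma> (n + i) = hor S i (\<sigma> i)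
        (bottoms S n \<sigma> (n - i)) n"
  using assms
proof (induction m arbitrary: i j k)
  case (Suc m)
  {
    case (1 k)
    then have "k < n - m"
      by auto
    with 1 show ?case
      using Suc.IH(1)[of k] by (simp add: run_append run_row)
  next
    case (2 j)
    let ?\<sigma> = "run S (grid_rows n m) \<sigma>" and ?i = "n - m"
    have i: "?\<sigma> ?i = \<sigma> ?i"
      using 2 by (intro Suc.IH) auto
    have b: "?\<sigma> (?i + j') = bottoms S n \<sigma> m j'" if "1 \<le> j'" "j' \<le> n" for j'
      using 2 that by (intro Suc.IH) auto
    have h: "hor S ?i (\<sigma> ?i) (\<lambda>j. ?\<sigma> (?i + j)) (j - 1) = hor S ?i (\<sigma> ?i) (bottoms S n \<sigma> m) (j - 1)"
      using b 2 by (intro hor_cong) auto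
    have k: "n - Suc m + j < ?i + n" "\<not> n - Suc m + j < ?i" "Suc (n - Suc m + j - ?i) = j"
      using 2 by auto
    have "run S (grid_rows n (Suc m)) \<sigma> (n - Suc m + j) = top_edge S ?i (\<sigma> ?i) (\<lambda>j. ?\<sigma> (?i + j)) j"
      using k by (simp add: run_append run_row i)
    also have "\<dots> = bottoms S n \<sigma> (Suc m) j"
    proof -
      have "?\<sigma> (?i + j) = bottoms S n \<sigma> m j"
        using 2 by (intro b) auto
      then show ?thesis
        by (simp only: top_edge_def h bottoms.simps)
    qed
    finally show ?case .
  next
    case (3 i)
    let ?\<sigma> = "run S (grid_rows n m) \<sigma>" and ?i = "n - m"
    show ?case
    proof (cases "i = ?i")
      case True
      have i: "?\<sigma> ?i = \<sigma> ?i"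
        using 3 by (intro Suc.IH) auto
      have b: "?\<sigma> (?i + j') = bottoms S n \<sigma> m j'" if "1 \<le> j'" "j' \<le> n" for j'
        using 3 that by (intro Suc.IH) auto
      have "hor S ?i (\<sigma> ?i) (\<lambda>j. ?\<sigma> (?i + j)) n = hor S ?i (\<sigma> ?i) (bottoms S n \<sigma> m) n"
        using b by (intro hor_cong) auto
      moreover have "run S (row ?i n) ?\<sigma> (?i + n) = hor S ?i (?\<sigma> ?i) (\<lambda>j. ?\<sigma> (?i + j)) n"
        by (simp add: run_row)
      moreover have "n - ?i = m" "n + ?i = ?i + n"
        using 3 by auto
      ultimately show ?thesis
        unfolding True by (simp only: grid_rows.simps run_append i)
    next
      case False
      then have "i \<in> {n - m<..n}"
        using 3 by auto
      then have "?\<sigma> (n + i) = hor S i (\<sigma> i) (bottoms S n \<sigma> (n - i)) n"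
        using 3 by (intro Suc.IH) auto
      then show ?thesis
        using False \<open>i \<in> {n - m<..n}\<close> by (simp add: run_append run_row)
    qed
  }
qed auto

lemma bot_UNIV: "bottoms UNIV n \<sigma> m j = \<sigma> (n + j)"
  by (induction m) simp_all

lemma run_weight_rows:
  assumes "m \<le> n"
  shows "run_weight n S (grid_rows n m) \<zeta> \<sigma> =
    (\<Prod>i\<in>{n - m<..n}. \<Prod>j=1..n. vertex n ((i, j) \<in> S) (hor S i (\<sigma> i) (bottoms S n \<sigma>
        (n - i)) (j - 1))
      (bottoms S n \<sigma> (n - i) j) (var (\<zeta> (n + j)) - var (\<zeta> i)))"
  using assms
proof (induction m)
  case (Suc m)
  let ?\<sigma> = "run S (grid_rows n m) \<sigma>" and ?\<zeta> = "run UNIV (grid_rows n m) \<zeta>" and ?i = "n - m"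
  have m: "m \<le> n"
    using Suc.prems by simp
  have *: "?\<sigma> ?i = \<sigma> ?i" "?\<zeta> ?i = \<zeta> ?i"
    using run_rows(1)[OF m] by simp_all
  have b: "?\<sigma> (?i + j') = bottoms S n \<sigma> m j'" "?\<zeta> (?i + j') = \<zeta> (n + j')" if "1 \<le> j'" "j' \<le> n"
      for j'
    using run_rows(2)[OF m] that by (simp_all add: bot_UNIV)
  have h: "hor S ?i (\<sigma> ?i) (\<lambda>j. ?\<sigma> (?i + j)) (j - 1) = hor S ?i (\<sigma> ?i) (bottoms S n \<sigma> m) (j - 1)"
    if "j \<le> n" for j
    using b that by (intro hor_cong) auto
  have "{n - Suc m<..n} = insert ?i {n - m<..n}" "n - ?i = m"
    using Suc.prems by auto
  moreover have "run_weight n S (row ?i n) ?\<zeta> ?\<sigma> =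
    (\<Prod>j=1..n. vertex n ((?i, j) \<in> S) (hor S ?i (\<sigma> ?i) (bottoms S n \<sigma> m) (j - 1))
      (bottoms S n \<sigma> m j) (var (\<zeta> (n + j)) - var (\<zeta> ?i)))"
    unfolding run_weight_row
  proof (intro prod.cong refl)
    fix j assume "j \<in> {1..n}"
    then have j: "1 \<le> j" "j \<le> n"
      by auto
    show "vertex n ((?i, j) \<in> S) (hor S ?i (?\<sigma> ?i) (\<lambda>j. ?\<sigma> (?i + j)) (j - 1)) (?\<sigma> (?i + j))
        (var (?\<zeta> (?i + j)) - var (?\<zeta> ?i)) =
      vertex n ((?i, j) \<in> S) (hor S ?i (\<sigma> ?i) (bottoms S n \<sigma> m) (j - 1))
        (bottoms S n \<sigma> m j) (var (\<zeta> (n + j)) - var (\<zeta> ?i))"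
      by (simp only: * h[OF j(2)] b(1)[OF j] b(2)[OF j])
  qed
  ultimately show ?case
    using Suc.IH[OF m] by (simp add: run_weight_append mult.commute)
qed simp

definition left_edge :: "nat \<Rightarrow> (nat \<times> nat) set \<Rightarrow> nat \<Rightarrow> nat
    \<Rightarrow> nat" where
  "left_edge n S i j = hor S i i (bottoms S n id (n - i)) (j - 1)"

definition bottom_edge :: "nat \<Rightarrow> (nat \<times> nat)
    set \<Rightarrow> nat \<Rightarrow> nat \<Rightarrow> nat" where
  "bottom_edge n S i j = bottoms S n id (n - i) j"

text \<open>For \<open>i = 0\<close> the bottom edges are the edges at the top of the grid.\<close>

lemma left_edge_1 [simp]: "left_edge n S i (Suc 0) = i"
  by (simp add: left_edge_def)

lemma left_edge_Suc:
  "1 \<le> j \<Longrightarrow> left_edge n S i (Suc j) = (if (i, j)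
      \<in> S then left_edge n S i j else bottom_edge n S i j)"
  by (cases j) (simp_all add: left_edge_def bottom_edge_def)

lemma bottom_edge_n [simp]: "bottom_edge n S n j = n + j"
  by (simp add: bottom_edge_def)

lemma bottom_edge_step:
  assumes "i < n"
  shows "bottom_edge n S i j =
    (if (Suc i, j) \<in> S then bottom_edge n S (Suc i) j else left_edge n S (Suc i) j)"
proof -
  have "n - i = Suc (n - Suc i)" "n - (n - Suc i) = Suc i"
    using assms by auto
  then show ?thesis
    by (simp add: left_edge_def bottom_edge_def top_edge_def)
qed

text \<open>Just before the tile (i, j) is traversed, its left and bottom edges are the values of an
  injective state at two neighbouring sites.\<close>

lemma left_edge_ne_bottom_edge:
  assumes "i \<in> {1..n}" "j \<in> {1..n}"
  shows "left_edge n S i j \<noteq> bottom_edge n S i j"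
proof -
  let ?\<sigma> = "run S (grid_rows n (n - i)) id"
  let ?\<sigma>' = "run S (row i (j - 1)) ?\<sigma>"
  have i: "?\<sigma> i = i"
    using run_rows(1)[of "n - i" n i S id] assms by simp
  have b: "?\<sigma> (i + j') = bottoms S n id (n - i) j'" if "1 \<le> j'" "j' \<le> n" for j'
    using run_rows(2)[of "n - i" n j' S id] assms that by (simp add: add.commute)
  have "?\<sigma>' (i + j - 1) = hor S i i (\<lambda>j. ?\<sigma> (i + j)) (j - 1)"
    using assms by (auto simp: run_row i)
  also have "\<dots> = left_edge n S i j"
    unfolding left_edge_def using b assms by (intro hor_cong) auto
  finally have "?\<sigma>' (i + j - 1) = left_edge n S i j" .
  moreover have "?\<sigma>' (i + j) = bottom_edge n S i j"
    using assms b[of j] by (simp add: run_row bottom_edge_def)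
  moreover have "inj ?\<sigma>'"
    by (intro inj_run) simp
  ultimately show ?thesis
    using assms by (metis inj_eq add_diff_inverse_nat add_is_0 atLeastAtMost_iff diff_diff_cancel
        n_not_Suc_n not_one_le_zero plus_1_eq_Suc less_one trans_le_add2)
qed

text \<open>States are injective, so no colour leaves both at the top and on the right.\<close>

lemma right_exit:
  assumes i: "i \<in> {1..n}" and all: "\<And>p. p \<in> {1..n} \<Longrightarrow>
      \<exists>j\<in>{1..n}. bottom_edge n S 0 j = p"
  shows "n < left_edge n S i (Suc n)"
proof (rule ccontr)
  let ?\<sigma> = "run S (grid_rows n n) id"
  assume "\<not> ?thesis"
  moreover have "?\<sigma> (n + i) = left_edge n S i (Suc n)"
    using run_rows(3)[of n n i S id] i by (simp add: left_edge_def)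
  moreover have "?\<sigma> 0 = 0"
    using run_rows(1)[of n n 0 S id] by simp
  moreover have inj: "inj ?\<sigma>"
    by (intro inj_run) simp
  moreover have "?\<sigma> (n + i) \<noteq> ?\<sigma> 0"
    using i inj_eq[OF inj, of "n + i" 0] by simp
  ultimately have "?\<sigma> (n + i) \<le> n" "?\<sigma> (n + i) \<noteq> 0"
    by simp_all
  then obtain j where j: "j \<in> {1..n}" "bottom_edge n S 0 j = ?\<sigma> (n + i)"
    using all[of "?\<sigma> (n + i)"] by auto
  moreover have "?\<sigma> j = bottom_edge n S 0 j"
    using run_rows(2)[of n n j S id] j(1) by (simp add: bottom_edge_def)
  ultimately have "j = n + i"
    using inj by (metis injD)
  with i j(1) show False by auto
qed

definition grid :: "nat \<Rightarrow> (nat \<times> nat) set" where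
  "grid n = {1..n} \<times> {1..n}"

definition connects :: "nat \<Rightarrow> (nat \<Rightarrow> nat) \<Rightarrow> (nat \<times> nat)
    set \<Rightarrow> bool" where
  "connects n w S \<longleftrightarrow> (\<forall>i\<in>{1..n}. bottom_edge n S 0 (w i) = i)"

lemma partition_fun_expand:
  assumes "w \<in> Sym n"
  shows "partition_fun n u w = (\<Sum>S\<in>Pow (grid n). if connects n w S then
    (\<Prod>i=1..n. \<Prod>j=1..n. vertex n ((i, j) \<in> S) (left_edge n S i j) (bottom_edge n S i j)
        (var j - var (u i)))
    else 0)"
proof -
  have set: "set (grid_rows n n) = grid n"
    unfolding grid_def by (subst set_rows) auto
  have top: "top_amplitude n w \<zeta> (run S (grid_rows n n) id) = (if connects n w S then 1 else 0)"
      for \<zeta> S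
  proof -
    have "run S (grid_rows n n) id (w i) = bottom_edge n S 0 (w i)" if "i \<in> {1..n}" for i
      using run_rows(2)[of n n "w i" S id] assms that permutes_in_image[of w "{1..n}" i]
      by (simp add: bottom_edge_def)
    then show ?thesis
      by (simp add: top_amplitude_def connects_def)
  qed
  have weight: "run_weight n S (grid_rows n n) (spectral n u) id =
    (\<Prod>i=1..n. \<Prod>j=1..n. vertex n ((i, j) \<in> S) (left_edge n S i j) (bottom_edge n S i j)
        (var j - var (u i)))" for S
    unfolding run_weight_rows[OF order_refl]
    by (intro prod.cong) (auto simp: left_edge_def bottom_edge_def spectral_def)
  have "partition_fun n u w = crossings (colour n) (map site (grid_rows n n)) (top_amplitude n w)
      (spectral n u) id"
    by (simp add: partition_fun_def map_site_rows)
  also have "\<dots> = (\<Sum>S\<in>Pow (grid n). run_weight n S (grid_rows n n) (spectral n u) id *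
      (if connects n w S then 1 else 0))"
    by (simp only: crossings_expand[OF distinct_rows[OF order_refl]] set top)
  finally show ?thesis
    by (simp add: weight if_distrib cong: if_cong)
qed

section \<open>The order of the empty strands\<close>

primrec empties :: "nat \<Rightarrow> (nat \<Rightarrow> nat) \<Rightarrow> nat \<Rightarrow> nat"
    where
  "empties n f 0 = 0"
| "empties n f (Suc j) = empties n f j + (if n < f (Suc j) then 1 else 0)"

text \<open>The label of an empty strand is then determined by its position alone; this is what lets
  a count made along a walk recover the colour.\<close>

definition ordered :: "nat \<Rightarrow> (nat \<Rightarrow> nat) \<Rightarrow> bool" where
  "ordered n f \<longleftrightarrow> (\<forall>j\<in>{1..n}. n < f j \<longrightarrow> f j = Suc (n + empties n f (j - 1)))"

definition no_empty_crossing :: "nat \<Rightarrow> (nat \<times> nat) set \<Rightarrow> bool" where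
  "no_empty_crossing n S \<longleftrightarrow> (\<forall>i\<in>{1..n}. \<forall>j\<in>{1..n}.
     \<not> ((i, j) \<in> S \<and> n < left_edge n S i j \<and> n < bottom_edge n S i j))"

text \<open>The crossings excluded here are those of weight \<open>Q(-\<hbar>, z) = 0\<close>.\<close>

definition nonvanishing :: "nat \<Rightarrow> (nat \<times> nat) set \<Rightarrow> bool" where
  "nonvanishing n S \<longleftrightarrow> (\<forall>i\<in>{1..n}. \<forall>j\<in>{1..n}.
     \<not> ((i, j) \<in> S \<and> n < left_edge n S i j \<and> bottom_edge n S i j = Suc (left_edge n S i j)))"

lemma bottom_edge_pred:
  assumes "i \<in> {1..n}"
  shows "bottom_edge n S (i - 1) j = (if (i, j) \<in> S then bottom_edge n S i j else left_edge n S i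
      j)"
  using bottom_edge_step[of "i - 1" n S j] assms by auto

text \<open>A scan of row i from the left. If the labels of the empty strands increase along the
  bottom edges, an empty strand carried along the row has the label just below that of the next one
  coming from below. Where the two meet, a crossing is excluded by \<open>nonvanishing\<close>; so
  they bounce, and the order passes on to the top edges.\<close>

lemma row_order:
  assumes i: "i \<in> {1..n}" and ord: "ordered n (bottom_edge n S i)" and nv: "nonvanishing n S" and
      "j \<le> n"
  defines "T \<equiv> bottom_edge n S (i - 1)"
  shows "empties n (bottom_edge n S i) j = empties n T j + (if n < left_edge n S i (Suc j)
      then 1 else 0)
    \<and> (n < left_edge n S i (Suc j) \<longrightarrow> left_edge n S i (Suc j) = Suc (n + empties n T j))
    \<and> (\<forall>j'\<in>{1..j}. n < T j' \<longrightarrow> T j' = Suc (n + empties n T (j' - 1)))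
    \<and> (\<forall>j'\<in>{1..j}. \<not> ((i, j') \<in> S \<and> n < left_edge n S i j' \<and> n < bottom_edge n S i j'))"
  using \<open>j \<le> n\<close>
proof (induction j)
  case 0
  then show ?case
    using i by simp
next
  case (Suc j)
  let ?l = "left_edge n S i (Suc j)" and ?b = "bottom_edge n S i (Suc j)"
  have T: "T (Suc j) = (if (i, Suc j) \<in> S then ?b else ?l)"
    unfolding T_def by (rule bottom_edge_pred[OF i])
  have r: "left_edge n S i (Suc (Suc j)) = (if (i, Suc j) \<in> S then ?l else ?b)"
    by (rule left_edge_Suc) simp
  have b: "n < ?b \<Longrightarrow> ?b = Suc (n + empties n (bottom_edge n S i) j)"
    using ord Suc.prems by (auto simp: ordered_def)
  have v: "\<not> ((i, Suc j) \<in> S \<and> n < ?l \<and> ?b = Suc ?l)"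
    using nv i Suc.prems by (auto simp: nonvanishing_def)
  have IH: "empties n (bottom_edge n S i) j = empties n T j + (if n < ?l then 1 else 0)"
    "n < ?l \<Longrightarrow> ?l = Suc (n + empties n T j)"
    "\<And>j'. j' \<in> {1..j} \<Longrightarrow> n < T j' \<Longrightarrow> T j' = Suc (n +
        empties n T (j' - 1))"
    "\<And>j'. j' \<in> {1..j} \<Longrightarrow> \<not> ((i, j') \<in> S \<and> n < left_edge n S i j' \<and>
        n < bottom_edge n S i j')"
    using Suc by auto
  have nc: "\<not> ((i, Suc j) \<in> S \<and> n < ?l \<and> n < ?b)"
    using IH(1,2) b v by auto
  have split: "(\<forall>j'\<in>{1..Suc j}. P j') \<longleftrightarrow> (\<forall>j'\<in>{1..j}. P j') \<and> P (Suc j)" for P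
  proof -
    have "{1..Suc j} = insert (Suc j) {1..j}"
      by auto
    then show ?thesis
      by auto
  qed
  have "empties n (bottom_edge n S i) (Suc j) =
      empties n T (Suc j) + (if n < left_edge n S i (Suc (Suc j)) then 1 else 0)"
    using IH(1) nc by (auto simp: T r)
  moreover have "n < left_edge n S i (Suc (Suc j)) \<longrightarrow> left_edge n S i (Suc (Suc j)) = Suc (n +
      empties n T (Suc j))"
    using IH(1,2) b nc by (auto simp: T r)
  moreover have "n < T (Suc j) \<longrightarrow> T (Suc j) = Suc (n + empties n T j)"
    using IH(1,2) b nc by (auto simp: T)
  ultimately show ?case
    unfolding split using IH(3,4) nc by simp
qed

lemma ordered_bottom_edge:
  assumes nv: "nonvanishing n S" and "i \<le> n"
  shows "ordered n (bottom_edge n S i)"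
  using \<open>i \<le> n\<close>
proof (induction i rule: inc_induct)
  case base
  have "bottom_edge n S n = (+) n"
    by (simp add: fun_eq_iff)
  moreover have "empties n ((+) n) j = j" for j
    by (induction j) simp_all
  ultimately show ?case
    by (simp add: ordered_def)
next
  case (step i)
  have "Suc i \<in> {1..n}"
    using step by auto
  from row_order[OF this step.IH nv order_refl] show ?case
    by (simp add: ordered_def)
qed

text \<open>Excluding the crossings of weight zero keeps the empty strands in order along every row.
  Two empty strands that meet then have consecutive labels, so no two of them cross at all.\<close>

lemma nonvanishing_iff: "nonvanishing n S \<longleftrightarrow> no_empty_crossing n S"
proof
  assume nv: "nonvanishing n S"
  show "no_empty_crossing n S"
    unfolding no_empty_crossing_def
  proof (intro ballI)
    fix i j assume ij: "i \<in> {1..n}" "j \<in> {1..n}"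
    then have "ordered n (bottom_edge n S i)"
      by (intro ordered_bottom_edge[OF nv]) auto
    from row_order[OF ij(1) this nv, of j] ij(2)
    show "\<not> ((i, j) \<in> S \<and> n < left_edge n S i j \<and> n < bottom_edge n S i j)"
      by auto
  qed
next
  assume nc: "no_empty_crossing n S"
  show "nonvanishing n S"
    unfolding nonvanishing_def
  proof (intro ballI)
    fix i j assume ij: "i \<in> {1..n}" "j \<in> {1..n}"
    have "\<not> ((i, j) \<in> S \<and> n < left_edge n S i j \<and> n < bottom_edge n S i j)"
      using nc ij unfolding no_empty_crossing_def by blast
    then show "\<not> ((i, j) \<in> S \<and> n < left_edge n S i j \<and> bottom_edge n S i j = Suc
        (left_edge n S i j))"
      by auto
  qed
qed

text \<open>The third equation is the source of the shift in the weights of I and F: an empty strand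
  entering a tile from the left is included in the count along the bottom edges, but not in the
  count along the top edges.\<close>

lemma edge_labels:
  assumes nc: "no_empty_crossing n S" and ij: "i \<in> {1..n}" "j \<in> {1..n}"
  shows "n < left_edge n S i j \<Longrightarrow> left_edge n S i j = Suc (n + empties n
      (bottom_edge n S (i - 1)) (j - 1))"
    and "n < bottom_edge n S i j \<Longrightarrow> bottom_edge n S i j = Suc (n + empties n
        (bottom_edge n S i) (j - 1))"
    and "empties n (bottom_edge n S i) (j - 1) =
      empties n (bottom_edge n S (i - 1)) (j - 1) + (if n < left_edge n S i j then 1 else 0)"
proof -
  have nv: "nonvanishing n S"
    using nc by (simp add: nonvanishing_iff)
  have ord: "ordered n (bottom_edge n S i)"
    using ij by (intro ordered_bottom_edge[OF nv]) auto
  obtain j' where j': "j = Suc j'"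
    using ij by (cases j) auto
  show "n < bottom_edge n S i j \<Longrightarrow> bottom_edge n S i j = Suc (n + empties n
      (bottom_edge n S i) (j - 1))"
    using ord ij by (simp add: ordered_def)
  show "n < left_edge n S i j \<Longrightarrow> left_edge n S i j = Suc (n + empties n
      (bottom_edge n S (i - 1)) (j - 1))"
    "empties n (bottom_edge n S i) (j - 1) =
      empties n (bottom_edge n S (i - 1)) (j - 1) + (if n < left_edge n S i j then 1 else 0)"
    using row_order[OF ij(1) ord nv, of j'] ij(2) by (simp_all add: j')
qed

section \<open>Generic pipe dreams as configurations of the state sum\<close>

section \<open>Generic pipe dreams as sets of crossings\<close>

text \<open>Once the empty strands are coloured, H and I are crossings with an empty strand, like X,
  whereas J, F and O are bounces, like B. The empty tile does not record the first argument.\<close>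

fun tile_of :: "bool \<Rightarrow> bool \<Rightarrow> bool \<Rightarrow> tile" where
  "tile_of x True True = (if x then TX else TB)"
| "tile_of x True False = (if x then TH else TJ)"
| "tile_of x False True = (if x then TI else TF)"
| "tile_of x False False = TO"

lemma tile_of_sides:
  "has_left (tile_of x l b) = l" "has_bottom (tile_of x l b) = b"
  "has_right (tile_of x l b) = (if x then l else b)" "has_top (tile_of x l b) =
      (if x then b else l)"
  by (cases l; cases b; cases x; simp add: has_left_def has_bottom_def has_right_def has_top_def)+

lemma tile_of_collapse: "tile_of (t \<in> {TX, TH, TI}) (has_left t) (has_bottom t) = t"
  by (cases t) (simp_all add: has_left_def has_bottom_def)

lemma tile_of_crossing: "x \<Longrightarrow> l \<or> b \<Longrightarrow> tile_of x l b \<in> {TX, TH, TI}"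
  "tile_of x l b \<in> {TX, TH, TI} \<Longrightarrow> x"
  by (cases l; cases b; cases x; simp)+

definition gpd_of :: "nat \<Rightarrow> (nat \<times> nat) set \<Rightarrow> nat \<Rightarrow> nat
    \<Rightarrow> tile" where
  "gpd_of n S i j = (if (i, j) \<in> grid n
     then tile_of ((i, j) \<in> S) (left_edge n S i j \<le> n) (bottom_edge n S i j \<le> n) else TO)"

definition crossings_of :: "(nat \<Rightarrow> nat \<Rightarrow> tile) \<Rightarrow> (nat \<times> nat)
    set" where
  "crossings_of \<pi> = {(i, j). \<pi> i j \<in> {TX, TH, TI}}"

text \<open>The configurations that correspond to generic pipe dreams, with the permutation left
  open.\<close>

locale tiling =
  fixes n :: nat and S :: "(nat \<times> nat) set"
  assumes nc: "no_empty_crossing n S"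
    and exits: "\<And>i. i \<in> {1..n} \<Longrightarrow> n < left_edge n S i (Suc n)"
begin

abbreviation "L \<equiv> left_edge n S"
abbreviation "B \<equiv> bottom_edge n S"
abbreviation "\<pi> \<equiv> gpd_of n S"

lemma tile:
  assumes "i \<in> {1..n}" "j \<in> {1..n}"
  shows "\<pi> i j = tile_of ((i, j) \<in> S) (L i j \<le> n) (B i j \<le> n)"
  using assms by (simp add: gpd_of_def grid_def)

text \<open>The number in mind counts empty columns to the left: those on the top edges of the row
  for a pipe entering from the left, those on the bottom edges for a pipe entering from below. An H
  tile adds the empty column that it passes. Going up through an I tile changes from bottom to top
  edges while an empty strand comes in from the left, so the count drops by one.\<close>

lemma walk_edge:
  assumes "walk n \<pi> p i j d c"
  shows "i \<in> {1..n} \<and> j \<in> {1..n} \<and> p \<le> n \<and>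
    (case d of FromLeft \<Rightarrow> L i j = p \<and> c = int (empties n (B (i - 1)) (j - 1))
     | FromBottom \<Rightarrow> B i j = p \<and> c = int (empties n (B i) (j - 1)))"
  using assms
proof induction
  case (source p)
  then show ?case by auto
next
  case (right p i j d c)
  then have ij: "i \<in> {1..n}" "j \<in> {1..n}" and p: "p \<le> n"
    by auto
  obtain j' where j': "j = Suc j'"
    using ij by (cases j) auto
  have LS: "L i (Suc j) = (if (i, j) \<in> S then L i j else B i j)"
    using ij by (intro left_edge_Suc) auto
  have T: "B (i - 1) j = (if (i, j) \<in> S then B i j else L i j)"
    by (rule bottom_edge_pred[OF ij(1)])
  note count = edge_labels(3)[OF nc ij]
  have main: "L i (Suc j) = p \<and> c + increment (\<pi> i j) = int (empties n (B (i - 1)) j)"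
    using right.hyps(2) right.IH p count LS T tile[OF ij] unfolding j'
    by (cases d; cases "(i, Suc j') \<in> S"; cases "L i (Suc j') \<le> n"; cases "B i (Suc j') \<le> n")
      (auto simp: increment_def)
  \<comment> \<open>Column n is never left to the right by a pipe, since every edge on the right
    boundary carries an empty strand.\<close>
  moreover have "j \<noteq> n"
    using main p exits[OF ij(1)] by auto
  ultimately show ?case
    using ij p by auto
next
  case (up p i j d c)
  then have ij: "Suc i \<in> {1..n}" "j \<in> {1..n}" and p: "p \<le> n"
    by auto
  have T: "B i j = (if (Suc i, j) \<in> S then B (Suc i) j else L (Suc i) j)"
    using ij by (intro bottom_edge_step) auto
  note count = edge_labels(3)[OF nc ij]
  have "B i j = p \<and> c + increment (\<pi> (Suc i) j) = int (empties n (B i) (j - 1))"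
    using up.hyps(3) up.IH p count T unfolding tile[OF ij]
    by (cases d; cases "(Suc i, j) \<in> S"; cases "L (Suc i) j \<le> n"; cases "B (Suc i) j \<le> n")
      (auto simp: increment_def)
  then show ?case
    using ij p up.hyps(2) by auto
qed

lemma exits_right_iff:
  assumes "i \<in> {1..n}" "j \<in> {1..n}"
  shows "L i j \<le> n \<Longrightarrow> exits_right FromLeft (\<pi> i j) \<longleftrightarrow> (i, j) \<in> S"
    and "B i j \<le> n \<Longrightarrow> exits_right FromBottom (\<pi> i j) \<longleftrightarrow> (i, j) \<notin> S"
    and "L i j \<le> n \<Longrightarrow> exits_top FromLeft (\<pi> i j) \<longleftrightarrow> (i, j) \<notin> S"
    and "B i j \<le> n \<Longrightarrow> exits_top FromBottom (\<pi> i j) \<longleftrightarrow> (i, j) \<in> S"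
  unfolding tile[OF assms]
  by (cases "(i, j) \<in> S"; cases "L i j \<le> n"; cases "B i j \<le> n"; simp)+

lemma walk_left_edge:
  assumes i: "i \<in> {1..n}"
    and bottom: "\<And>j. j \<in> {1..n} \<Longrightarrow> B i j \<le> n \<Longrightarrow> \<exists>c. walk n \<pi>
        (B i j) i j FromBottom c"
    and "j \<in> {1..n}" "L i j \<le> n"
  shows "\<exists>c. walk n \<pi> (L i j) i j FromLeft c"
proof -
  have "1 \<le> j"
    using assms by simp
  then show ?thesis
    using assms(3,4)
  proof (induction j rule: dec_induct)
    case base
    then show ?case
      using walk.source[OF i] by auto
  next
    case (step j)
    then have j: "j \<in> {1..n}"
      by auto
    have LS: "L i (Suc j) = (if (i, j) \<in> S then L i j else B i j)"
      using j by (intro left_edge_Suc) auto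
    show ?case
    proof (cases "(i, j) \<in> S")
      case True
      then have "L i j \<le> n"
        using step.prems LS by simp
      with step.IH[OF j this] True exits_right_iff(1)[OF i j] show ?thesis
        using walk.right by (metis LS)
    next
      case False
      then have "B i j \<le> n"
        using step.prems LS by simp
      with bottom[OF j this] False exits_right_iff(2)[OF i j] show ?thesis
        using walk.right by (metis LS)
    qed
  qed
qed

text \<open>Existence of walks goes upward from the bottom row, where all bottom edges are empty;
  within a row \<open>walk_left_edge\<close> follows the left edges from the source.\<close>

lemma walk_bottom_edge:
  assumes "i \<le> n" "1 \<le> i" "j \<in> {1..n}" "B i j \<le> n"
  shows "\<exists>c. walk n \<pi> (B i j) i j FromBottom c"
  using assms
proof (induction i arbitrary: j rule: inc_induct)
  case base
  then show ?case by simp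
next
  case (step i)
  have i: "Suc i \<in> {1..n}"
    using step.hyps by auto
  have T: "B i j = (if (Suc i, j) \<in> S then B (Suc i) j else L (Suc i) j)"
    using step.hyps by (intro bottom_edge_step) auto
  show ?case
  proof (cases "(Suc i, j) \<in> S")
    case True
    then have "B (Suc i) j \<le> n"
      using step.prems T by simp
    with step.IH[OF _ step.prems(2) this] True exits_right_iff(4)[OF i step.prems(2)] show ?thesis
      using walk.up[OF _ step.prems(1)] by (metis T le_add1 plus_1_eq_Suc)
  next
    case False
    then have *: "L (Suc i) j \<le> n"
      using step.prems T by simp
    have "\<exists>c. walk n \<pi> (L (Suc i) j) (Suc i) j FromLeft c"
      by (rule walk_left_edge[OF i _ step.prems(2) *]) (rule step.IH, simp)
    with * False exits_right_iff(3)[OF i step.prems(2)] show ?thesis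
      using walk.up[OF _ step.prems(1)] by (metis T)
  qed
qed

lemma walk_left_iff:
  assumes "i \<in> {1..n}" "j \<in> {1..n}" "L i j \<le> n"
  shows "walk n \<pi> p i j FromLeft c \<longleftrightarrow> p = L i j \<and> c = int (empties n (B (i - 1)) (j - 1))"
proof -
  have "\<exists>c. walk n \<pi> (L i j) i j FromLeft c"
    using assms walk_bottom_edge by (intro walk_left_edge) auto
  then show ?thesis
    using walk_edge by fastforce
qed

lemma walk_bottom_iff:
  assumes "i \<in> {1..n}" "j \<in> {1..n}" "B i j \<le> n"
  shows "walk n \<pi> p i j FromBottom c \<longleftrightarrow> p = B i j \<and> c = int (empties n (B i) (j - 1))"
proof -
  have "\<exists>c. walk n \<pi> (B i j) i j FromBottom c"
    using assms by (intro walk_bottom_edge) auto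
  then show ?thesis
    using walk_edge by fastforce
qed

text \<open>The edge labels determine pipes and levels. In a tile with one pipe the level can come
  only from that pipe, so its definite description is resolved by \<open>walk_edge\<close>.\<close>

lemma tile_weight_eq:
  assumes ij: "i \<in> {1..n}" "j \<in> {1..n}"
  shows "tile_weight n \<pi> i j = vertex n ((i, j) \<in> S) (L i j) (B i j) (var (Y j) - var (X i))"
proof -
  note labels = edge_labels[OF nc ij]
  have left: "pipe_from n \<pi> i j FromLeft = L i j" if "L i j \<le> n"
    unfolding pipe_from_def using walk_left_iff[OF ij that] by (intro the_equality) blast+
  have bottom: "pipe_from n \<pi> i j FromBottom = B i j" if "B i j \<le> n"
    unfolding pipe_from_def using walk_bottom_iff[OF ij that] by (intro the_equality) blast+
  have level_left: "level n \<pi> i j = int (empties n (B (i - 1)) (j - 1))" if "L i j \<le> n" "n < B i j"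
    unfolding level_def
  proof (rule the_equality)
    show "\<exists>p d. walk n \<pi> p i j d (int (empties n (B (i - 1)) (j - 1)))"
      using walk_left_iff[OF ij that(1)] by blast
    fix c assume "\<exists>p d. walk n \<pi> p i j d c"
    then obtain p d where *: "walk n \<pi> p i j d c"
      by blast
    then show "c = int (empties n (B (i - 1)) (j - 1))"
      using walk_edge[OF *] that by (cases d) auto
  qed
  have level_bottom: "level n \<pi> i j = int (empties n (B i) (j - 1))" if "n < L i j" "B i j \<le> n"
    unfolding level_def
  proof (rule the_equality)
    show "\<exists>p d. walk n \<pi> p i j d (int (empties n (B i) (j - 1)))"
      using walk_bottom_iff[OF ij that(2)] by blast
    fix c assume "\<exists>p d. walk n \<pi> p i j d c"
    then obtain p d where *: "walk n \<pi> p i j d c"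
      by blast
    then show "c = int (empties n (B i) (j - 1))"
      using walk_edge[OF *] that by (cases d) auto
  qed
  have nc': "\<not> ((i, j) \<in> S \<and> n < L i j \<and> n < B i j)"
    using nc ij by (auto simp: no_empty_crossing_def)
  consider "L i j \<le> n" "B i j \<le> n" | "L i j \<le> n" "n < B i j" | "n < L i j" "B i j \<le> n" |
      "n < L i j" "n < B i j"
    by linarith
  then show ?thesis
  proof cases
    case 1
    then show ?thesis
      by (simp add: tile_weight_def Let_def tile[OF ij] vertex_def left bottom colour_def)
  next
    case 2
    have "int (B i j) - int n - 1 = int (empties n (B (i - 1)) (j - 1))"
      using labels(2)[OF 2(2)] labels(3) 2 by simp
    with 2 show ?thesis
      by (simp add: tile_weight_def Let_def tile[OF ij] vertex_def left level_left colour_def)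
  next
    case 3
    \<comment> \<open>The level counts along the bottom edges and so includes the strand entering
      from the left; the index of that strand is the level minus 1.\<close>
    have "int (L i j) - int n - 1 = int (empties n (B i) (j - 1)) - 1"
      using labels(1)[OF 3(1)] labels(3) 3 by simp
    with 3 show ?thesis
      by (simp add: tile_weight_def Let_def tile[OF ij] vertex_def bottom level_bottom colour_def)
  next
    case 4
    \<comment> \<open>An empty tile is a bounce of two neighbouring empty strands, with weight
      P(-hbar, z) = 1.\<close>
    have "B i j = Suc (L i j)"
      using labels(1)[OF 4(1)] labels(2)[OF 4(2)] labels(3) 4 by simp
    then have "colour n (L i j) - colour n (B i j) = (- hbar :: xyvar lattice)"
      using 4 by (simp add: colour_def flip: frag_cmul_diff_distrib)
    moreover have "(i, j) \<notin> S"
      using nc' 4 by blast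
    ultimately show ?thesis
      using 4 by (simp add: tile_weight_def Let_def tile[OF ij] vertex_def PQ_at_minus_hbar)
  qed
qed

end

section \<open>The bijection\<close>

lemma connects_exits:
  assumes w: "w \<in> Sym n" and "connects n w S"
  shows "\<And>i. i \<in> {1..n} \<Longrightarrow> n < left_edge n S i (Suc n)"
    and "\<And>j. j \<in> {1..n} \<Longrightarrow> bottom_edge n S 0 j = inv w j"
proof -
  have "w permutes {1..n}"
    using w by simp
  then have win: "w p \<in> {1..n} \<longleftrightarrow> p \<in> {1..n}" for p
    by (rule permutes_in_image)
  have *: "bottom_edge n S 0 (w p) = p" if "p \<in> {1..n}" for p
    using assms(2) that by (simp add: connects_def)
  show "n < left_edge n S i (Suc n)" if "i \<in> {1..n}" for i
    using * win by (intro right_exit[OF that]) blast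
  show "bottom_edge n S 0 j = inv w j" if "j \<in> {1..n}" for j
    using *[OF Sym_inv_apply(1)[OF w that]] by (simp only: Sym_inv_apply(2)[OF w])
qed

lemma tiling_connects: "w \<in> Sym n \<Longrightarrow> connects n w S \<Longrightarrow>
    no_empty_crossing n S \<Longrightarrow> tiling n S"
  by (rule tiling.intro) (use connects_exits in auto)

lemma gpd_of_GPD:
  assumes w: "w \<in> Sym n" and con: "connects n w S" and nc: "no_empty_crossing n S"
  shows "gpd_of n S \<in> GPD n w"
proof -
  interpret tiling n S
    by (rule tiling_connects) fact+
  have top: "bottom_edge n S 0 j \<in> {1..n}" if "j \<in> {1..n}" for j
    using connects_exits(2)[OF w con that] Sym_inv_apply(1)[OF w that] by simp
  have T: "B 0 j = (if (Suc 0, j) \<in> S then B (Suc 0) j else L (Suc 0) j)" if "j \<in> {1..n}" for j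
    using bottom_edge_step[of 0 n S j] that by auto
  have "generic_pipe_dream n \<pi>"
    unfolding generic_pipe_dream_def
  proof (intro conjI allI ballI impI)
    show "\<pi> i j = TO" if "\<not> (i \<in> {1..n} \<and> j \<in> {1..n})" for i j
      using that by (auto simp: gpd_of_def grid_def)
    show "has_right (\<pi> i j) = has_left (\<pi> i (Suc j))" if "i \<in> {1..n}" "j \<in> {1..<n}" for i j
      using that left_edge_Suc[of j n S i] by (simp add: tile tile_of_sides)
    show "has_bottom (\<pi> i j) = has_top (\<pi> (Suc i) j)" if "i \<in> {1..<n}" "j \<in> {1..n}" for i j
      using that bottom_edge_step[of i n S j] by (simp add: tile tile_of_sides)
    show "has_left (\<pi> i 1)" if "i \<in> {1..n}" for i
      using that by (simp add: tile tile_of_sides)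
    show "\<not> has_right (\<pi> i n)" if "i \<in> {1..n}" for i
      using that exits[OF that] left_edge_Suc[of n n S i] by
          (simp add: tile tile_of_sides split: if_splits)
    show "has_top (\<pi> 1 j)" if "j \<in> {1..n}" for j
      using that top[OF that] T[OF that] by (auto simp: tile tile_of_sides split: if_splits)
    show "\<not> has_bottom (\<pi> n j)" if "j \<in> {1..n}" for j
      using that by (simp add: tile tile_of_sides)
  qed
  moreover have "\<exists>d c. walk n \<pi> i 1 (w i) d c \<and> exits_top d (\<pi> 1 (w i))" if i: "i \<in> {1..n}" for i
  proof -
    have wi: "w i \<in> {1..n}" and 1: "Suc 0 \<in> {1..n}"
      using i w permutes_in_image[of w "{1..n}" i] by auto
    have Bi: "B 0 (w i) = i"
      using con i by (simp add: connects_def)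
    show ?thesis
    proof (cases "(Suc 0, w i) \<in> S")
      case True
      then have "B (Suc 0) (w i) = i"
        using Bi T[OF wi] by simp
      then have "\<exists>c. walk n \<pi> i 1 (w i) FromBottom c" "exits_top FromBottom (\<pi> 1 (w i))"
        using walk_bottom_iff[OF 1 wi] exits_right_iff(4)[OF 1 wi] True i by simp_all
      then show ?thesis by blast
    next
      case False
      then have "L (Suc 0) (w i) = i"
        using Bi T[OF wi] by simp
      then have "\<exists>c. walk n \<pi> i 1 (w i) FromLeft c" "exits_top FromLeft (\<pi> 1 (w i))"
        using walk_left_iff[OF 1 wi] exits_right_iff(3)[OF 1 wi] False i by simp_all
      then show ?thesis by blast
    qed
  qed
  ultimately show ?thesis
    by (simp add: GPD_def)
qed

text \<open>Information could be lost only at empty tiles in S, and \<open>no_empty_crossing\<close>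
  rules these out.\<close>

lemma crossings_of_gpd_of:
  assumes "S \<subseteq> grid n" "no_empty_crossing n S"
  shows "crossings_of (gpd_of n S) = S"
proof -
  have "gpd_of n S i j \<in> {TX, TH, TI} \<longleftrightarrow> (i, j) \<in> S" for i j
  proof (cases "(i, j) \<in> grid n")
    case True
    show ?thesis
    proof
      assume "(i, j) \<in> S"
      with True assms(2) have "left_edge n S i j \<le> n \<or> bottom_edge n S i j \<le> n"
        by (auto simp: no_empty_crossing_def grid_def not_less)
      with True \<open>(i, j) \<in> S\<close> show "gpd_of n S i j \<in> {TX, TH, TI}"
        unfolding gpd_of_def by (simp only: if_True tile_of_crossing(1))
    next
      assume "gpd_of n S i j \<in> {TX, TH, TI}"
      with True show "(i, j) \<in> S"
        unfolding gpd_of_def using tile_of_crossing(2) by (simp only: if_True)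
    qed
  next
    case False
    then show ?thesis
      using assms(1) by (auto simp: gpd_of_def)
  qed
  then show ?thesis
    by (auto simp: crossings_of_def)
qed

text \<open>Labels at most n sit exactly on the edges of \<pi> that carry a pipe: this holds on the
  left and bottom boundary and is propagated from tile to tile. The tiles of \<pi> are then
  recovered from S, and its walks follow the labels.\<close>

lemma GPD_crossings:
  assumes w: "w \<in> Sym n" and \<pi>: "\<pi> \<in> GPD n w"
  defines "S \<equiv> crossings_of \<pi>"
  shows "S \<subseteq> grid n" "gpd_of n S = \<pi>" "no_empty_crossing n S" "connects n w S"
proof -
  have gpd: "generic_pipe_dream n \<pi>"
    using \<pi> by (simp add: GPD_def)
  then have out: "\<pi> i j = TO" if "\<not> (i \<in> {1..n} \<and> j \<in> {1..n})" for i j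
    using that unfolding generic_pipe_dream_def by blast
  have hor: "has_right (\<pi> i j) = has_left (\<pi> i (Suc j))" if "i \<in> {1..n}" "j \<in> {1..<n}" for i j
    using gpd that unfolding generic_pipe_dream_def by blast
  have ver: "has_bottom (\<pi> i j) = has_top (\<pi> (Suc i) j)" if "i \<in> {1..<n}" "j \<in> {1..n}" for i j
    using gpd that unfolding generic_pipe_dream_def by blast
  have bdry: "has_left (\<pi> i 1)" "\<not> has_right (\<pi> i n)" "has_top (\<pi> 1 i)" "\<not> has_bottom (\<pi> n i)"
    if "i \<in> {1..n}" for i
    using gpd that unfolding generic_pipe_dream_def by blast+
  have S: "(i, j) \<in> S \<longleftrightarrow> \<pi> i j \<in> {TX, TH, TI}" for i j
    by (simp add: S_def crossings_of_def)
  have sides: "has_right t = (if t \<in> {TX, TH, TI} then has_left t else has_bottom t)"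
    "has_top t = (if t \<in> {TX, TH, TI} then has_bottom t else has_left t)" for t
    by (cases t; simp add: has_left_def has_bottom_def has_right_def has_top_def)+
  have left: "left_edge n S i j \<le> n \<longleftrightarrow> has_left (\<pi> i j)"
    if i: "i \<in> {1..n}" and bot: "\<And>j. j \<in> {1..n} \<Longrightarrow>
        bottom_edge n S i j \<le> n \<longleftrightarrow> has_bottom (\<pi> i j)"
      and j: "j \<in> {1..n}" for i j
  proof -
    have "1 \<le> j"
      using j by simp
    then show ?thesis
      using j
    proof (induction j rule: dec_induct)
      case base
      then show ?case
        using bdry(1)[OF i] i by simp
    next
      case (step j)
      then have j: "j \<in> {1..n}" "j \<in> {1..<n}"
        by auto
      show ?case
        using step.IH[OF j(1)] bot[OF j(1)] left_edge_Suc[of j n S i] hor[OF i j(2)] j sides(1)[of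
            "\<pi> i j"] S[of i j]
        by auto
    qed
  qed
  have bottom: "bottom_edge n S i j \<le> n \<longleftrightarrow> has_bottom (\<pi> i j)" if "i \<le> n" "1 \<le> i" "j \<in> {1..n}"
      for i j
    using that
  proof (induction i arbitrary: j rule: inc_induct)
    case base
    then show ?case
      using bdry(4) by simp
  next
    case (step i)
    then have i: "Suc i \<in> {1..n}" "i \<in> {1..<n}"
      by auto
    have IH: "bottom_edge n S (Suc i) j \<le> n \<longleftrightarrow> has_bottom (\<pi> (Suc i) j)" if "j \<in> {1..n}" for j
      using step.IH that by simp
    have l: "left_edge n S (Suc i) j \<le> n \<longleftrightarrow> has_left (\<pi> (Suc i) j)"
      by (rule left[OF i(1) IH step.prems(2)])
    show ?case
      using l IH[OF step.prems(2)] bottom_edge_step[of i n S j] ver[OF i(2) step.prems(2)] i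
        sides(2)[of "\<pi> (Suc i) j"] S[of "Suc i" j] by auto
  qed
  have edges: "left_edge n S i j \<le> n \<longleftrightarrow> has_left (\<pi> i j)" "bottom_edge n S i j \<le> n \<longleftrightarrow> has_bottom
      (\<pi> i j)"
    if "i \<in> {1..n}" "j \<in> {1..n}" for i j
    using that bottom left[OF that(1) _ that(2)] by auto
  show sub: "S \<subseteq> grid n"
  proof (rule subrelI)
    fix i j assume "(i, j) \<in> S"
    then have "\<pi> i j \<noteq> TO"
      using S[of i j] by auto
    then show "(i, j) \<in> grid n"
      using out[of i j] by (auto simp: grid_def)
  qed
  show eq: "gpd_of n S = \<pi>"
  proof (intro ext)
    fix i j
    show "gpd_of n S i j = \<pi> i j"
    proof (cases "i \<in> {1..n} \<and> j \<in> {1..n}")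
      case True
      then show ?thesis
        using tile_of_collapse[of "\<pi> i j"] edges[of i j] S[of i j] by
            (simp add: gpd_of_def grid_def)
    next
      case False
      then show ?thesis
        unfolding gpd_of_def grid_def using out[OF False] by auto
    qed
  qed
  show nc: "no_empty_crossing n S"
    unfolding no_empty_crossing_def
  proof (intro ballI notI)
    fix i j assume ij: "i \<in> {1..n}" "j \<in> {1..n}"
      and *: "(i, j) \<in> S \<and> n < left_edge n S i j \<and> n < bottom_edge n S i j"
    then have "\<not> has_left (\<pi> i j)" "\<not> has_bottom (\<pi> i j)" "\<pi> i j \<in> {TX, TH, TI}"
      using edges[OF ij] S by auto
    then show False
      by (auto simp: has_left_def has_bottom_def)
  qed
  interpret tiling n S
  proof
    fix i assume i: "i \<in> {1..n}"
    then have n: "n \<in> {1..n}"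
      by auto
    show "n < left_edge n S i (Suc n)"
      using left_edge_Suc[of n n S i] bdry(2)[OF i] edges[OF i n] sides(1)[of "\<pi> i n"] S[of i n] n
          by auto
  qed (rule nc)
  show "connects n w S"
    unfolding connects_def
  proof
    fix i assume i: "i \<in> {1..n}"
    then obtain d c where walk: "walk n \<pi> i 1 (w i) d c" "exits_top d (\<pi> 1 (w i))"
      using \<pi> unfolding GPD_def by blast
    have wi: "w i \<in> {1..n}" and 1: "Suc 0 \<in> {1..n}"
      using i w permutes_in_image[of w "{1..n}" i] by auto
    have T: "bottom_edge n S 0 (w i) = (if (Suc 0, w i) \<in> S then bottom_edge n S (Suc 0) (w i)
        else left_edge n S (Suc 0) (w i))"
      using bottom_edge_step[of 0 n S "w i"] i by auto
    show "bottom_edge n S 0 (w i) = i"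
    proof (cases d)
      case FromLeft
      then have "left_edge n S (Suc 0) (w i) = i"
        using walk_edge[of i 1 "w i" d c] walk(1) unfolding eq by simp
      moreover have "(Suc 0, w i) \<notin> S"
        using exits_right_iff(3)[OF 1 wi] walk(2) calculation i unfolding eq FromLeft by simp
      ultimately show ?thesis
        using T by simp
    next
      case FromBottom
      then have "bottom_edge n S (Suc 0) (w i) = i"
        using walk_edge[of i 1 "w i" d c] walk(1) unfolding eq by simp
      moreover have "(Suc 0, w i) \<in> S"
        using exits_right_iff(4)[OF 1 wi] walk(2) calculation i unfolding eq FromBottom by simp
      ultimately show ?thesis
        using T by simp
    qed
  qed
qed

lemma sum_GPD:
  assumes "w \<in> Sym n"
  shows "(\<Sum>\<pi>\<in>GPD n w. f \<pi>) =
    (\<Sum>S\<in>{S \<in> Pow (grid n). connects n w S \<and> no_empty_crossing n S}. f (gpd_of n S))"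
  by (rule sum.reindex_bij_witness[where i = "gpd_of n" and j = crossings_of])
    (use GPD_crossings[OF assms] gpd_of_GPD[OF assms] crossings_of_gpd_of in auto)

text \<open>If two empty strands cross somewhere, then by \<open>nonvanishing_iff\<close> two
  strands with consecutive labels cross somewhere, and that tile contributes Q(-hbar, z) =
  0.\<close>

lemma partition_fun_eq:
  assumes w: "w \<in> Sym n"
  shows "partition_fun n u w =
    (\<Sum>S\<in>{S \<in> Pow (grid n). connects n w S \<and> no_empty_crossing n S}.
      \<Prod>i=1..n. \<Prod>j=1..n. vertex n ((i, j) \<in> S) (left_edge n S i j)
          (bottom_edge n S i j) (var j - var (u i)))"
proof -
  let ?p = "\<lambda>S. \<Prod>i=1..n. \<Prod>j=1..n. vertex n ((i, j) \<in> S) (left_edge n S i j)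
      (bottom_edge n S i j)
      (var j - var (u i) :: nat lattice)"
  have "?p S = 0" if empty: "\<not> no_empty_crossing n S" for S
  proof -
    obtain i j where ij: "i \<in> {1..n}" "j \<in> {1..n}"
      and *: "(i, j) \<in> S" "n < left_edge n S i j" "bottom_edge n S i j = Suc (left_edge n S i j)"
      using empty unfolding nonvanishing_iff [symmetric] nonvanishing_def by blast
    have "colour n (left_edge n S i j) - colour n (bottom_edge n S i j) = (- hbar :: nat lattice)"
      using * by (simp add: colour_def flip: frag_cmul_diff_distrib)
    then have "vertex n ((i, j) \<in> S) (left_edge n S i j) (bottom_edge n S i j) (var j - var (u i)
        :: nat lattice) = 0"
      using *(1) by (simp add: vertex_def PQ_at_minus_hbar)
    then show ?thesis
      using ij by (intro prod_zero bexI[of _ i] bexI[of _ j]) auto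
  qed
  then have "partition_fun n u w = (\<Sum>S\<in>Pow (grid n). if connects n w S \<and>
      no_empty_crossing n S then ?p S else 0)"
    unfolding partition_fun_expand[OF w] by (intro sum.cong) auto
  also have "\<dots> = (\<Sum>S\<in>{S \<in> Pow (grid n). connects n w S \<and> no_empty_crossing n S}. ?p S)"
    by (rule sum.inter_filter [symmetric]) (simp add: grid_def)
  finally show ?thesis .
qed

section \<open>Localization of the weighted sum\<close>

section \<open>Localization\<close>

definition admissible :: "nat \<Rightarrow> xyvar lattice \<Rightarrow> bool" where
  "admissible n \<mu> \<longleftrightarrow> Poly_Mapping.keys \<mu> \<subseteq>
     Var ` (X ` {1..n} \<union> Y ` {1..n}) \<union> Lam ` {1..n} \<union> {Hbar}"

lemma admissible_0: "admissible n 0"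
  and admissible_add: "admissible n \<mu> \<Longrightarrow> admissible n \<nu> \<Longrightarrow>
      admissible n (\<mu> + \<nu>)"
  and admissible_diff: "admissible n \<mu> \<Longrightarrow> admissible n \<nu> \<Longrightarrow>
      admissible n (\<mu> - \<nu>)"
  and admissible_cmul: "admissible n \<mu> \<Longrightarrow> admissible n (frag_cmul k \<mu>)"
  and admissible_minus: "admissible n \<mu> \<Longrightarrow> admissible n (- \<mu>)"
  unfolding admissible_def using keys_add[of \<mu> \<nu>] keys_diff[of \<mu> \<nu>] keys_cmul[of k \<mu>]
  by (simp, blast, blast, blast, simp)

definition galg_ring :: "nat \<Rightarrow> xyvar galg set" where
  "galg_ring n = {p. \<forall>\<mu>\<in>Poly_Mapping.keys p. admissible n \<mu>}"

lemma galg_ring_0: "0 \<in> galg_ring n"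
  by (simp add: galg_ring_def)

lemma galg_ring_add: "p \<in> galg_ring n \<Longrightarrow> q \<in> galg_ring n \<Longrightarrow> p +
    q \<in> galg_ring n"
  unfolding galg_ring_def using keys_add[of p q] by blast

lemma galg_ring_uminus: "p \<in> galg_ring n \<Longrightarrow> - p \<in> galg_ring n"
  unfolding galg_ring_def by (simp add: in_keys_iff)

lemma galg_ring_mult:
  assumes "p \<in> galg_ring n" "q \<in> galg_ring n"
  shows "p * q \<in> galg_ring n"
  unfolding galg_ring_def
proof safe
  fix \<mu> assume "\<mu> \<in> Poly_Mapping.keys (p * q)"
  then obtain a b where "\<mu> = a + b" "a \<in> Poly_Mapping.keys p" "b \<in> Poly_Mapping.keys q"
    using keys_mult[of p q] by blast
  with assms show "admissible n \<mu>"
    by (simp add: galg_ring_def admissible_add)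
qed

lemma galg_ring_ex: "admissible n \<mu> \<Longrightarrow> ex \<mu> \<in> galg_ring n"
  by (simp add: galg_ring_def ex_def)

lemma galg_ring_sum: "(\<And>i. i \<in> A \<Longrightarrow> f i \<in> galg_ring n) \<Longrightarrow>
    sum f A \<in> galg_ring n"
  by (induction A rule: infinite_finite_induct) (auto intro: galg_ring_0 galg_ring_add)

lemma poly_ring_iff: "f \<in> poly_ring n \<longleftrightarrow> (\<forall>k. fps_nth f k \<in> galg_ring n)"
  by (simp add: poly_ring_def galg_ring_def admissible_def)

lemma poly_ring_add: "f \<in> poly_ring n \<Longrightarrow> g \<in> poly_ring n \<Longrightarrow> f +
    g \<in> poly_ring n"
  by (simp add: poly_ring_iff galg_ring_add)

lemma poly_ring_diff: "f \<in> poly_ring n \<Longrightarrow> g \<in> poly_ring n \<Longrightarrow>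
    f - g \<in> poly_ring n"
  using galg_ring_add[OF _ galg_ring_uminus] by (simp add: poly_ring_iff)

lemma poly_ring_mult: "f \<in> poly_ring n \<Longrightarrow> g \<in> poly_ring n \<Longrightarrow> f *
    g \<in> poly_ring n"
  by (simp add: poly_ring_iff fps_mult_nth galg_ring_sum galg_ring_mult)

lemma poly_ring_const: "c \<in> galg_ring n \<Longrightarrow> fps_const c \<in> poly_ring n"
  by (simp add: poly_ring_iff galg_ring_0)

lemma galg_ring_1: "1 \<in> galg_ring n"
  using galg_ring_ex[OF admissible_0] by simp

lemma poly_ring_1: "1 \<in> poly_ring n"
  using poly_ring_const[OF galg_ring_1] by simp

lemma poly_ring_0: "0 \<in> poly_ring n"
  by (simp add: poly_ring_iff galg_ring_0)

lemma poly_ring_X_power: "fps_X ^ k \<in> poly_ring n"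
  by (simp add: poly_ring_iff fps_X_power_nth galg_ring_0 galg_ring_1)

lemma poly_ring_prod: "(\<And>i. i \<in> A \<Longrightarrow> f i \<in> poly_ring n) \<Longrightarrow>
    prod f A \<in> poly_ring n"
  by (induction A rule: infinite_finite_induct) (auto intro: poly_ring_1 poly_ring_mult)

lemma poly_ring_theta:
  assumes "admissible n u"
  shows "theta u \<in> poly_ring n"
proof -
  have "theta_fin u k \<in> poly_ring n" for k
    unfolding theta_fin_def fps_const_sub [symmetric] using assms
    by (intro poly_ring_mult poly_ring_prod poly_ring_diff poly_ring_1 poly_ring_X_power
        poly_ring_const galg_ring_ex admissible_minus admissible_cmul)
  moreover have "fps_nth (theta u) k = fps_nth (theta_fin u k) k" for k
    using theta_upto[of k k u] by (simp add: eq_upto_def)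
  ultimately show ?thesis
    by (simp add: poly_ring_iff)
qed

context
  fixes n :: nat
begin

lemma localizable_nonzero:
  assumes "\<forall>u\<in>Sym n. series_subst (loc_gen u) b \<noteq> 0"
  shows "b \<noteq> 0"
proof
  assume "b = 0"
  moreover have "series_subst (loc_gen id) b \<noteq> 0"
    using assms id_Sym by blast
  ultimately show False
    using frac_hom.h_0[OF frac_hom_series_subst, of "loc_gen id"] by simp
qed

lemma localizable_0: "localizable n 0" and localizable_1: "localizable n 1"
proof -
  have "series_subst (loc_gen u) 1 \<noteq> 0" for u
    using frac_hom.h_1[OF frac_hom_series_subst, of "loc_gen u"] by simp
  then show "localizable n 0" "localizable n 1"
    unfolding localizable_def Zero_fract_def One_fract_def
    using poly_ring_0[of n] poly_ring_1[of n] by blast+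
qed

lemma localizable_add:
  assumes "localizable n F" "localizable n G"
  shows "localizable n (F + G)"
proof -
  obtain a b c d where *: "a \<in> poly_ring n" "b \<in> poly_ring n" "F = Fract a b"
    "\<forall>u\<in>Sym n. series_subst (loc_gen u) b \<noteq> 0"
    "c \<in> poly_ring n" "d \<in> poly_ring n" "G = Fract c d"
    "\<forall>u\<in>Sym n. series_subst (loc_gen u) d \<noteq> 0"
    using assms unfolding localizable_def by blast
  have "F + G = Fract (a * d + c * b) (b * d)"
    using * localizable_nonzero by simp
  moreover have "\<forall>u\<in>Sym n. series_subst (loc_gen u) (b * d) \<noteq> 0"
    using *(4,8) by (simp add: frac_hom.h_mult[OF frac_hom_series_subst])
  moreover have "a * d + c * b \<in> poly_ring n" "b * d \<in> poly_ring n"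
    using * by (simp_all add: poly_ring_add poly_ring_mult)
  ultimately show ?thesis
    unfolding localizable_def by blast
qed

lemma localizable_mult:
  assumes "localizable n F" "localizable n G"
  shows "localizable n (F * G)"
proof -
  obtain a b c d where *: "a \<in> poly_ring n" "b \<in> poly_ring n" "F = Fract a b"
    "\<forall>u\<in>Sym n. series_subst (loc_gen u) b \<noteq> 0"
    "c \<in> poly_ring n" "d \<in> poly_ring n" "G = Fract c d"
    "\<forall>u\<in>Sym n. series_subst (loc_gen u) d \<noteq> 0"
    using assms unfolding localizable_def by blast
  have "F * G = Fract (a * c) (b * d)"
    using * by simp
  moreover have "\<forall>u\<in>Sym n. series_subst (loc_gen u) (b * d) \<noteq> 0"
    using *(4,8) by (simp add: frac_hom.h_mult[OF frac_hom_series_subst])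
  moreover have "a * c \<in> poly_ring n" "b * d \<in> poly_ring n"
    using * by (simp_all add: poly_ring_mult)
  ultimately show ?thesis
    unfolding localizable_def by blast
qed

lemma localizable_sum: "(\<And>i. i \<in> A \<Longrightarrow> localizable n (f i)) \<Longrightarrow>
    localizable n (sum f A)"
  by (induction A rule: infinite_finite_induct) (auto intro: localizable_0 localizable_add)

lemma localizable_prod: "(\<And>i. i \<in> A \<Longrightarrow> localizable n (f i)) \<Longrightarrow>
    localizable n (prod f A)"
  by (induction A rule: infinite_finite_induct) (auto intro: localizable_1 localizable_mult)

end

lemma gen_map_loc_colour: "gen_map (loc_gen u) (colour n a) = colour n a"
  by (simp add: colour_def frag_extend_cmul)

lemma colour_diff_ne: "a \<noteq> b \<Longrightarrow> colour n a - colour n b \<noteq> (0 :: 'v lattice)"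
  using inj_colour[of n] by (auto simp: inj_def)

lemma vertex_extends_to:
  assumes "a \<noteq> b"
  shows "frac_hom.extends_to (series_subst (loc_gen u)) (vertex n x a b (var (Y j) - var (X i)))
    (vertex n x a b (var j - var (u i)))"
proof -
  have "gen_map (loc_gen u) (colour n a - colour n b) = colour n a - colour n b"
    "gen_map (loc_gen u) (var (Y j) - var (X i)) = var j - var (u i)"
    by (simp_all add: gen_map_diff gen_map_loc_colour)
  then show ?thesis
    using extends_to_PQ[of "loc_gen u" "colour n a - colour n b" "var (Y j) - var (X i)"]
      colour_diff_ne[OF assms, of n, where 'v = nat] Hbar_coeff_ne(1)[of j "u i"]
    by (simp add: vertex_def)
qed

text \<open>The denominator survives every localization: hbar is independent of the z_i, so z_j -
  z_u(i) + hbar is nonzero, and distinct colours remain distinct.\<close>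

lemma vertex_localizable:
  assumes "a \<noteq> b" "1 \<le> a" "1 \<le> b" "i \<in> {1..n}" "j \<in> {1..n}"
  shows "localizable n (vertex n x a b (var (Y j) - var (X i)))"
proof -
  let ?y = "var (Y j) - var (X i)" and ?c = "colour n a - colour n b :: xyvar lattice"
  have h: "admissible n hbar"
    by (simp add: admissible_def)
  have col: "admissible n (colour n a)" if "1 \<le> a" for a
    using that h admissible_cmul by (auto simp: colour_def admissible_def)
  have c: "admissible n ?c"
    using assms by (intro admissible_diff col)
  have "admissible n (var (Y j))" "admissible n (var (X i))"
    using assms by (auto simp: admissible_def)
  then have y: "admissible n ?y"
    by (rule admissible_diff)
  let ?d = "theta (?y + hbar) * theta ?c"
  have d: "?d \<in> poly_ring n"
    using c y h by (intro poly_ring_mult poly_ring_theta admissible_add)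
  have "series_subst (loc_gen u) ?d \<noteq> 0" for u
  proof -
    have "gen_map (loc_gen u) ?c = colour n a - colour n b"
      "gen_map (loc_gen u) (?y + hbar) = var j - var (u i) + hbar"
      by (simp_all add: gen_map_diff gen_map_add gen_map_loc_colour)
    then have "series_subst (loc_gen u) ?d = theta (var j - var (u i) + hbar) * theta
        (colour n a - colour n b)"
      by (simp only: frac_hom.h_mult[OF frac_hom_series_subst] series_subst_theta)
    then show ?thesis
      using colour_diff_ne[OF assms(1), of n, where 'v = nat] Hbar_coeff_ne(1)[of j "u i"]
      by (simp only: mult_eq_0_iff theta_eq_0_iff) simp
  qed
  moreover have "theta (?c - ?y) * theta hbar \<in> poly_ring n"
    by (rule poly_ring_mult[OF poly_ring_theta[OF admissible_diff[OF c y]] poly_ring_theta[OF h]])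
  moreover have "theta (?c + hbar) * theta ?y \<in> poly_ring n"
    by (rule poly_ring_mult[OF poly_ring_theta[OF admissible_add[OF c h]] poly_ring_theta[OF y]])
  ultimately show ?thesis
    using d unfolding vertex_def Pfun_def Qfun_def localizable_def
    by (cases x) auto
qed

text \<open>Colour 0 stands for \<open>lam 0\<close>, which is outside the lattice of
  \<open>poly_ring n\<close>. It never occurs on an edge, as rows start with a label i and columns
  with a label n + j.\<close>

lemma edges_pos:
  assumes "i \<in> {1..n}" "j \<in> {1..n}"
  shows "1 \<le> left_edge n S i j" "1 \<le> bottom_edge n S i j"
proof -
  have hor: "1 \<le> hor S i a \<beta> j" if "1 \<le> a" "\<And>j. 1 \<le> j \<Longrightarrow> 1 \<le> \<beta> j" for i a \<beta> j
    using that by (induction j) auto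
  have bottoms: "1 \<le> bottoms S n id m j" if "m < n" "1 \<le> j" for m j
    using that
  proof (induction m arbitrary: j)
    case (Suc m)
    have b: "1 \<le> bottoms S n id m j" if "1 \<le> j" for j
      by (rule Suc.IH[OF Suc_lessD[OF Suc.prems(1)] that])
    have "1 \<le> id (n - m)"
      using Suc.prems(1) by simp
    then have h: "1 \<le> hor S (n - m) (id (n - m)) (bottoms S n id m) (j - 1)"
      by (rule hor[OF _ b])
    show ?case
      unfolding bottoms.simps top_edge_def using h b[OF Suc.prems(2)]
      by (cases "(n - m, j) \<in> S") (simp_all only: if_True if_False)
  qed simp
  show "1 \<le> bottom_edge n S i j"
    unfolding bottom_edge_def using assms by (intro bottoms) auto
  show "1 \<le> left_edge n S i j"
    unfolding left_edge_def
  proof (rule hor)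
    show "1 \<le> i"
      using assms by simp
    show "1 \<le> bottoms S n id (n - i) j" if "1 \<le> j" for j
      using assms that by (intro bottoms) auto
  qed
qed

theorem theorem1p2:
  fixes n :: nat and w :: "nat \<Rightarrow> nat"
  assumes "w permutes {1..n}"
  shows "polynomial_representative n (elliptic_class n w) (\<Sum>\<pi>\<in>GPD n w. gpd_weight n \<pi>)"
proof -
  have w: "w \<in> Sym n"
    using assms by simp
  let ?A = "{S \<in> Pow (grid n). connects n w S \<and> no_empty_crossing n S}"
  let ?v = "\<lambda>S i j. vertex n ((i, j) \<in> S) (left_edge n S i j) (bottom_edge n S i j)"
  have weight: "gpd_weight n (gpd_of n S) = (\<Prod>i=1..n. \<Prod>j=1..n. ?v S i j (var (Y j)
      - var (X i)))"
    if "S \<in> ?A" for S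
  proof -
    interpret tiling n S
      using that w by (intro tiling_connects) auto
    show ?thesis
      unfolding gpd_weight_def by (intro prod.cong refl tile_weight_eq)
  qed
  have sum: "(\<Sum>\<pi>\<in>GPD n w. gpd_weight n \<pi>) =
      (\<Sum>S\<in>?A. \<Prod>i=1..n. \<Prod>j=1..n. ?v S i j (var (Y j) - var (X i)))"
    unfolding sum_GPD[OF w] by (intro sum.cong refl weight)
  show ?thesis
    unfolding polynomial_representative_def
  proof
    show "localizable n (\<Sum>\<pi>\<in>GPD n w. gpd_weight n \<pi>)"
      unfolding sum
      by (intro localizable_sum localizable_prod vertex_localizable left_edge_ne_bottom_edge
          edges_pos)
    show "\<forall>u\<in>Sym n. Loc (\<Sum>\<pi>\<in>GPD n w. gpd_weight n \<pi>) u = elliptic_class n w u"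
    proof
      fix u assume u: "u \<in> Sym n"
      interpret frac_hom "series_subst (loc_gen u) :: xyvar series \<Rightarrow> nat series"
        by (rule frac_hom_series_subst)
      \<comment> \<open>Both sides are now the same state sum, with y_j - x_i on the left and z_j -
        z_u(i) on the right, so it suffices to localize each vertex.\<close>
      have "extends_to (\<Sum>\<pi>\<in>GPD n w. gpd_weight n \<pi>) (partition_fun n u w)"
        unfolding sum partition_fun_eq[OF w]
        by (intro extends_to_sum extends_to_prod vertex_extends_to left_edge_ne_bottom_edge)
      then have "Loc (\<Sum>\<pi>\<in>GPD n w. gpd_weight n \<pi>) u = partition_fun n u w"
        unfolding Loc_def by (rule frac_extend_eq)
      then show "Loc (\<Sum>\<pi>\<in>GPD n w. gpd_weight n \<pi>) u = elliptic_class n w u"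
        by (simp only: elliptic_class_def b_coeff_eq[OF u w])
    qed
  qed
qed

end
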